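(* Suppose $n=2^s$ or $n=3\cdot 2^s$, $n\ge 8$. Then the map $\varphi_n:\mathrm{PU}_2(R_n)\to\mathbb H_n^\times/F_n^\times$ defined below is an isomorphism onto $\widetilde{\mathcal M}_n^\times/\underline R_n^\times$ (the image of $\widetilde{\mathcal M}_n^\times$ in $\mathbb H_n^\times/F_n^\times$).
   Context: $\zeta_n=e^{2\pi i/n}$, $K_n={\mathbf Q}(\zeta_n)$, $F_n={\mathbf Q}(\zeta_n+\zeta_n^{-1})$, $R_n={\mathbf Z}[\zeta_n,1/2]$, $\underline R_n={\mathbf Z}[\zeta_n+\zeta_n^{-1},1/2]$. $\mathbb H_n=F_n\otimes_{\mathbf Q}\mathbb H$ with $\mathbb H$ the Hamilton quaternions over ${\mathbf Q}$ with basis $1,i,j,k$, $i^2=j^2=k^2=-1$, $ij=-ji=k$, and $\widetilde{\mathcal M}_n=\underline R_n\langle1,i,j,(1+i+j+k)/2\rangle$. $\mathrm{PU}_2(R_n)$ is the group of $2\times2$ unitary matrices over $R_n$ modulo scalars. Definition of $\varphi_n$: for $A\in\mathrm U_2(K_n)$ with class $[A]$, write $\det A=\bar\beta/\beta$ with $\beta\in K_n^\times$ (Hilbert 90); then $A'=\beta A$ has $\det A'=\beta\bar\beta\in F_n$ and is of the form $\begin{pmatrix} r+s\sqrt{-1}& t+u\sqrt{-1}\\ -t+u\sqrt{-1}& r-s\sqrt{-1}\end{pmatrix}$ with $r,s,t,u\in F_n$; set $\varphi_n([A])$ to be the class of $r-ui-tj-sk$ in $\mathbb H_n^\times/F_n^\times$.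 *)

theory Defs
  imports "HOL-Analysis.Analysis" "HOL-Computational_Algebra.Polynomial"
begin

definition zeta :: "nat \<Rightarrow> complex" where
  "zeta n = cis (2 * pi / real n)"

definition Kfld :: "nat \<Rightarrow> complex set" where
  "Kfld n = {poly (map_poly of_rat p) (zeta n) | p :: rat poly. True}"

text \<open>F_n = Q(zeta_n + zeta_n^{-1}); it is contained in the reals\<close>
definition Ffld :: "nat \<Rightarrow> complex set" where
  "Ffld n = {poly (map_poly of_rat p) (zeta n + inverse (zeta n)) | p :: rat poly. True}"

definition Freal :: "nat \<Rightarrow> real set" where
  "Freal n = {x. complex_of_real x \<in> Ffld n}"

definition Rring :: "nat \<Rightarrow> complex set" where
  "Rring n = {poly (map_poly of_int p) (zeta n) / 2 ^ k | (p :: int poly) (k :: nat). True}"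

definition Rbring :: "nat \<Rightarrow> complex set" where
  "Rbring n = {poly (map_poly of_int p) (zeta n + inverse (zeta n)) / 2 ^ k
               | (p :: int poly) (k :: nat). True}"

definition Rbreal :: "nat \<Rightarrow> real set" where
  "Rbreal n = {x. complex_of_real x \<in> Rbring n}"

section \<open>Quaternions with real coefficients (H_n = F_n \<otimes> H embeds into them)\<close>

datatype quat = Quat (q1: real) (qi: real) (qj: real) (qk: real)

definition qmul :: "quat \<Rightarrow> quat \<Rightarrow> quat" where
  "qmul x y = Quat
     (q1 x * q1 y - qi x * qi y - qj x * qj y - qk x * qk y)
     (q1 x * qi y + qi x * q1 y + qj x * qk y - qk x * qj y)
     (q1 x * qj y - qi x * qk y + qj x * q1 y + qk x * qi y)
     (q1 x * qk y + qi x * qj y - qj x * qi y + qk x * q1 y)"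

definition qone :: quat where "qone = Quat 1 0 0 0"

definition qscale :: "real \<Rightarrow> quat \<Rightarrow> quat" where
  "qscale c x = Quat (c * q1 x) (c * qi x) (c * qj x) (c * qk x)"

definition Hn :: "nat \<Rightarrow> quat set" where
  "Hn n = {x. q1 x \<in> Freal n \<and> qi x \<in> Freal n \<and> qj x \<in> Freal n \<and> qk x \<in> Freal n}"

definition Fcls :: "nat \<Rightarrow> quat \<Rightarrow> quat set" where
  "Fcls n x = {qscale c x | c. c \<in> Freal n \<and> c \<noteq> 0}"

text \<open>The order tilde M_n = underline R_n <1, i, j, (1+i+j+k)/2>\<close>
definition Mtilde :: "nat \<Rightarrow> quat set" where
  "Mtilde n = {Quat (a + d/2) (b + d/2) (c + d/2) (d/2) | a b c d.
                 a \<in> Rbreal n \<and> b \<in> Rbreal n \<and> c \<in> Rbreal n \<and> d \<in> Rbreal n}"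

definition Mtilde_units :: "nat \<Rightarrow> quat set" where
  "Mtilde_units n = {m \<in> Mtilde n. \<exists>m' \<in> Mtilde n. qmul m m' = qone \<and> qmul m' m = qone}"

definition cadj :: "complex^2^2 \<Rightarrow> complex^2^2" where
  "cadj A = (\<chi> i j. cnj (A $ j $ i))"

definition U2 :: "nat \<Rightarrow> (complex^2^2) set" where
  "U2 n = {A. (\<forall>i j. A $ i $ j \<in> Rring n) \<and> A ** cadj A = mat 1}"

definition phi :: "nat \<Rightarrow> complex^2^2 \<Rightarrow> quat set" where
  "phi n A = (let b = (SOME b. b \<in> Kfld n \<and> b \<noteq> 0 \<and> det A = cnj b / b);
                  A' = (\<chi> i j. b * A $ i $ j);
                  r = Re (A' $ 1 $ 1); s = Im (A' $ 1 $ 1);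
                  t = Re (A' $ 1 $ 2); u = Im (A' $ 1 $ 2)
              in Fcls n (Quat r (- u) (- t) (- s)))"

end

theory Submission
  imports "HOL-Number_Theory.Number_Theory" "HOL-Computational_Algebra.Squarefree" Defs
begin

text \<open>
  Write \<open>n = m d\<close> with \<open>m\<close> equal to 4 or 12 and \<open>d\<close> a power of 2, so that \<open>K\<^sub>n\<close> is cyclic of degree \<open>d\<close> over
  \<open>K\<^sub>m\<close>, with generator \<open>\<sigma>\<close>. Surjectivity onto the unit classes amounts to two facts about \<open>R\<^sub>n\<close>.

  First, an element of \<open>R\<^sub>n\<close> of absolute value one is a root of unity, hence of the form \<open>cnj b / b\<close> with a
  unit \<open>b\<close>: there is only one prime above 2 and conjugation fixes it, so the element is integral, and then
  the trace form shows that it has only one coordinate.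

  Second, a totally positive unit of \<open>\<real> \<inter> R\<^sub>n\<close> is a norm from the units of \<open>R\<^sub>n\<close> (for \<open>n = 2\<^sup>s\<close> this is
  Weber's theorem). Consider such units modulo squares and \<open>\<pi> = \<bar>1 + \<zeta>\<bar>\<^sup>2\<close>; since \<open>d\<close> is a power of 2, it suffices
  to treat classes fixed by \<open>\<sigma>\<close>. If \<open>\<sigma> \<mu> = \<mu> \<epsilon>\<^sup>2\<close>, then \<open>\<epsilon>\<close> has norm \<open>\<plusminus> 1\<close>, and replacing \<open>\<mu>\<close> by \<open>\<mu> \<pi>\<close>
  changes the sign. When the norm is 1, Hilbert 90 makes \<open>\<mu>\<close> a square times an element of the real subfield
  of \<open>K\<^sub>m\<close>, and as only primes above 6 ramify, that element is 1 or 2 up to squares; both are norms.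
\<close>

section \<open>Subrings of the complex numbers generated by one element\<close>

text \<open>If det A = cnj b / b, the first row (x, y) of b A is a quaternion of reduced norm x cnj
  x + y cnj y = b cnj b. As 1/2 lies in the ring, the order consists of all quaternions with
  coordinates in the real part of R, and its units are the elements whose norm is a unit. Hilbert 90
  alone would leave b in K, with unknown denominators; a unit b puts the class of A among the unit
  classes. Conversely a unit quaternion has totally positive norm, and dividing by some b of that
  norm makes it unitary. The reduction to classes fixed by \<sigma> works because, modulo squares,
  (\<sigma> - 1)^d = \<sigma>^d - 1 = 0: iterating x -> \<sigma> x / x ends in a square, and one
  returns step by step. The obstacle is a power of \<pi> picked up on the way; its exponent must be
  even, since the norm of \<pi> to the base field is not a square there. Squares are taken in the
  real elements of K and not among units, as Hilbert 90 does not produce units. Nothing is lost: R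
  is closed under square roots taken in K, so a square root of a unit is a unit. No class number or
  unit index enters.\<close>

definition subring_C :: "complex set \<Rightarrow> bool" where
  "subring_C S \<longleftrightarrow> 1 \<in> S \<and> (\<forall>x\<in>S. \<forall>y\<in>S. x - y \<in> S \<and> x * y \<in> S)"

definition subfield_C :: "complex set \<Rightarrow> bool" where
  "subfield_C S \<longleftrightarrow> subring_C S \<and> (\<forall>x\<in>S. inverse x \<in> S)"

context
  fixes S assumes S: "subring_C S"
begin

lemma subring_C_1: "1 \<in> S" and subring_C_diff: "x \<in> S \<Longrightarrow> y \<in> S \<Longrightarrow> x - y \<in> S"
  and subring_C_mult: "x \<in> S \<Longrightarrow> y \<in> S \<Longrightarrow> x * y \<in> S"
  using S by (auto simp: subring_C_def)

lemma subring_C_0: "0 \<in> S"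
  using subring_C_diff[OF subring_C_1 subring_C_1] by simp

lemma subring_C_uminus: "x \<in> S \<Longrightarrow> - x \<in> S"
  using subring_C_diff[OF subring_C_0, of x] by simp

lemma subring_C_add: "x \<in> S \<Longrightarrow> y \<in> S \<Longrightarrow> x + y \<in> S"
  using subring_C_diff[OF _ subring_C_uminus, of x y] by simp

lemma subring_C_power: "x \<in> S \<Longrightarrow> x ^ k \<in> S"
  by (induction k) (auto intro: subring_C_mult subring_C_1)

lemma subring_C_sum: "(\<And>i. i \<in> A \<Longrightarrow> f i \<in> S) \<Longrightarrow> sum f A \<in> S"
  by (induction A rule: infinite_finite_induct) (auto intro: subring_C_add subring_C_0)

lemma subring_C_prod: "(\<And>i. i \<in> A \<Longrightarrow> f i \<in> S) \<Longrightarrow> prod f A \<in> S"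
  by (induction A rule: infinite_finite_induct) (auto intro: subring_C_mult subring_C_1)

lemma subring_C_of_nat: "of_nat k \<in> S"
  by (induction k) (auto intro: subring_C_add subring_C_0 subring_C_1)

lemma subring_C_of_int: "of_int k \<in> S"
  by (cases k rule: int_cases2) (auto intro: subring_C_of_nat subring_C_uminus)

lemma subring_C_numeral: "numeral k \<in> S"
  using subring_C_of_nat[of "numeral k"] by simp

lemma Ints_subset_subring_C: "\<int> \<subseteq> S"
  by (auto elim!: Ints_cases intro: subring_C_of_int)

end

lemmas subring_C_closed = subring_C_0 subring_C_1 subring_C_diff subring_C_mult
  subring_C_uminus subring_C_add subring_C_power subring_C_sum subring_C_prod
  subring_C_of_nat subring_C_of_int subring_C_numeral

lemma subring_C_Ints: "subring_C \<int>" and subring_C_Rats: "subring_C \<rat>"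
  by (auto simp: subring_C_def)

lemma subfield_C_Rats: "subfield_C \<rat>"
  by (auto simp: subfield_C_def subring_C_Rats)

lemma subfield_C_subring: "subfield_C S \<Longrightarrow> subring_C S"
  by (simp add: subfield_C_def)

lemma subfield_C_inverse: "subfield_C S \<Longrightarrow> x \<in> S \<Longrightarrow> inverse x \<in> S"
  by (simp add: subfield_C_def)

lemma subfield_C_divide: "subfield_C S \<Longrightarrow> x \<in> S \<Longrightarrow> y \<in> S \<Longrightarrow> x / y \<in> S"
  by (simp add: subfield_C_def divide_inverse subring_C_mult)

lemma Rats_subset_subfield_C: "subfield_C S \<Longrightarrow> \<rat> \<subseteq> S"
proof
  fix x :: complex assume S: "subfield_C S" and "x \<in> \<rat>"
  then obtain a b where "x = of_int a / of_int b" by (auto elim: Rats_cases')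
  then show "x \<in> S"
    using S by (simp add: subfield_C_divide subring_C_of_int subfield_C_subring)
qed

definition coeffs_in :: "complex set \<Rightarrow> complex poly \<Rightarrow> bool" where
  "coeffs_in S p \<longleftrightarrow> (\<forall>i. coeff p i \<in> S)"

text \<open>The ring S[z]. Base rings are subsets of the complex numbers rather than types, so that
  the integers, the rationals and the rings and fields above them fall under the same
  lemmas.\<close>

definition adj :: "complex set \<Rightarrow> complex \<Rightarrow> complex set" where
  "adj S z = {poly p z | p. coeffs_in S p}"

lemma coeffs_in_pCons: "subring_C S \<Longrightarrow> coeffs_in S (pCons a p) \<longleftrightarrow> a \<in> S \<and> coeffs_in S p"
  by (auto simp: coeffs_in_def coeff_pCons split: nat.splits)

lemma coeffs_in_0: "subring_C S \<Longrightarrow> coeffs_in S 0"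
  by (simp add: coeffs_in_def subring_C_0)

lemma coeffs_in_induct [consumes 2, case_names 0 pCons]:
  assumes "subring_C S" "coeffs_in S p" "P 0"
    "\<And>a p. a \<in> S \<Longrightarrow> coeffs_in S p \<Longrightarrow> P p \<Longrightarrow> P (pCons a p)"
  shows "P p"
  using assms(2)
proof (induction p)
  case (pCons a p)
  then show ?case using assms(1,4) by (simp add: coeffs_in_pCons)
qed (rule assms(3))

lemma coeffs_in_diff: "subring_C S \<Longrightarrow> coeffs_in S p \<Longrightarrow> coeffs_in S q \<Longrightarrow> coeffs_in S (p - q)"
  by (simp add: coeffs_in_def subring_C_diff)

lemma coeffs_in_add: "subring_C S \<Longrightarrow> coeffs_in S p \<Longrightarrow> coeffs_in S q \<Longrightarrow> coeffs_in S (p + q)"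
  by (simp add: coeffs_in_def subring_C_add)

lemma coeffs_in_smult: "subring_C S \<Longrightarrow> a \<in> S \<Longrightarrow> coeffs_in S q \<Longrightarrow> coeffs_in S (smult a q)"
  by (simp add: coeffs_in_def subring_C_mult)

lemma coeffs_in_mult: "subring_C S \<Longrightarrow> coeffs_in S p \<Longrightarrow> coeffs_in S q \<Longrightarrow> coeffs_in S (p * q)"
  by (simp add: coeffs_in_def coeff_mult subring_C_mult subring_C_sum)

lemma coeffs_in_monom: "subring_C S \<Longrightarrow> a \<in> S \<Longrightarrow> coeffs_in S (monom a k)"
  by (simp add: coeffs_in_def subring_C_0)

lemma coeffs_in_const: "subring_C S \<Longrightarrow> a \<in> S \<Longrightarrow> coeffs_in S [:a:]"
  by (simp add: coeffs_in_pCons coeffs_in_0)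

lemma subring_C_adj:
  assumes S: "subring_C S" shows "subring_C (adj S z)"
  unfolding subring_C_def
proof (intro conjI ballI)
  show "1 \<in> adj S z"
    unfolding adj_def using coeffs_in_const[OF S subring_C_1[OF S]]
    by (auto intro!: exI[of _ "[:1:]"])
  fix x y assume "x \<in> adj S z" "y \<in> adj S z"
  then obtain p q where *: "x = poly p z" "coeffs_in S p" "y = poly q z" "coeffs_in S q"
    by (auto simp: adj_def)
  show "x - y \<in> adj S z"
    unfolding adj_def using * coeffs_in_diff[OF S] by (auto intro!: exI[of _ "p - q"])
  show "x * y \<in> adj S z"
    unfolding adj_def using * coeffs_in_mult[OF S] by (auto intro!: exI[of _ "p * q"])
qed

lemma adj_gen: "subring_C S \<Longrightarrow> z \<in> adj S z"
  unfolding adj_def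
  by (auto intro!: exI[of _ "[:0, 1:]"] simp: coeffs_in_pCons coeffs_in_0 subring_C_closed)

lemma adj_base: "subring_C S \<Longrightarrow> S \<subseteq> adj S z"
proof
  fix a assume "subring_C S" "a \<in> S"
  then show "a \<in> adj S z"
    unfolding adj_def by (auto intro!: exI[of _ "[:a:]"] coeffs_in_const)
qed

lemma poly_in_subring_C:
  assumes "subring_C T" "coeffs_in T p" "z \<in> T" shows "poly p z \<in> T"
  using assms(1,2)
  by (induction rule: coeffs_in_induct) (auto intro!: subring_C_closed assms)

lemma coeffs_in_mono: "S \<subseteq> T \<Longrightarrow> coeffs_in S p \<Longrightarrow> coeffs_in T p"
  by (auto simp: coeffs_in_def)

lemma adj_least: "subring_C T \<Longrightarrow> S \<subseteq> T \<Longrightarrow> z \<in> T \<Longrightarrow> adj S z \<subseteq> T"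
  unfolding adj_def using poly_in_subring_C coeffs_in_mono by blast

text \<open>Division with remainder needs only a monic divisor, not a field. Horner style: if p = q
  Q + r, then X p + a = X q Q + (X r + a), and subtracting c Q removes the coefficient of degree N.
  The remainder is bounded through vanishing coefficients, so that a zero remainder is no special
  case.\<close>

lemma monic_division:
  assumes S: "subring_C S" and p: "coeffs_in S p" and Q: "coeffs_in S Q" "lead_coeff Q = 1"
    and N: "degree Q = N" "N > 0"
  shows "\<exists>q r. coeffs_in S q \<and> coeffs_in S r \<and> p = q * Q + r \<and> (\<forall>i\<ge>N. coeff r i = 0)"
  using S p
proof (induction p rule: coeffs_in_induct)
  case 0
  show ?case by (rule exI[of _ 0], rule exI[of _ 0]) (simp add: coeffs_in_0 S)
next
  case (pCons a p)
  then obtain q r where IH: "coeffs_in S q" "coeffs_in S r" "p = q * Q + r"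
    "\<forall>i\<ge>N. coeff r i = 0" by blast
  define c where "c = coeff (pCons a r) N"
  have c: "c \<in> S"
    using IH(2) pCons(1) unfolding c_def by (metis coeffs_in_def coeffs_in_pCons[OF S])
  have "coeffs_in S (pCons c q)" "coeffs_in S (pCons a r - smult c Q)"
    using IH pCons c Q S by (auto simp: coeffs_in_pCons coeffs_in_diff coeffs_in_smult)
  moreover have "pCons a p = pCons c q * Q + (pCons a r - smult c Q)"
    by (simp add: IH(3))
  moreover have "coeff (pCons a r - smult c Q) i = 0" if "i \<ge> N" for i
  proof (cases "i = N")
    case True
    then show ?thesis using Q N by (simp add: c_def)
  next
    case False
    then have "i > N" using that by simp
    then obtain j where j: "i = Suc j" "j \<ge> N" by (cases i) auto
    have "coeff Q i = 0" using \<open>i > N\<close> N by (simp add: coeff_eq_0)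
    then show ?thesis using j IH(4) by simp
  qed
  ultimately show ?case by blast
qed

lemma poly_eq_sum_lessThan:
  fixes r :: "complex poly"
  assumes "\<forall>i\<ge>N. coeff r i = 0"
  shows "poly r x = (\<Sum>i<N. coeff r i * x ^ i)"
proof -
  have "poly r x = (\<Sum>i\<le>degree r. coeff r i * x ^ i)" by (simp add: poly_altdef)
  also have "\<dots> = (\<Sum>i\<in>{..degree r} \<union> {..<N}. coeff r i * x ^ i)"
    by (rule sum.mono_neutral_left) (auto simp: coeff_eq_0)
  also have "\<dots> = (\<Sum>i<N. coeff r i * x ^ i)"
    by (rule sum.mono_neutral_right) (use assms in \<open>auto simp: not_less\<close>)
  finally show ?thesis .
qed

lemma adj_coordinates:
  assumes S: "subring_C S" and Q: "coeffs_in S Q" "lead_coeff Q = 1"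
    "degree Q = N" "N > 0" "poly Q z = 0" and x: "x \<in> adj S z"
  obtains c where "\<And>i. c i \<in> S" "x = (\<Sum>i<N. c i * z ^ i)"
proof -
  obtain p where p: "x = poly p z" "coeffs_in S p" using x by (auto simp: adj_def)
  obtain q r where "coeffs_in S r" "p = q * Q + r" "\<forall>i\<ge>N. coeff r i = 0"
    using monic_division[OF S p(2) Q(1-4)] by blast
  then show ?thesis
    using that[of "coeff r"] p Q by (auto simp: coeffs_in_def poly_eq_sum_lessThan)
qed

section \<open>Inverting 2\<close>

definition halves :: "complex set \<Rightarrow> complex set" where
  "halves S = {x / 2 ^ k | x k. x \<in> S}"

lemma halvesI: "x \<in> S \<Longrightarrow> x / 2 ^ k \<in> halves S"
  by (auto simp: halves_def)

lemma halves_base: "S \<subseteq> halves S"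
  using halvesI[of _ S 0] by auto

lemma subring_C_halves:
  assumes S: "subring_C S" shows "subring_C (halves S)"
  unfolding subring_C_def
proof (intro conjI ballI)
  show "1 \<in> halves S" using halves_base subring_C_1[OF S] by blast
  fix x y assume "x \<in> halves S" "y \<in> halves S"
  then obtain a j b k where *: "x = a / 2 ^ j" "a \<in> S" "y = b / 2 ^ k" "b \<in> S"
    by (auto simp: halves_def)
  have "x - y = (2 ^ k * a - 2 ^ j * b) / 2 ^ (j + k)"
    by (simp add: * field_simps power_add)
  also have "\<dots> \<in> halves S"
    by (intro halvesI subring_C_closed[OF S] *)
  finally show "x - y \<in> halves S" .
  have "x * y = (a * b) / 2 ^ (j + k)" by (simp add: * power_add)
  also have "\<dots> \<in> halves S" by (intro halvesI subring_C_closed[OF S] *)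
  finally show "x * y \<in> halves S" .
qed

section \<open>The fields and rings of the statement as rings generated by one element\<close>

lemma poly_map_poly_Ints: "{poly (map_poly of_int p) z | p :: int poly. True} = adj \<int> z"
proof (intro equalityI subsetI)
  fix x assume "x \<in> adj \<int> z"
  then obtain p where p: "x = poly p z" "coeffs_in \<int> p" by (auto simp: adj_def)
  have "\<exists>q :: int poly. p = map_poly of_int q"
    using subring_C_Ints p(2)
  proof (induction p rule: coeffs_in_induct)
    case (pCons a p)
    then obtain q b where "p = map_poly of_int q" "a = of_int b" by (auto elim: Ints_cases)
    then show ?case by (intro exI[of _ "pCons b q"]) (simp add: map_poly_pCons)
  qed (auto intro: exI[of _ 0])
  then show "x \<in> {poly (map_poly of_int p) z | p :: int poly. True}" using p by auto
qed (auto simp: adj_def coeffs_in_def coeff_map_poly)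

lemma poly_map_poly_Rats: "{poly (map_poly of_rat p) z | p :: rat poly. True} = adj \<rat> z"
proof (intro equalityI subsetI)
  fix x assume "x \<in> adj \<rat> z"
  then obtain p where p: "x = poly p z" "coeffs_in \<rat> p" by (auto simp: adj_def)
  have "\<exists>q :: rat poly. p = map_poly of_rat q"
    using subring_C_Rats p(2)
  proof (induction p rule: coeffs_in_induct)
    case (pCons a p)
    then obtain q b where "p = map_poly of_rat q" "a = of_rat b" by (auto elim: Rats_cases)
    then show ?case by (intro exI[of _ "pCons b q"]) (simp add: map_poly_pCons)
  qed (auto intro: exI[of _ 0])
  then show "x \<in> {poly (map_poly of_rat p) z | p :: rat poly. True}" using p by auto
qed (auto simp: adj_def coeffs_in_def coeff_map_poly)

lemma Kfld_eq_adj: "Kfld n = adj \<rat> (zeta n)"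
  unfolding Kfld_def poly_map_poly_Rats ..

lemma Ffld_eq_adj: "Ffld n = adj \<rat> (zeta n + inverse (zeta n))"
  unfolding Ffld_def poly_map_poly_Rats ..

lemma Rring_eq_halves: "Rring n = halves (adj \<int> (zeta n))"
  unfolding Rring_def halves_def poly_map_poly_Ints[symmetric] by auto

lemma Rbring_eq_halves: "Rbring n = halves (adj \<int> (zeta n + inverse (zeta n)))"
  unfolding Rbring_def halves_def poly_map_poly_Ints[symmetric] by auto

section \<open>Real elements and the generator z + 1/z\<close>

lemma power_plus_inverse_power_in_adj:
  assumes S: "subring_C S" and z: "z \<noteq> 0"
  shows "z ^ j + inverse z ^ j \<in> adj S (z + inverse z)"
proof (induction j rule: less_induct)
  case (less j)
  note T = subring_C_adj[OF S, of "z + inverse z"]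
  consider "j = 0" | "j = 1" | i where "j = Suc (Suc i)"
    by (metis One_nat_def not0_implies_Suc)
  then show ?case
  proof cases
    case 3
    have "z ^ j + inverse z ^ j =
      (z + inverse z) * (z ^ Suc i + inverse z ^ Suc i) - (z ^ i + inverse z ^ i)"
      using z unfolding 3 by (simp add: field_simps)
    also have "\<dots> \<in> adj S (z + inverse z)"
      using less[of "Suc i"] less[of i] 3
      by (intro subring_C_diff[OF T] subring_C_mult[OF T] adj_gen[OF S]) auto
    finally show ?thesis .
  qed (use subring_C_add[OF T subring_C_1[OF T] subring_C_1[OF T]] adj_gen[OF S] in auto)
qed

lemma Rats_subset_Reals: "(\<rat> :: complex set) \<subseteq> \<real>"
  by (auto elim!: Rats_cases')

lemma Ints_subset_Reals: "(\<int> :: complex set) \<subseteq> \<real>"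
  by (auto elim!: Ints_cases)

text \<open>A real x is the mean of x and \<open>cnj x\<close>, and on the unit circle conjugation
  exchanges z and \<open>inverse z\<close>; so 2 x is a combination of the sums z^i + z^(-i). The
  factor 2 is harmless where this is used: it is cancelled in \<rat> or absorbed into a denominator
  2^k.\<close>

lemma real_in_adj:
  assumes S: "subring_C S" "S \<subseteq> \<real>" and z: "cmod z = 1" and x: "x \<in> adj S z" "x \<in> \<real>"
  shows "2 * x \<in> adj S (z + inverse z)"
proof -
  obtain p where p: "x = poly p z" "coeffs_in S p" using x by (auto simp: adj_def)
  have cz: "cnj z = inverse z"
    using complex_norm_square[of z] z by (simp add: inverse_unique)
  have z0: "z \<noteq> 0" using z by auto
  have c: "cnj (coeff p i) = coeff p i" for i
    using p(2) S(2) unfolding coeffs_in_def by (meson Reals_cnj_iff subsetD)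
  have "2 * x = x + cnj x" using x(2) by (simp add: Reals_cnj_iff)
  also have "\<dots> = (\<Sum>i\<le>degree p. coeff p i * (z ^ i + inverse z ^ i))"
    by (simp add: p poly_altdef c cz sum.distrib[symmetric] distrib_left)
  also have "\<dots> \<in> adj S (z + inverse z)"
    using adj_base[OF S(1)] p(2) power_plus_inverse_power_in_adj[OF S(1) z0]
    by (intro subring_C_sum subring_C_adj S subring_C_mult) (auto simp: coeffs_in_def)
  finally show ?thesis .
qed

lemma cmod_zeta: "cmod (zeta n) = 1"
  by (simp add: zeta_def)

lemma cnj_zeta: "cnj (zeta n) = inverse (zeta n)"
  by (simp add: zeta_def cis_cnj cis_inverse)

lemma zeta_nonzero: "zeta n \<noteq> 0"
  using cmod_zeta[of n] by auto

lemma zeta_power: "zeta n ^ j = cis (2 * pi * real j / real n)"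
  by (simp add: zeta_def Complex.DeMoivre field_simps)

lemma zeta_power_self: "n > 0 \<Longrightarrow> zeta n ^ n = 1"
  by (simp add: zeta_power)

lemma zeta_power_eq_1_iff:
  assumes "n > 0" shows "zeta n ^ j = 1 \<longleftrightarrow> n dvd j"
proof
  assume "zeta n ^ j = 1"
  then have "exp (\<i> * complex_of_real (2 * pi * real j / real n)) = 1"
    by (simp add: zeta_power cis_conv_exp)
  then obtain k :: int where "2 * pi * real j / real n = of_int (2 * k) * pi"
    by (auto simp: exp_eq_1)
  then have "real j = real n * k" using assms by (simp add: field_simps)
  then have "int j = int n * k" by (metis of_int_eq_iff of_int_mult of_int_of_nat_eq)
  then show "n dvd j" by (metis dvd_triv_left int_dvd_int_iff)
qed (use zeta_power_self[OF assms] in \<open>auto simp: power_mult\<close>)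

lemma inverse_zeta: "n > 0 \<Longrightarrow> inverse (zeta n) = zeta n ^ (n - 1)"
  by (metis inverse_unique power_minus_mult mult.commute zeta_power_self)

lemma zeta_mult_power: "d > 0 \<Longrightarrow> zeta (m * d) ^ d = zeta m"
  by (simp add: zeta_power) (simp add: zeta_def)

lemma inverse_zeta_in_adj: "subring_C S \<Longrightarrow> n > 0 \<Longrightarrow> inverse (zeta n) \<in> adj S (zeta n)"
  by (simp add: inverse_zeta subring_C_power subring_C_adj adj_gen)

text \<open>Turns membership in the real subfield into reality of an element of
  \<open>Kfld n\<close>; afterwards no polynomial in \<zeta> + 1/\<zeta> is needed.\<close>

lemma Freal_iff:
  assumes "n > 0" shows "x \<in> Freal n \<longleftrightarrow> complex_of_real x \<in> Kfld n"
proof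
  assume "x \<in> Freal n"
  then have "complex_of_real x \<in> adj \<rat> (zeta n + inverse (zeta n))"
    by (simp add: Freal_def Ffld_eq_adj)
  also have "\<dots> \<subseteq> Kfld n" unfolding Kfld_eq_adj
    by (intro adj_least subring_C_adj adj_base subring_C_add subring_C_Rats
          inverse_zeta_in_adj adj_gen assms)
  finally show "complex_of_real x \<in> Kfld n" .
next
  assume "complex_of_real x \<in> Kfld n"
  then have "2 * complex_of_real x \<in> Ffld n"
    using real_in_adj[OF subring_C_Rats Rats_subset_Reals cmod_zeta]
    unfolding Kfld_eq_adj Ffld_eq_adj by auto
  moreover have "1 / 2 \<in> Ffld n"
    using adj_base[OF subring_C_Rats] unfolding Ffld_eq_adj by (rule subsetD) simp
  ultimately have "1 / 2 * (2 * complex_of_real x) \<in> Ffld n"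
    unfolding Ffld_eq_adj by (rule subring_C_mult[OF subring_C_adj[OF subring_C_Rats], rotated])
  then show "x \<in> Freal n" by (simp add: Freal_def)
qed

lemma Rbreal_iff:
  assumes "n > 0" shows "x \<in> Rbreal n \<longleftrightarrow> complex_of_real x \<in> Rring n"
proof
  assume "x \<in> Rbreal n"
  then have "complex_of_real x \<in> halves (adj \<int> (zeta n + inverse (zeta n)))"
    by (simp add: Rbreal_def Rbring_eq_halves)
  moreover have "adj \<int> (zeta n + inverse (zeta n)) \<subseteq> adj \<int> (zeta n)"
    by (intro adj_least subring_C_adj adj_base subring_C_add subring_C_Ints
          inverse_zeta_in_adj adj_gen assms)
  ultimately show "complex_of_real x \<in> Rring n"
    by (auto simp: Rring_eq_halves halves_def)
next
  assume "complex_of_real x \<in> Rring n"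
  then obtain y k where y: "complex_of_real x = y / 2 ^ k" "y \<in> adj \<int> (zeta n)"
    by (auto simp: Rring_eq_halves halves_def)
  then have "y = complex_of_real (x * 2 ^ k)" by (simp add: field_simps)
  then have "y \<in> \<real>" by (metis Reals_of_real)
  then have "2 * y \<in> adj \<int> (zeta n + inverse (zeta n))"
    using real_in_adj[OF subring_C_Ints Ints_subset_Reals cmod_zeta y(2)] by auto
  then have "(2 * y) / 2 ^ Suc k \<in> Rbring n"
    unfolding Rbring_eq_halves by (rule halvesI)
  then show "x \<in> Rbreal n" using y by (simp add: Rbreal_def)
qed

section \<open>Towers of quadratic extensions\<close>

definition qext :: "complex set \<Rightarrow> complex \<Rightarrow> complex set" where
  "qext S b = {x + y * b | x y. x \<in> S \<and> y \<in> S}"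

text \<open>b may already lie in S, and the extension is then S itself. This keeps the towers free
  of case distinctions, at the price that the conjugate x - y b in the usual formula for the inverse
  may vanish.\<close>

lemma subfield_C_qext:
  assumes S: "subfield_C S" and b: "b ^ 2 \<in> S"
  shows "subfield_C (qext S b)"
proof -
  note R = subfield_C_subring[OF S]
  have "1 \<in> qext S b"
    unfolding qext_def using subring_C_0[OF R] subring_C_1[OF R] by force
  moreover have "u - v \<in> qext S b \<and> u * v \<in> qext S b" if uv: "u \<in> qext S b" "v \<in> qext S b" for u v
  proof -
    obtain x y x' y' where *: "u = x + y * b" "v = x' + y' * b" "x \<in> S" "y \<in> S" "x' \<in> S" "y' \<in> S"
      using uv unfolding qext_def by blast
    have "u - v = (x - x') + (y - y') * b" "u * v = (x * x' + y * y' * b ^ 2) + (x * y' + y * x') * b"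
      by (simp_all add: * algebra_simps power2_eq_square)
    moreover have "x - x' \<in> S" "y - y' \<in> S" "x * x' + y * y' * b ^ 2 \<in> S" "x * y' + y * x' \<in> S"
      using * b by (simp_all add: subring_C_diff[OF R] subring_C_add[OF R] subring_C_mult[OF R])
    ultimately show ?thesis unfolding qext_def by blast
  qed
  moreover have "inverse u \<in> qext S b" if u: "u \<in> qext S b" for u
  proof -
    obtain x y where *: "u = x + y * b" "x \<in> S" "y \<in> S" using u by (auto simp: qext_def)
    define D where "D = x ^ 2 - b ^ 2 * y ^ 2"
    have D: "D = (x + y * b) * (x - y * b)"
      by (simp add: D_def algebra_simps power2_eq_square)
    have DS: "D \<in> S"
      unfolding D_def using * b
      by (simp add: subring_C_diff[OF R] subring_C_mult[OF R] subring_C_power[OF R])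
    consider "u = 0" | "u \<noteq> 0" "D = 0" | "D \<noteq> 0" by blast
    then show ?thesis
    proof cases
      case 1
      then show ?thesis using u by simp
    next
      \<comment> \<open>A vanishing conjugate means b = x / y in S, and then u is the element 2 x of
        S.\<close>
      case 2
      then have "x - y * b = 0" using D *(1) by simp
      then have "u = 2 * x" using *(1) by simp
      then have "u \<in> S" using * by (simp add: subring_C_mult[OF R] subring_C_numeral[OF R])
      then have "inverse u \<in> S" by (rule subfield_C_inverse[OF S])
      then show ?thesis unfolding qext_def using subring_C_0[OF R] by force
    next
      case 3
      then have "u \<noteq> 0" using D *(1) by auto
      moreover have "u * (x - y * b) = D" using D *(1) by simp
      ultimately have "inverse u = (x - y * b) / D"
        using 3 by (intro inverse_unique) simp
      then have "inverse u = x / D + (- y / D) * b"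
        by (simp add: diff_divide_distrib)
      moreover have "x / D \<in> S" "- y / D \<in> S"
        using * DS by (simp_all add: subfield_C_divide[OF S] subring_C_uminus[OF R])
      ultimately show ?thesis unfolding qext_def by blast
    qed
  qed
  ultimately show ?thesis by (auto simp: subfield_C_def subring_C_def)
qed

lemma qext_base: "subfield_C S \<Longrightarrow> S \<subseteq> qext S b"
  unfolding qext_def using subring_C_0[OF subfield_C_subring] by force

lemma qext_gen: "subfield_C S \<Longrightarrow> b \<in> qext S b"
  unfolding qext_def using subring_C_0[OF subfield_C_subring] subring_C_1[OF subfield_C_subring]
  by force

text \<open>The root z is adjoined in e quadratic steps, starting with a square root of z^(2^e); so
  S[z] is seen to be a field without knowing any minimal polynomial.\<close>

lemma subfield_C_adj_root:
  assumes "subfield_C S" "z ^ (2 ^ e) \<in> S"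
  shows "subfield_C (adj S z)"
  using assms
proof (induction e arbitrary: S)
  case 0
  note R = subfield_C_subring[OF 0(1)]
  have "adj S z = S"
    using adj_base[OF R] adj_least[OF R subset_refl] 0 by auto
  then show ?case using 0 by simp
next
  case (Suc e)
  define b where "b = z ^ (2 ^ e)"
  note R = subfield_C_subring[OF Suc(2)]
  have "b ^ 2 \<in> S" using Suc(3) by (simp add: b_def power_mult[symmetric] mult.commute)
  then have q: "subfield_C (qext S b)" using Suc(2) by (rule subfield_C_qext[rotated])
  note Rq = subfield_C_subring[OF q]
  have *: "subfield_C (adj (qext S b) z)"
    by (rule Suc(1)[OF q]) (simp add: qext_gen[OF Suc(2)] flip: b_def)
  have "qext S b \<subseteq> adj S z"
  proof
    fix u assume "u \<in> qext S b"
    then obtain x y where "u = x + y * b" "x \<in> S" "y \<in> S" by (auto simp: qext_def)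
    moreover have "b \<in> adj S z"
      unfolding b_def by (intro subring_C_power subring_C_adj adj_gen R)
    moreover have "S \<subseteq> adj S z" by (rule adj_base[OF R])
    ultimately show "u \<in> adj S z"
      by (metis subring_C_add[OF subring_C_adj[OF R]] subring_C_mult[OF subring_C_adj[OF R]] subsetD)
  qed
  then have "adj (qext S b) z \<subseteq> adj S z"
    by (intro adj_least subring_C_adj adj_gen R)
  moreover have "adj S z \<subseteq> adj (qext S b) z"
    using qext_base[OF Suc(2)] adj_base[OF Rq]
    by (intro adj_least subring_C_adj adj_gen Rq) blast
  ultimately show ?case using * by simp
qed

lemma sum_lessThan_add:
  fixes f :: "nat \<Rightarrow> 'a::comm_monoid_add"
  shows "sum f {..<N + M} = sum f {..<N} + (\<Sum>j<M. f (N + j))"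
  by (induction M) (simp_all add: add.assoc)

lemma prod_lessThan_add:
  fixes f :: "nat \<Rightarrow> 'a::comm_monoid_mult"
  shows "prod f {..<N + M} = prod f {..<N} * (\<Prod>j<M. f (N + j))"
  by (induction M) (simp_all add: mult.assoc)

text \<open>If \<open>b\<^sup>2 = a\<close> is not a square in a field \<open>S\<close> containing \<^term>\<open>\<i>\<close>, then \<open>b\<close> is not a square
  in \<open>S(b)\<close>: comparing coefficients, \<open>(x + y b)\<^sup>2 = b\<close> would give \<open>a = (\<i> x / y)\<^sup>2\<close>.\<close>

lemma root_linear_independent:
  assumes "subfield_C S" "\<i> \<in> S" "a \<in> S" "\<forall>y\<in>S. y ^ 2 \<noteq> a" "z ^ (2 ^ e) = a"
    "\<forall>j<2 ^ e. c j \<in> S" "(\<Sum>j<2 ^ e. c j * z ^ j) = 0"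
  shows "\<forall>j<2 ^ e. c j = 0"
  using assms
proof (induction e arbitrary: S a c)
  case (Suc e)
  note S = Suc.prems(1)
  note R = subfield_C_subring[OF S]
  define b where "b = z ^ (2 ^ e)"
  define N :: nat where "N = 2 ^ e"
  have ba: "b ^ 2 = a" using Suc.prems(5) by (simp add: b_def power_mult[symmetric] mult.commute)
  have bS: "b \<notin> S" using Suc.prems(4) ba by blast
  have ind: "x = 0 \<and> y = 0" if "x \<in> S" "y \<in> S" "x + y * b = 0" for x y
  proof (rule ccontr)
    assume "\<not> ?thesis"
    with that(3) have "y \<noteq> 0" by auto
    then have "b = - x / y" using that(3) by (simp add: field_simps eq_neg_iff_add_eq_0 add.commute)
    then show False using bS that subfield_C_divide[OF S] subring_C_uminus[OF R] by metis
  qed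
  have q: "subfield_C (qext S b)" using S Suc.prems(3) ba by (intro subfield_C_qext) auto
  have nsq: "\<forall>w\<in>qext S b. w ^ 2 \<noteq> b"
  proof
    fix w assume "w \<in> qext S b"
    then obtain x y where w: "w = x + y * b" "x \<in> S" "y \<in> S" by (auto simp: qext_def)
    show "w ^ 2 \<noteq> b"
    proof
      assume "w ^ 2 = b"
      then have "(x ^ 2 + a * y ^ 2) + (2 * x * y - 1) * b = 0"
        by (simp add: w ba[symmetric] algebra_simps power2_eq_square)
      moreover have "x ^ 2 + a * y ^ 2 \<in> S" "2 * x * y - 1 \<in> S"
        using w Suc.prems(3)
        by (auto intro!: subring_C_closed[OF R])
      ultimately have *: "x ^ 2 + a * y ^ 2 = 0" "2 * x * y - 1 = 0" using ind by blast+
      then have "y \<noteq> 0" by auto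
      have "x ^ 2 = - (a * y ^ 2)" using *(1) by (simp add: eq_neg_iff_add_eq_0)
      then have "(\<i> * x / y) ^ 2 = a"
        using \<open>y \<noteq> 0\<close> by (simp add: power_mult_distrib power_divide)
      moreover have "\<i> * x / y \<in> S"
        using w Suc.prems(2) by (simp add: subfield_C_divide[OF S] subring_C_mult[OF R])
      ultimately show False using Suc.prems(4) by blast
    qed
  qed
  \<comment> \<open>As z^(N + j) = b z^j, the two halves of the sum combine into one over j < N with
    coefficients in S(b). This is a relation of the same kind for the exponent e, with b in the role
    of a.\<close>
  have "0 = (\<Sum>j<N + N. c j * z ^ j)" using Suc.prems(7) by (simp add: N_def mult_2)
  also have "\<dots> = (\<Sum>j<N. (c j + c (N + j) * b) * z ^ j)"
    by (simp add: sum_lessThan_add sum.distrib[symmetric] b_def N_def power_add algebra_simps)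
  finally have s: "(\<Sum>j<2 ^ e. (c j + c (N + j) * b) * z ^ j) = 0" by (simp add: N_def)
  have cS: "c j \<in> S" if "j < N + N" for j using Suc.prems(6) that by (simp add: N_def mult_2)
  have "\<forall>j<2 ^ e. c j + c (N + j) * b = 0"
  proof (rule Suc.IH[OF q _ _ nsq _ _ s])
    show "\<i> \<in> qext S b" using qext_base[OF S] Suc.prems(2) by blast
    show "b \<in> qext S b" by (rule qext_gen[OF S])
    show "\<forall>j<2 ^ e. c j + c (N + j) * b \<in> qext S b"
    proof (intro allI impI)
      fix j :: nat assume "j < 2 ^ e"
      then have "c j \<in> S" "c (N + j) \<in> S" using cS by (simp_all add: N_def)
      then show "c j + c (N + j) * b \<in> qext S b" unfolding qext_def by blast
    qed
  qed (simp add: b_def)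
  then have "c j = 0 \<and> c (N + j) = 0" if "j < N" for j
    using ind[of "c j" "c (N + j)"] cS that by (auto simp: N_def)
  then show ?case
    by (metis N_def add_diff_inverse_nat mult_2 nat_add_left_cancel_less not_less power_Suc)
qed auto

section \<open>The fields generated by roots of unity of order 4 and 12\<close>

lemma Rats_complex_iff: "(x :: complex) \<in> \<rat> \<longleftrightarrow> (\<exists>r\<in>\<rat>. x = complex_of_real r)"
proof
  assume "x \<in> \<rat>"
  then obtain a b where "x = of_int a / of_int b" by (auto elim: Rats_cases')
  then have "x = complex_of_real (of_int a / of_int b)" by simp
  then show "\<exists>r\<in>\<rat>. x = complex_of_real r" by (metis Rats_divide Rats_of_int)
next
  assume "\<exists>r\<in>\<rat>. x = complex_of_real r"
  then obtain a b where "x = complex_of_real (of_int a / of_int b)" by (auto elim: Rats_cases')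
  then show "x \<in> \<rat>" by simp
qed

lemma Rats_square_nonsquare:
  fixes r :: real
  assumes "r \<in> \<rat>" "r ^ 2 = of_nat k" shows "\<exists>j. k = j ^ 2"
proof -
  have "algebraic_int r"
    by (rule algebraic_int.intros[of "[:- of_nat k, 0, 1:]"])
       (use assms(2) in \<open>auto simp: coeff_pCons power2_eq_square split: nat.splits\<close>)
  then obtain i where "r = of_int i"
    using rational_algebraic_int_is_int assms(1) Ints_cases by metis
  then have "real (nat \<bar>i\<bar> ^ 2) = of_nat k" using assms(2) by simp
  then show ?thesis by (intro exI[of _ "nat \<bar>i\<bar>"]) (simp only: of_nat_eq_iff)
qed

lemma nonsquare_2: "(2::nat) \<noteq> j ^ 2" and nonsquare_3: "(3::nat) \<noteq> j ^ 2"
  and nonsquare_6: "(6::nat) \<noteq> j ^ 2"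
proof -
  have "j ^ 2 \<ge> 9" if "j \<ge> 3" using power_mono[OF that, of 2] by simp
  moreover have "j < 3 \<Longrightarrow> j = 0 \<or> j = 1 \<or> j = 2" by auto
  ultimately show "(2::nat) \<noteq> j ^ 2" "(3::nat) \<noteq> j ^ 2" "(6::nat) \<noteq> j ^ 2"
    by (cases "j < 3"; force)+
qed

lemma Rats_sqrt3_indep:
  fixes p q :: real
  assumes "p \<in> \<rat>" "q \<in> \<rat>" "p + q * sqrt 3 = 0" shows "p = 0 \<and> q = 0"
proof (rule ccontr)
  assume "\<not> ?thesis"
  with assms(3) have "q \<noteq> 0" by auto
  then have "sqrt 3 = - p / q" using assms(3) by (simp add: field_simps)
  then have "sqrt 3 \<in> \<rat>" using assms by simp
  then show False using Rats_square_nonsquare[of "sqrt 3" 3] nonsquare_3 by auto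
qed

lemma zeta_4: "zeta 4 = \<i>"
  by (simp add: zeta_def)

lemma zeta_12: "zeta 12 = Complex (sqrt 3 / 2) (1 / 2)"
proof -
  have "2 * pi / 12 = pi / 6" by simp
  then show ?thesis by (simp add: zeta_def cis.ctr cos_30 sin_30)
qed

lemma Kfld_4_iff: "x \<in> Kfld 4 \<longleftrightarrow> (\<exists>a\<in>\<rat>. \<exists>b\<in>\<rat>. x = Complex a b)"
proof -
  have q: "subfield_C (qext \<rat> \<i>)" by (rule subfield_C_qext[OF subfield_C_Rats]) simp
  have "Kfld 4 \<subseteq> qext \<rat> \<i>"
    unfolding Kfld_eq_adj zeta_4
    by (intro adj_least subfield_C_subring q qext_base subfield_C_Rats qext_gen)
  moreover have "qext \<rat> \<i> \<subseteq> Kfld 4"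
    unfolding Kfld_eq_adj zeta_4 qext_def
    using adj_base[OF subring_C_Rats, of \<i>] adj_gen[OF subring_C_Rats, of \<i>]
    by (auto intro!: subring_C_add[OF subring_C_adj[OF subring_C_Rats]]
        subring_C_mult[OF subring_C_adj[OF subring_C_Rats]])
  ultimately have "x \<in> Kfld 4 \<longleftrightarrow> x \<in> qext \<rat> \<i>" by blast
  also have "\<dots> \<longleftrightarrow> (\<exists>a\<in>\<rat>. \<exists>b\<in>\<rat>. x = complex_of_real a + complex_of_real b * \<i>)"
    unfolding qext_def Rats_complex_iff by auto
  finally show ?thesis by (simp add: Complex_eq mult.commute)
qed

text \<open>The field is \<rat>(\<i>, sqrt 3): \<open>zeta 12\<close> is (sqrt 3 + \<i>) / 2, and
  conversely \<i> is its cube and sqrt 3 is twice it minus \<i>.\<close>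

lemma Kfld_12_iff:
  "x \<in> Kfld 12 \<longleftrightarrow> (\<exists>a\<in>\<rat>. \<exists>b\<in>\<rat>. \<exists>c\<in>\<rat>. \<exists>d\<in>\<rat>. x = Complex (a + b * sqrt 3) (c + d * sqrt 3))"
proof -
  let ?s = "complex_of_real (sqrt 3)"
  have q: "subfield_C (qext \<rat> \<i>)" by (rule subfield_C_qext[OF subfield_C_Rats]) simp
  have s: "?s ^ 2 = 3" by (simp flip: of_real_power)
  have q': "subfield_C (qext (qext \<rat> \<i>) ?s)"
    by (rule subfield_C_qext[OF q]) (simp add: s subring_C_numeral[OF subfield_C_subring[OF q]])
  let ?K = "adj \<rat> (zeta 12)"
  have K: "subring_C ?K" by (rule subring_C_adj[OF subring_C_Rats])
  have g: "zeta 12 \<in> ?K" by (rule adj_gen[OF subring_C_Rats])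
  have "?K \<subseteq> qext (qext \<rat> \<i>) ?s"
  proof (intro adj_least subfield_C_subring q')
    show "\<rat> \<subseteq> qext (qext \<rat> \<i>) ?s" using qext_base[OF subfield_C_Rats] qext_base[OF q] by blast
    have "1 / 2 \<in> qext \<rat> \<i>" "(1 / 2) * \<i> \<in> qext \<rat> \<i>"
      unfolding qext_def by (force intro: exI[of _ "1/2"])+
    then have "(1 / 2) * \<i> + 1 / 2 * ?s \<in> qext (qext \<rat> \<i>) ?s"
      unfolding qext_def[of "qext \<rat> \<i>"] by blast
    also have "(1 / 2) * \<i> + 1 / 2 * ?s = zeta 12" by (simp add: zeta_12 complex_eq_iff)
    finally show "zeta 12 \<in> qext (qext \<rat> \<i>) ?s" .
  qed
  moreover have "qext (qext \<rat> \<i>) ?s \<subseteq> ?K"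
  proof -
    have "zeta 12 ^ 3 \<in> ?K" by (intro subring_C_power K g)
    also have "zeta 12 ^ 3 = \<i>"
      by (simp add: zeta_12 complex_eq_iff power3_eq_cube algebra_simps)
    finally have i: "\<i> \<in> ?K" .
    have "2 * zeta 12 - \<i> \<in> ?K"
      by (intro subring_C_closed[OF K] g i)
    also have "2 * zeta 12 - \<i> = ?s" by (simp add: zeta_12 complex_eq_iff)
    finally have "?s \<in> ?K" .
    then show ?thesis
      using i adj_base[OF subring_C_Rats, of "zeta 12"] unfolding qext_def
      by (auto intro!: subring_C_add[OF K] subring_C_mult[OF K])
  qed
  ultimately have "x \<in> Kfld 12 \<longleftrightarrow> x \<in> qext (qext \<rat> \<i>) ?s" unfolding Kfld_eq_adj by blast
  also have "\<dots> \<longleftrightarrow> (\<exists>a\<in>\<rat>. \<exists>b\<in>\<rat>. \<exists>c\<in>\<rat>. \<exists>d\<in>\<rat>. x = complex_of_real a + complex_of_real c * \<i> +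
      (complex_of_real b + complex_of_real d * \<i>) * ?s)"
    unfolding qext_def Rats_complex_iff by blast
  finally show ?thesis by (simp add: Complex_eq algebra_simps)
qed

lemma Complex_eq_of_real_iff: "Complex a b = complex_of_real r \<longleftrightarrow> a = r \<and> b = 0"
  by (auto simp: complex_eq_iff)

lemma Kfld_4_real: "complex_of_real x \<in> Kfld 4 \<longleftrightarrow> x \<in> \<rat>"
  unfolding Kfld_4_iff by (metis Complex_eq_of_real_iff Rats_0)

lemma Kfld_12_real: "complex_of_real x \<in> Kfld 12 \<longleftrightarrow> (\<exists>a\<in>\<rat>. \<exists>b\<in>\<rat>. x = a + b * sqrt 3)"
proof
  assume "complex_of_real x \<in> Kfld 12"
  then show "\<exists>a\<in>\<rat>. \<exists>b\<in>\<rat>. x = a + b * sqrt 3"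
    unfolding Kfld_12_iff by (metis Complex_eq_of_real_iff)
next
  assume "\<exists>a\<in>\<rat>. \<exists>b\<in>\<rat>. x = a + b * sqrt 3"
  then obtain a b where "a \<in> \<rat>" "b \<in> \<rat>" "complex_of_real x = Complex (a + b * sqrt 3) (0 + 0 * sqrt 3)"
    by (auto simp: complex_eq_iff)
  then show "complex_of_real x \<in> Kfld 12"
    unfolding Kfld_12_iff by (metis Rats_0)
qed

text \<open>A number with square 2 is real, and a^2 + 3 b^2 + 2 a b sqrt 3 = 2 forces a b = 0, so
  that 2 or 6 = (3 b)^2 would be a rational square. Both the independence of the powers of \<zeta>
  over \<open>Kfld m\<close> and the parity of exponents in the final descent rest on this.\<close>

lemma sqrt2_notin_Kfld:
  assumes m: "m = 4 \<or> m = 12" and y: "y \<in> Kfld m" shows "y ^ 2 \<noteq> 2"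
proof
  assume y2: "y ^ 2 = 2"
  have "y ^ 2 = complex_of_real (sqrt 2) ^ 2" by (simp add: y2 flip: of_real_power)
  then have "y = complex_of_real (sqrt 2) \<or> y = complex_of_real (- sqrt 2)"
    by (auto simp: power2_eq_iff)
  then obtain r where r: "y = complex_of_real r" "r ^ 2 = 2" by fastforce
  from m show False
  proof
    assume "m = 4"
    then have "r \<in> \<rat>" using y r Kfld_4_real by simp
    then show False using Rats_square_nonsquare[of r 2] r nonsquare_2 by auto
  next
    assume "m = 12"
    then obtain a b where ab: "a \<in> \<rat>" "b \<in> \<rat>" "r = a + b * sqrt 3"
      using y r Kfld_12_real by auto
    have "(a ^ 2 + 3 * b ^ 2 - 2) + (2 * a * b) * sqrt 3 = 0"
      using r(2) unfolding ab by (simp add: algebra_simps power2_eq_square)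
    then have *: "a ^ 2 + 3 * b ^ 2 = 2" "a * b = 0"
      using Rats_sqrt3_indep[of "a ^ 2 + 3 * b ^ 2 - 2" "2 * a * b"] ab by auto
    show False
    proof (cases "a = 0")
      case True
      then have "(3 * b) ^ 2 = of_nat 6" using * by (simp add: power2_eq_square)
      then show False using Rats_square_nonsquare[of "3 * b" 6] ab nonsquare_6 by auto
    next
      case False
      then have "a ^ 2 = of_nat 2" using * by simp
      then show False using Rats_square_nonsquare[of a 2] ab nonsquare_2 by auto
    qed
  qed
qed

text \<open>As no 2-power of \<open>zeta 12\<close> is rational, adjoining 2-power roots to \<rat>
  covers only m = 4; for m = 12 the field is presented as a quadratic extension of
  \<open>Kfld 4\<close>.\<close>

lemma subfield_C_Kfld_4_12:
  assumes "m = 4 \<or> m = 12" shows "subfield_C (Kfld m)"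
proof -
  have *: "subfield_C (adj \<rat> (zeta 4))"
    by (rule subfield_C_adj_root[OF subfield_C_Rats, of _ 1]) (simp add: zeta_4)
  have "subfield_C (Kfld 12)"
    unfolding subfield_C_def
  proof (intro conjI ballI)
    show "subring_C (Kfld 12)" unfolding Kfld_eq_adj by (rule subring_C_adj[OF subring_C_Rats])
    let ?s = "complex_of_real (sqrt 3)"
    have q: "subfield_C (qext (Kfld 4) ?s)"
      by (rule subfield_C_qext)
         (use * in \<open>simp_all add: Kfld_eq_adj subring_C_numeral subfield_C_subring flip: of_real_power\<close>)
    have "qext (Kfld 4) ?s = Kfld 12"
    proof (intro equalityI subsetI)
      fix x assume "x \<in> qext (Kfld 4) ?s"
      then obtain a b c d where "a \<in> \<rat>" "b \<in> \<rat>" "c \<in> \<rat>" "d \<in> \<rat>" "x = Complex a b + Complex c d * ?s"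
        unfolding qext_def Kfld_4_iff by blast
      moreover from this have "x = Complex (a + c * sqrt 3) (b + d * sqrt 3)"
        by (simp add: complex_eq_iff)
      ultimately show "x \<in> Kfld 12" unfolding Kfld_12_iff by blast
    next
      fix x assume "x \<in> Kfld 12"
      then obtain a b c d where "a \<in> \<rat>" "b \<in> \<rat>" "c \<in> \<rat>" "d \<in> \<rat>"
        "x = Complex (a + c * sqrt 3) (b + d * sqrt 3)" unfolding Kfld_12_iff by blast
      moreover from this have "x = Complex a b + Complex c d * ?s" by (simp add: complex_eq_iff)
      ultimately show "x \<in> qext (Kfld 4) ?s" unfolding qext_def Kfld_4_iff by blast
    qed
    then show "inverse x \<in> Kfld 12" if "x \<in> Kfld 12" for x
      using q that subfield_C_inverse by metis
  qed
  with * assms show ?thesis by (auto simp: Kfld_eq_adj)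
qed

section \<open>Automorphisms of the cyclotomic field\<close>

lemma sum_swap_blocks:
  fixes f :: "nat \<Rightarrow> 'a::comm_monoid_add"
  shows "(\<Sum>i<k * d. f i) = (\<Sum>j<d. \<Sum>t<k. f (j + d * t))"
proof (induction k)
  case (Suc k)
  have "(\<Sum>i<Suc k * d. f i) = (\<Sum>i<k * d + d. f i)" by (simp add: add.commute)
  also have "\<dots> = (\<Sum>j<d. \<Sum>t<k. f (j + d * t)) + (\<Sum>j<d. f (k * d + j))"
    by (simp only: sum_lessThan_add Suc)
  also have "\<dots> = (\<Sum>j<d. \<Sum>t<Suc k. f (j + d * t))"
    by (simp add: sum.distrib algebra_simps)
  finally show ?case .
qed simp

lemma coeffs_in_pcompose:
  assumes S: "subring_C S" and p: "coeffs_in S p" and q: "coeffs_in S q"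
  shows "coeffs_in S (pcompose p q)"
  using S p
  by (induction rule: coeffs_in_induct)
     (auto simp: pcompose_pCons intro!: coeffs_in_0 coeffs_in_add coeffs_in_mult coeffs_in_const S q)

lemma Kfld_subring: "subring_C (Kfld n)"
  unfolding Kfld_eq_adj by (intro subring_C_adj subring_C_Rats)

definition cyc_poly :: "nat \<Rightarrow> complex poly" where
  "cyc_poly m = (if m = 4 then [:1, 0, 1:] else [:1, 0, -1, 0, 1:])"

lemma root_of_unity_eq_zeta_power:
  assumes "n > 0" "z ^ n = 1" obtains j where "j < n" "z = zeta n ^ j"
proof -
  have "z \<in> (\<lambda>k. cis (2 * pi * real k / real n)) ` {..<n}"
    using Complex.bij_betw_roots_unity[OF assms(1)] assms(2) by (auto simp: bij_betw_def)
  then show ?thesis using that by (auto simp: zeta_power)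
qed

text \<open>For m = 12 the square w of \<open>zeta 12\<close> is a primitive sixth root of unity
  with w^2 = w - 1. An exponent prime to 12 is 1 or 5 modulo 6, so w^l is w or 1 - w, the two roots
  of X^2 - X + 1.\<close>

lemma cyc_poly_zeta_power:
  assumes m: "m = 4 \<or> m = 12" and l: "coprime l m"
  shows "poly (cyc_poly m) (zeta m ^ l) = 0"
  using m
proof
  assume m: "m = 4"
  have "coprime l (2 * 2)" using l m by simp
  then have "odd l" unfolding coprime_mult_right_iff by (simp add: coprime_right_2_iff_odd)
  moreover have "(\<i> ^ l) ^ 2 = (\<i> ^ 2) ^ l" by (metis mult.commute power_mult)
  ultimately have "(\<i> ^ l) ^ 2 = (-1 :: complex)" by simp
  then show ?thesis by (simp add: m cyc_poly_def zeta_4 power2_eq_square)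
next
  assume m: "m = 12"
  define w where "w = zeta 12 ^ 2"
  have w: "w ^ 2 = w - 1" "w ^ 3 = -1"
    by (simp_all add: w_def zeta_12 complex_eq_iff power2_eq_square power3_eq_cube algebra_simps)
  have "w ^ 6 = (w ^ 3) ^ 2" by (simp flip: power_mult)
  then have w6: "w ^ 6 = 1" by (simp add: w)
  have "l mod 6 = 1 \<or> l mod 6 = 5"
  proof -
    have "coprime l (2 * 2 * 3)" using l m by simp
    then have "coprime l 2" "coprime l 3" unfolding coprime_mult_right_iff by auto
    then have "odd l" "\<not> 3 dvd l"
      using coprime_right_2_iff_odd coprime_absorb_right[of 3 l] by auto
    then show ?thesis by presburger
  qed
  moreover have "w ^ l = w ^ (l mod 6)"
  proof -
    have "w ^ l = w ^ (6 * (l div 6) + l mod 6)" by simp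
    also have "\<dots> = w ^ (l mod 6)" by (simp only: power_add power_mult w6 power_one mult_1)
    finally show ?thesis .
  qed
  moreover have "w ^ 5 = 1 - w"
  proof -
    have "w ^ 5 = w ^ 3 * w ^ 2" by (simp flip: power_add)
    then show ?thesis by (simp add: w)
  qed
  ultimately have "w ^ l = w \<or> w ^ l = 1 - w" by auto
  then have "(w ^ l) ^ 2 = w ^ l - 1"
    using w(1) by (auto simp: power2_diff)
  then have "(zeta 12 ^ l) ^ 4 = (zeta 12 ^ l) ^ 2 - 1"
    by (simp add: w_def mult.commute flip: power_mult)
  then show ?thesis
    by (simp add: m cyc_poly_def algebra_simps power2_eq_square power4_eq_xxxx)
qed

lemma cyc_poly_indep:
  assumes m: "m = 4 \<or> m = 12" and a: "\<And>t. a t \<in> \<rat>"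
    and 0: "(\<Sum>t<degree (cyc_poly m). a t * zeta m ^ t) = 0" and t: "t < degree (cyc_poly m)"
  shows "a t = 0"
proof -
  obtain b where b: "\<And>t. b t \<in> \<rat>" "\<And>t. a t = complex_of_real (b t)"
    using a unfolding Rats_complex_iff by metis
  from m show ?thesis
  proof
    assume m: "m = 4"
    have "{..<degree (cyc_poly m)} = {0, 1}" by (auto simp: m cyc_poly_def)
    then have "b 0 = 0 \<and> b 1 = 0" using 0 by (simp add: m zeta_4 b complex_eq_iff)
    then show ?thesis using t b by (auto simp: m cyc_poly_def less_Suc_eq)
  next
    assume m: "m = 12"
    have "{..<degree (cyc_poly m)} = {0, 1, 2, 3}" by (auto simp: m cyc_poly_def)
    then have "(b 0 + b 2 / 2) + (b 1 / 2) * sqrt 3 = 0 \<and> (b 1 / 2 + b 3) + (b 2 / 2) * sqrt 3 = 0"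
      using 0 by (simp add: m zeta_12 b complex_eq_iff power2_eq_square power3_eq_cube algebra_simps)
    then have "b 0 = 0 \<and> b 1 = 0 \<and> b 2 = 0 \<and> b 3 = 0"
      using Rats_sqrt3_indep[of "b 0 + b 2 / 2" "b 1 / 2"] Rats_sqrt3_indep[of "b 1 / 2 + b 3" "b 2 / 2"] b
      by auto
    moreover have "t = 0 \<or> t = 1 \<or> t = 2 \<or> t = 3" using t by (auto simp: m cyc_poly_def)
    ultimately show ?thesis using b by auto
  qed
qed

locale cyclo =
  fixes m e n :: nat
  assumes m: "m = 4 \<or> m = 12" and n_eq: "n = m * 2 ^ e"
begin

abbreviation "\<zeta> \<equiv> zeta n"
abbreviation "K \<equiv> Kfld n"
abbreviation "R \<equiv> Rring n"
abbreviation "K0 \<equiv> Kfld m"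
abbreviation "Oz \<equiv> adj \<int> \<zeta>"

lemma m_pos: "m > 0" and n_pos: "n > 0"
  using m n_eq by auto

lemma four_dvd_m: "4 dvd m" and odd_m_div_4: "odd (m div 4)"
  using m by auto

lemma zeta_pow_d: "\<zeta> ^ (2 ^ e) = zeta m"
  unfolding n_eq by (rule zeta_mult_power) simp

lemma zeta_m_pow_m4: "zeta m ^ (m div 4) = \<i>"
proof -
  have "zeta (4 * (m div 4)) ^ (m div 4) = zeta 4" using m by (intro zeta_mult_power) auto
  then show ?thesis using four_dvd_m by (simp add: zeta_4)
qed

lemma K0_subfield: "subfield_C K0"
  by (rule subfield_C_Kfld_4_12[OF m])

lemmas K0_subring = subfield_C_subring[OF K0_subfield]

lemma zeta_m_in_K0: "zeta m \<in> K0"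
  unfolding Kfld_eq_adj by (rule adj_gen[OF subring_C_Rats])

lemma i_in_K0: "\<i> \<in> K0"
  using subring_C_power[OF K0_subring zeta_m_in_K0] zeta_m_pow_m4 by metis

lemma zeta_in_Oz: "\<zeta> \<in> Oz"
  by (rule adj_gen[OF subring_C_Ints])

lemma Oz_subring: "subring_C Oz"
  by (rule subring_C_adj[OF subring_C_Ints])

lemma zeta_m_in_Oz: "zeta m \<in> Oz"
  unfolding zeta_pow_d[symmetric] by (rule subring_C_power[OF Oz_subring zeta_in_Oz])

lemma i_in_Oz: "\<i> \<in> Oz"
  using subring_C_power[OF Oz_subring zeta_m_in_Oz] zeta_m_pow_m4 by metis

lemma R_subring: "subring_C R"
  unfolding Rring_eq_halves by (intro subring_C_halves Oz_subring)

lemma Oz_subset_R: "Oz \<subseteq> R"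
  unfolding Rring_eq_halves by (rule halves_base)

lemma zeta_in_K: "\<zeta> \<in> K"
  unfolding Kfld_eq_adj by (rule adj_gen[OF subring_C_Rats])

lemma K_subring: "subring_C K"
  by (rule Kfld_subring)

lemma K0_subset_K: "K0 \<subseteq> K"
proof -
  have "zeta m \<in> K"
    unfolding zeta_pow_d[symmetric] by (rule subring_C_power[OF K_subring zeta_in_K])
  then show ?thesis
    using K_subring adj_base[OF subring_C_Rats, of \<zeta>]
    unfolding Kfld_eq_adj by (intro adj_least) auto
qed

lemma K_subfield: "subfield_C K"
proof -
  have "subfield_C (adj K0 \<zeta>)"
    by (rule subfield_C_adj_root[OF K0_subfield, of _ e]) (simp add: zeta_pow_d zeta_m_in_K0)
  moreover have "adj K0 \<zeta> \<subseteq> K"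
    by (intro adj_least K_subring K0_subset_K zeta_in_K)
  moreover have "K \<subseteq> adj K0 \<zeta>"
    unfolding Kfld_eq_adj[of n]
    using adj_base[OF K0_subring, of \<zeta>] Rats_subset_subfield_C[OF K0_subfield]
    by (intro adj_least subring_C_adj K0_subring adj_gen) auto
  ultimately show ?thesis by simp
qed

lemma Rats_subset_K: "\<rat> \<subseteq> K"
  by (rule Rats_subset_subfield_C[OF K_subfield])

lemma Oz_subset_K: "Oz \<subseteq> K"
  by (intro adj_least K_subring Ints_subset_subring_C zeta_in_K)

lemma R_subset_K: "R \<subseteq> K"
proof
  fix x assume "x \<in> R"
  then obtain y k where "x = y / 2 ^ k" "y \<in> Oz" by (auto simp: Rring_eq_halves halves_def)
  then show "x \<in> K"
    using Oz_subset_K subfield_C_divide[OF K_subfield] subring_C_power[OF K_subring subring_C_numeral[OF K_subring]]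
    by (metis subsetD)
qed

lemma K_divide: "x \<in> K \<Longrightarrow> y \<in> K \<Longrightarrow> x / y \<in> K" and K_inverse: "x \<in> K \<Longrightarrow> inverse x \<in> K"
  by (simp_all add: subfield_C_divide[OF K_subfield] subfield_C_inverse[OF K_subfield])

lemmas K_closed = subring_C_closed[OF K_subring] K_divide K_inverse zeta_in_K

lemmas R_closed = subring_C_closed[OF R_subring]

lemmas Oz_closed = subring_C_closed[OF Oz_subring] zeta_in_Oz

text \<open>Raising a square root of \<open>zeta m\<close> to the power m div 4 gives a square root
  w of \<i>, and (w + 1/w)^2 = \<i> - \<i> + 2. So K0 would contain a square root of 2.\<close>

lemma zeta_m_nonsquare: "\<forall>y\<in>K0. y ^ 2 \<noteq> zeta m"
proof (intro ballI notI)
  fix y assume y: "y \<in> K0" "y ^ 2 = zeta m"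
  define w where "w = y ^ (m div 4)"
  have w2: "w ^ 2 = \<i>"
    by (metis w_def mult.commute power_mult y(2) zeta_m_pow_m4)
  then have "w \<noteq> 0" by auto
  then have "(w + inverse w) ^ 2 = w ^ 2 + inverse (w ^ 2) + 2"
    by (simp add: field_simps power2_eq_square)
  then have "(w + inverse w) ^ 2 = 2" by (simp add: w2)
  moreover have "w + inverse w \<in> K0"
    unfolding w_def using y
    by (intro subring_C_add[OF K0_subring] subfield_C_inverse[OF K0_subfield] subring_C_power[OF K0_subring])
  ultimately show False using sqrt2_notin_Kfld[OF m] by blast
qed

text \<open>The n-th cyclotomic polynomial: m already contains all primes of n, hence it arises from
  the one of order m by substituting X^(2^e).\<close>

definition Phi :: "complex poly" where
  "Phi = pcompose (cyc_poly m) (monom 1 (2 ^ e))"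

lemma poly_Phi: "poly Phi x = poly (cyc_poly m) (x ^ (2 ^ e))"
  by (simp add: Phi_def poly_pcompose poly_monom)

lemma degree_Phi: "degree Phi = degree (cyc_poly m) * 2 ^ e"
  by (simp add: Phi_def degree_pcompose degree_monom_eq)

lemma degree_cyc_poly_pos: "degree (cyc_poly m) > 0"
  by (simp add: cyc_poly_def)

lemma lead_coeff_Phi: "lead_coeff Phi = 1"
  unfolding Phi_def by (subst lead_coeff_comp) (simp_all add: degree_monom_eq cyc_poly_def)

lemma coeffs_in_Phi: "coeffs_in \<int> Phi"
  unfolding Phi_def
  by (intro coeffs_in_pcompose subring_C_Ints coeffs_in_monom)
     (auto simp: cyc_poly_def coeffs_in_pCons subring_C_Ints coeffs_in_0)

lemma poly_Phi_zeta_power: "coprime l n \<Longrightarrow> poly Phi (\<zeta> ^ l) = 0"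
proof -
  assume l: "coprime l n"
  have "(\<zeta> ^ l) ^ (2 ^ e) = zeta m ^ l"
    by (metis mult.commute power_mult zeta_pow_d)
  then show ?thesis
    using l cyc_poly_zeta_power[OF m, of l] by (simp add: poly_Phi n_eq)
qed

lemma poly_Phi_zeta: "poly Phi \<zeta> = 0"
  using poly_Phi_zeta_power[of 1] by simp

lemma K0_indep:
  assumes "\<And>j. j < 2 ^ e \<Longrightarrow> c j \<in> K0" "(\<Sum>j<2 ^ e. c j * \<zeta> ^ j) = 0" "j < 2 ^ e"
  shows "c j = 0"
  using root_linear_independent[OF K0_subfield i_in_K0 zeta_m_in_K0 zeta_m_nonsquare zeta_pow_d] assms
  by blast

text \<open>Exponents are sorted by residue modulo 2^e. The inner sums are elements of K0 and vanish
  by independence over K0; within K0 there are explicit coordinates. Thus \<open>Phi\<close> is the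
  minimal polynomial of \<zeta>.\<close>

lemma Rats_indep:
  assumes a: "\<And>j. a j \<in> \<rat>" and 0: "(\<Sum>j<degree Phi. a j * \<zeta> ^ j) = 0" and j: "j < degree Phi"
  shows "a j = 0"
proof -
  define c where "c j = (\<Sum>t<degree (cyc_poly m). a (j + 2 ^ e * t) * zeta m ^ t)" for j
  have aK: "a i \<in> K0" for i using a Rats_subset_subfield_C[OF K0_subfield] by blast
  have "c i \<in> K0" for i
    unfolding c_def
    by (intro subring_C_sum[OF K0_subring] subring_C_mult[OF K0_subring] aK subring_C_power[OF K0_subring] zeta_m_in_K0)
  moreover have "(\<Sum>j<2 ^ e. c j * \<zeta> ^ j) = 0"
  proof -
    have "0 = (\<Sum>j<2 ^ e. \<Sum>t<degree (cyc_poly m). a (j + 2 ^ e * t) * \<zeta> ^ (j + 2 ^ e * t))"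
      using 0 unfolding degree_Phi sum_swap_blocks by simp
    also have "\<dots> = (\<Sum>j<2 ^ e. c j * \<zeta> ^ j)"
      unfolding c_def power_add power_mult zeta_pow_d sum_distrib_right
      by (intro sum.cong refl) (simp add: mult_ac)
    finally show ?thesis by simp
  qed
  ultimately have *: "c (j mod 2 ^ e) = 0" by (intro K0_indep[of c]) auto
  have "j div 2 ^ e < degree (cyc_poly m)"
    using j unfolding degree_Phi by (simp add: less_mult_imp_div_less)
  then have "a (j mod 2 ^ e + 2 ^ e * (j div 2 ^ e)) = 0"
    using cyc_poly_indep[OF m, of "\<lambda>t. a (j mod 2 ^ e + 2 ^ e * t)"] * a
    unfolding c_def by blast
  then show ?thesis by simp
qed

text \<open>A rational relation for \<zeta> leaves remainder 0 modulo \<open>Phi\<close>, hence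
  holds at every root of \<open>Phi\<close>. This makes the substitution \<zeta> -> \<zeta>^l well
  defined.\<close>

lemma poly_conjugate_eq_0:
  assumes p: "coeffs_in \<rat> p" "poly p \<zeta> = 0" and w: "poly Phi w = 0"
  shows "poly p w = 0"
proof -
  have Q: "coeffs_in \<rat> Phi" using coeffs_in_Phi by (rule coeffs_in_mono[rotated]) (auto elim: Ints_cases)
  obtain q r where *: "coeffs_in \<rat> r" "p = q * Phi + r" "\<forall>i\<ge>degree Phi. coeff r i = 0"
    using monic_division[OF subring_C_Rats p(1) Q lead_coeff_Phi refl] degree_cyc_poly_pos
    by (auto simp: degree_Phi)
  have "poly r \<zeta> = 0" using p(2) by (simp add: * poly_Phi_zeta)
  then have "coeff r i = 0" if "i < degree Phi" for i
    using that *(1) Rats_indep[of "coeff r"] by (simp add: poly_eq_sum_lessThan[OF *(3)] coeffs_in_def)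
  then have "poly r w = 0" by (simp add: poly_eq_sum_lessThan[OF *(3)])
  then show ?thesis by (simp add: * w)
qed

text \<open>Evaluates a chosen polynomial for x at \<zeta>^l. For l prime to n the choice is
  irrelevant; for other l, or outside K, the value carries no meaning.\<close>

definition aut :: "nat \<Rightarrow> complex \<Rightarrow> complex" where
  "aut l x = poly (SOME p. coeffs_in \<rat> p \<and> poly p \<zeta> = x) (\<zeta> ^ l)"

lemma aut_poly:
  assumes "coprime l n" "coeffs_in \<rat> p" shows "aut l (poly p \<zeta>) = poly p (\<zeta> ^ l)"
proof -
  define q where "q = (SOME q. coeffs_in \<rat> q \<and> poly q \<zeta> = poly p \<zeta>)"
  have q: "coeffs_in \<rat> q \<and> poly q \<zeta> = poly p \<zeta>"
    unfolding q_def by (rule someI[of _ p]) (use assms in auto)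
  have "poly (q - p) (\<zeta> ^ l) = 0"
    by (rule poly_conjugate_eq_0)
       (use q assms in \<open>simp_all add: coeffs_in_diff subring_C_Rats poly_Phi_zeta_power\<close>)
  then show ?thesis by (simp add: aut_def q_def)
qed

text \<open>Commuting with \<open>cnj\<close> is built in, which is no restriction for an abelian
  Galois group: it keeps real elements real and makes the conjugates of x * cnj x absolute squares.
  Complex conjugation is itself an instance, which gives the closure of R and \<open>Oz\<close>
  under it.\<close>

definition is_aut :: "(complex \<Rightarrow> complex) \<Rightarrow> bool" where
  "is_aut f \<longleftrightarrow> (\<forall>x\<in>K. \<forall>y\<in>K. f (x + y) = f x + f y \<and> f (x * y) = f x * f y) \<and> f 1 = 1 \<and>
     (\<forall>x\<in>K. f x \<in> K \<and> f (cnj x) = cnj (f x))"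

lemma K_cnj: "x \<in> K \<Longrightarrow> cnj x \<in> K"
proof -
  assume "x \<in> K"
  then obtain p where p: "x = poly p \<zeta>" "coeffs_in \<rat> p" by (auto simp: Kfld_eq_adj adj_def)
  have "cnj (coeff p i) = coeff p i" for i
    using p(2) Rats_subset_Reals unfolding coeffs_in_def by (meson Reals_cnj_iff subsetD)
  then have "cnj x = poly p (inverse \<zeta>)" by (simp add: p poly_altdef cnj_zeta)
  then show ?thesis
    using p(2) coeffs_in_mono[OF Rats_subset_K] by (auto intro!: poly_in_subring_C K_subring K_inverse zeta_in_K)
qed

lemma is_aut_aut:
  assumes l: "coprime l n" shows "is_aut (aut l)"
  unfolding is_aut_def
proof (intro conjI ballI)
  have "aut l (poly [:1:] \<zeta>) = 1"
    by (subst aut_poly[OF l]) (simp_all add: coeffs_in_const subring_C_Rats)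
  then show "aut l 1 = 1" by simp
  fix x assume "x \<in> K"
  then obtain p where p: "x = poly p \<zeta>" "coeffs_in \<rat> p" by (auto simp: Kfld_eq_adj adj_def)
  show "aut l x \<in> K"
    using p(2) coeffs_in_mono[OF Rats_subset_K]
    by (auto simp: p aut_poly[OF l] intro!: poly_in_subring_C K_subring K_closed)
  have cp: "cnj (coeff p i) = coeff p i" for i
    using p(2) Rats_subset_Reals unfolding coeffs_in_def by (meson Reals_cnj_iff subsetD)
  \<comment> \<open>On powers of \<zeta> conjugation is the substitution \<zeta> -> \<zeta>^(n-1);
    written this way it yields a rational polynomial in \<zeta> again, to which
    \<open>aut_poly\<close> applies.\<close>
  have "cnj x = poly (pcompose p (monom 1 (n - 1))) \<zeta>"
    by (simp add: p poly_pcompose poly_monom poly_altdef[of p] cp cnj_zeta inverse_zeta[OF n_pos])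
  moreover have "aut l (poly (pcompose p (monom 1 (n - 1))) \<zeta>) = poly (pcompose p (monom 1 (n - 1))) (\<zeta> ^ l)"
    by (intro aut_poly l coeffs_in_pcompose coeffs_in_monom subring_C_Rats p) auto
  moreover have "\<dots> = cnj (poly p (\<zeta> ^ l))"
    by (simp add: poly_pcompose poly_monom poly_altdef[of p] cp cnj_zeta inverse_zeta[OF n_pos]
        mult_ac flip: power_mult)
  ultimately show "aut l (cnj x) = cnj (aut l x)"
    by (simp add: p aut_poly[OF l])
  fix y assume "y \<in> K"
  then obtain q where q: "y = poly q \<zeta>" "coeffs_in \<rat> q" by (auto simp: Kfld_eq_adj adj_def)
  have "x + y = poly (p + q) \<zeta>" "x * y = poly (p * q) \<zeta>" by (simp_all add: p q)
  then show "aut l (x + y) = aut l x + aut l y" "aut l (x * y) = aut l x * aut l y"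
    using p q by (simp_all add: aut_poly[OF l] coeffs_in_add coeffs_in_mult subring_C_Rats
        del: poly_add poly_mult) simp_all
qed

lemma aut_zeta: "coprime l n \<Longrightarrow> aut l \<zeta> = \<zeta> ^ l"
  using aut_poly[of l "[:0, 1:]"] by (simp add: coeffs_in_pCons coeffs_in_0 subring_C_Rats)

context
  fixes f assumes f: "is_aut f"
begin

lemma is_aut_add: "x \<in> K \<Longrightarrow> y \<in> K \<Longrightarrow> f (x + y) = f x + f y"
  and is_aut_mult: "x \<in> K \<Longrightarrow> y \<in> K \<Longrightarrow> f (x * y) = f x * f y"
  and is_aut_1: "f 1 = 1" and is_aut_K: "x \<in> K \<Longrightarrow> f x \<in> K"
  and is_aut_cnj: "x \<in> K \<Longrightarrow> f (cnj x) = cnj (f x)"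
  using f by (auto simp: is_aut_def)

lemma is_aut_0: "f 0 = 0"
  using is_aut_add[of 0 0] subring_C_0[OF K_subring] by simp

lemma is_aut_uminus: "x \<in> K \<Longrightarrow> f (- x) = - f x"
  using is_aut_add[of x "- x"] subring_C_uminus[OF K_subring, of x] is_aut_0
  by (simp add: eq_neg_iff_add_eq_0 add.commute)

lemma is_aut_power: "x \<in> K \<Longrightarrow> f (x ^ k) = f x ^ k"
  by (induction k) (simp_all add: is_aut_1 is_aut_mult K_closed)

lemma is_aut_sum: "(\<And>i. i \<in> A \<Longrightarrow> g i \<in> K) \<Longrightarrow> f (sum g A) = (\<Sum>i\<in>A. f (g i))"
  by (induction A rule: infinite_finite_induct) (simp_all add: is_aut_0 is_aut_add K_closed)

lemma is_aut_prod: "(\<And>i. i \<in> A \<Longrightarrow> g i \<in> K) \<Longrightarrow> f (prod g A) = (\<Prod>i\<in>A. f (g i))"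
  by (induction A rule: infinite_finite_induct) (simp_all add: is_aut_1 is_aut_mult K_closed)

lemma is_aut_nonzero: "x \<in> K \<Longrightarrow> x \<noteq> 0 \<Longrightarrow> f x \<noteq> 0"
  using is_aut_mult[of x "inverse x"] K_inverse[of x] is_aut_1 by auto

lemma is_aut_inverse: "x \<in> K \<Longrightarrow> f (inverse x) = inverse (f x)"
  using is_aut_mult[of x "inverse x"] K_inverse[of x] is_aut_1 is_aut_0
  by (cases "x = 0") (auto intro: inverse_unique[symmetric])

lemma is_aut_divide: "x \<in> K \<Longrightarrow> y \<in> K \<Longrightarrow> f (x / y) = f x / f y"
  by (simp add: divide_inverse is_aut_mult is_aut_inverse K_inverse)

lemma is_aut_of_nat: "f (of_nat k) = of_nat k"
  by (induction k) (simp_all add: is_aut_0 is_aut_1 is_aut_add K_closed)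

lemma is_aut_of_int: "f (of_int k) = of_int k"
  by (cases k rule: int_cases2) (simp_all add: is_aut_of_nat is_aut_uminus K_closed)

lemma is_aut_Rats: "x \<in> \<rat> \<Longrightarrow> f x = x"
  by (auto elim!: Rats_cases' simp: is_aut_divide K_closed is_aut_of_int)

lemma is_aut_poly:
  assumes p: "coeffs_in \<rat> p" and x: "x \<in> K" shows "f (poly p x) = poly p (f x)"
  using subring_C_Rats p
proof (induction p rule: coeffs_in_induct)
  case (pCons a p)
  have "poly p x \<in> K" "a \<in> K"
    using pCons x coeffs_in_mono[OF Rats_subset_K] Rats_subset_K by (auto intro!: poly_in_subring_C K_subring)
  then show ?case using pCons x by (simp add: is_aut_add is_aut_mult is_aut_Rats K_closed)
qed (simp_all add: is_aut_0)

text \<open>An automorphism sends \<zeta> to an n-th root of unity, hence to a power of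
  \<zeta>.\<close>

lemma is_aut_Oz: assumes "x \<in> Oz" shows "f x \<in> Oz"
proof -
  obtain p where p: "x = poly p \<zeta>" "coeffs_in \<int> p" using assms by (auto simp: adj_def)
  have "f \<zeta> ^ n = 1"
    using is_aut_power[OF zeta_in_K, of n] by (simp add: zeta_power_self n_pos is_aut_1)
  then obtain j where "f \<zeta> = \<zeta> ^ j" using root_of_unity_eq_zeta_power[OF n_pos] by blast
  moreover have "f x = poly p (f \<zeta>)"
    unfolding p using p(2) by (intro is_aut_poly zeta_in_K) (auto elim!: coeffs_in_mono[rotated] Ints_cases)
  ultimately show ?thesis
    using p(2) coeffs_in_mono[OF Ints_subset_subring_C[OF Oz_subring]]
    by (auto intro!: poly_in_subring_C Oz_closed Oz_subring)
qed

lemma is_aut_R: assumes "x \<in> R" shows "f x \<in> R"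
proof -
  obtain y k where "x = y / 2 ^ k" "y \<in> Oz"
    using assms by (auto simp: Rring_eq_halves halves_def)
  moreover from this have "f x = f y / 2 ^ k"
    using Oz_subset_K is_aut_of_nat[of 2]
    by (subst \<open>x = _\<close>, subst is_aut_divide) (auto simp: is_aut_power K_closed)
  ultimately show ?thesis
    unfolding Rring_eq_halves using is_aut_Oz by (auto intro: halvesI)
qed

lemma is_aut_real: "x \<in> K \<Longrightarrow> x \<in> \<real> \<Longrightarrow> f x \<in> \<real>"
  by (metis Reals_cnj_iff is_aut_cnj)

end

lemma is_aut_comp: "is_aut f \<Longrightarrow> is_aut g \<Longrightarrow> is_aut (f \<circ> g)"
  by (simp add: is_aut_def)

lemma is_aut_id: "is_aut id"
  by (simp add: is_aut_def)

lemma is_aut_funpow: "is_aut f \<Longrightarrow> is_aut (f ^^ k)"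
  by (induction k) (auto intro: is_aut_comp simp: is_aut_id[unfolded id_def] is_aut_id)

lemma R_cnj: "x \<in> R \<Longrightarrow> cnj x \<in> R"
  by (rule is_aut_R[where f = cnj]) (auto simp: is_aut_def K_cnj)

lemma Oz_cnj: "x \<in> Oz \<Longrightarrow> cnj x \<in> Oz"
  by (rule is_aut_Oz[where f = cnj]) (auto simp: is_aut_def K_cnj)

text \<open>x has integral coordinates in the powers of \<zeta> and, being rational, also the single
  coordinate x at \<zeta>^0. By independence over \<rat> the two agree.\<close>

lemma Oz_Rats:
  assumes "x \<in> Oz" "x \<in> \<rat>" shows "x \<in> \<int>"
proof -
  obtain c where c: "\<And>i. c i \<in> \<int>" "x = (\<Sum>i<degree Phi. c i * \<zeta> ^ i)"
    using adj_coordinates[OF subring_C_Ints coeffs_in_Phi lead_coeff_Phi refl _ poly_Phi_zeta assms(1)]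
      degree_cyc_poly_pos by (auto simp: degree_Phi)
  define a where "a i = c i - (if i = 0 then x else 0)" for i
  have "degree Phi > 0" using degree_cyc_poly_pos by (simp add: degree_Phi)
  have "a i \<in> \<rat>" for i using c(1)[of i] assms(2) by (auto simp: a_def elim!: Ints_cases)
  moreover have "(\<Sum>i<degree Phi. a i * \<zeta> ^ i) = 0"
    using \<open>degree Phi > 0\<close>
    by (simp add: a_def left_diff_distrib sum_subtractf if_distrib[of "\<lambda>x. x * _"] sum.delta flip: c(2) cong: if_cong)
  ultimately have "a 0 = 0" using \<open>degree Phi > 0\<close> by (intro Rats_indep[of a])
  then have "x = c 0" by (simp add: a_def)
  then show ?thesis using c by simp
qed

lemma R_Rats:
  assumes "x \<in> R" "x \<in> \<rat>" obtains a k where "x = of_int a / 2 ^ k"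
proof -
  obtain y k where y: "x = y / 2 ^ k" "y \<in> Oz"
    using assms by (auto simp: Rring_eq_halves halves_def)
  then have "y = x * 2 ^ k" by simp
  then have "y \<in> \<rat>" using assms by simp
  then obtain a where "y = of_int a" using Oz_Rats y(2) by (auto elim: Ints_cases)
  then show ?thesis using that y(1) by auto
qed

end

section \<open>Power sums and products over the powers of \<open>Suc m\<close>\<close>

text \<open>These are the exponents of \<zeta> under iterates of \<sigma>, and the factor m 2^i is
  exact up to odd numbers. Squaring 1 + m 2^i u doubles it, and the quadratic term only adds an even
  number to u because 4 divides m.\<close>

lemma succ_power_two_power:
  assumes "4 dvd m"
  shows "\<exists>u. odd u \<and> Suc m ^ (2 ^ i) = 1 + m * 2 ^ i * (u :: nat)"
proof (induction i)
  case (Suc i)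
  then obtain u where u: "odd u" "Suc m ^ (2 ^ i) = 1 + m * 2 ^ i * u" by blast
  obtain c where c: "m = 4 * c" using assms by blast
  have "Suc m ^ (2 ^ Suc i) = (1 + m * 2 ^ i * u) ^ 2"
    unfolding power_Suc2 power_mult u(2) ..
  also have "\<dots> = 1 + m * 2 ^ Suc i * (u + 2 * (c * 2 ^ i * u ^ 2))"
    by (simp add: c power2_eq_square algebra_simps)
  finally show ?case using u(1) by (intro exI[of _ "u + 2 * (c * 2 ^ i * u ^ 2)"]) simp
qed (auto intro: exI[of _ 1])

text \<open>The second half of an orbit of length 2^(e+1) is the first half times the sign s: after
  2^e steps \<eta> has become \<eta> s^u with u odd, and the remaining exponent is odd too, so the
  sign survives.\<close>

lemma power_half_orbit:
  fixes \<eta> :: complex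
  assumes "4 dvd m" and s: "\<eta> ^ (m * 2 ^ e) = s" "s = 1 \<or> s = - 1"
  shows "\<eta> ^ (Suc m ^ (2 ^ e + i)) = s * \<eta> ^ (Suc m ^ i)"
proof -
  obtain u where u: "odd u" "Suc m ^ (2 ^ e) = 1 + m * 2 ^ e * (u :: nat)"
    using succ_power_two_power[OF assms(1)] by blast
  have su: "s ^ u = s" and so: "s ^ (Suc m ^ i) = s"
    using s(2) u(1) assms(1) by auto
  have "\<eta> ^ (Suc m ^ (2 ^ e)) = \<eta> * s"
    unfolding u(2) power_add power_mult[of \<eta> "m * 2 ^ e" u] s(1) su by simp
  then have "\<eta> ^ (Suc m ^ (2 ^ e + i)) = (\<eta> * s) ^ (Suc m ^ i)"
    by (simp add: power_add power_mult)
  then show ?thesis by (simp add: power_mult_distrib so mult.commute)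
qed

text \<open>This computes the trace of a root of unity. Each halving of the orbit splits off a
  factor 1 + s with s = 1 or s = -1, so the sum vanishes as soon as some s is -1; if none is, every
  term equals \<eta>.\<close>

lemma sum_orbit:
  fixes \<eta> :: complex
  assumes "4 dvd m" "\<eta> ^ (m * 2 ^ e) = 1"
  shows "(\<Sum>i<2 ^ e. \<eta> ^ (Suc m ^ i)) = (if \<eta> ^ m = 1 then 2 ^ e * \<eta> else 0)"
  using assms(2)
proof (induction e)
  case (Suc e)
  define s where "s = \<eta> ^ (m * 2 ^ e)"
  have "s ^ 2 = 1"
    using Suc.prems by (simp add: s_def power_mult[symmetric] mult_ac)
  then have s: "s = 1 \<or> s = - 1" by (simp add: power2_eq_1_iff)
  have *: "(\<Sum>i<2 ^ Suc e. \<eta> ^ (Suc m ^ i)) = (1 + s) * (\<Sum>i<2 ^ e. \<eta> ^ (Suc m ^ i))"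
    unfolding power_Suc mult_2 sum_lessThan_add power_half_orbit[OF assms(1) s_def[symmetric] s]
    by (simp only: sum_distrib_left distrib_right mult_1 sum.distrib)
  show ?case
  proof (cases "s = 1")
    case True
    then show ?thesis using Suc.IH unfolding * by (simp add: s_def)
  next
    case False
    then have "s = -1" using s by blast
    moreover have "\<eta> ^ m \<noteq> 1" using False by (auto simp: s_def power_mult)
    ultimately show ?thesis unfolding * by simp
  qed
qed simp

text \<open>The orbit runs through \<eta> times all 2^e-th roots of unity. Its halves differ by the
  sign, so the factors pair up to differences of squares and the induction continues with
  \<eta>^2.\<close>

lemma prod_orbit:
  fixes \<eta> x :: complex
  assumes "4 dvd m" "e = 0 \<or> \<eta> ^ (m * 2 ^ (e - 1)) = - 1"
  shows "(\<Prod>i<2 ^ e. (x - \<eta> ^ (Suc m ^ i))) = x ^ (2 ^ e) - \<eta> ^ (2 ^ e)"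
  using assms(2)
proof (induction e arbitrary: \<eta> x)
  case (Suc e)
  then have s: "\<eta> ^ (m * 2 ^ e) = - 1" by simp
  have "(\<Prod>i<2 ^ Suc e. (x - \<eta> ^ (Suc m ^ i))) =
      (\<Prod>i<2 ^ e. (x - \<eta> ^ (Suc m ^ i)) * (x + \<eta> ^ (Suc m ^ i)))"
    unfolding power_Suc mult_2 prod_lessThan_add power_half_orbit[OF assms(1) s disjI2[OF refl]]
    by (simp add: prod.distrib)
  also have "\<dots> = (\<Prod>i<2 ^ e. (x ^ 2 - (\<eta> ^ 2) ^ (Suc m ^ i)))"
    by (intro prod.cong refl) (simp add: algebra_simps power2_eq_square power_mult_distrib)
  also have "\<dots> = (x ^ 2) ^ (2 ^ e) - (\<eta> ^ 2) ^ (2 ^ e)"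
  proof (rule Suc.IH)
    have "(\<eta> ^ 2) ^ (m * 2 ^ (e - 1)) = \<eta> ^ (m * 2 ^ e)" if "e \<noteq> 0"
      using that by (cases e) (simp_all add: power_mult[symmetric] mult_ac)
    then show "e = 0 \<or> (\<eta> ^ 2) ^ (m * 2 ^ (e - 1)) = - 1" using s by auto
  qed
  finally show ?case by (simp add: power_mult)
qed simp

context cyclo
begin

abbreviation "\<sigma> \<equiv> aut (Suc m)"

lemma coprime_succ_m: "coprime (Suc m) n"
  using m by (auto simp: n_eq)

lemmas is_aut_sigma = is_aut_aut[OF coprime_succ_m]

lemma is_aut_sigma_pow: "is_aut (\<sigma> ^^ i)"
  by (rule is_aut_funpow[OF is_aut_sigma])

lemma sigma_pow_zeta: "(\<sigma> ^^ i) \<zeta> = \<zeta> ^ (Suc m ^ i)"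
proof (induction i)
  case (Suc i)
  then have "(\<sigma> ^^ Suc i) \<zeta> = (\<zeta> ^ Suc m) ^ (Suc m ^ i)"
    using is_aut_power[OF is_aut_sigma zeta_in_K] aut_zeta[OF coprime_succ_m] by simp
  then show ?case by (simp only: power_mult power_Suc)
qed simp

lemma sigma_pow_poly: "coeffs_in \<rat> p \<Longrightarrow> (\<sigma> ^^ i) (poly p \<zeta>) = poly p (\<zeta> ^ (Suc m ^ i))"
  by (simp add: is_aut_poly[OF is_aut_sigma_pow] zeta_in_K sigma_pow_zeta)

lemma zeta_pow_n: "\<zeta> ^ n = 1"
  by (rule zeta_power_self[OF n_pos])

lemma sigma_pow_d: assumes "x \<in> K" shows "(\<sigma> ^^ (2 ^ e)) x = x"
proof -
  obtain p where p: "x = poly p \<zeta>" "coeffs_in \<rat> p" using assms by (auto simp: Kfld_eq_adj adj_def)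
  have "\<zeta> ^ (Suc m ^ (2 ^ e + 0)) = 1 * \<zeta> ^ (Suc m ^ 0)"
    by (rule power_half_orbit[OF four_dvd_m]) (simp_all flip: n_eq add: zeta_pow_n)
  then show ?thesis by (simp add: p sigma_pow_poly)
qed

lemma sigma_K0: "x \<in> K0 \<Longrightarrow> (\<sigma> ^^ i) x = x"
proof -
  assume "x \<in> K0"
  then obtain p where p: "x = poly p (zeta m)" "coeffs_in \<rat> p" by (auto simp: Kfld_eq_adj adj_def)
  have "\<sigma> (zeta m) = zeta m ^ (Suc m)"
    unfolding zeta_pow_d[symmetric] is_aut_power[OF is_aut_sigma zeta_in_K] aut_zeta[OF coprime_succ_m]
    by (simp only: mult.commute flip: power_mult)
  also have "\<dots> = zeta m" using zeta_power_self[OF m_pos] by simp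
  finally have "(\<sigma> ^^ i) (zeta m) = zeta m" by (induction i) auto
  then show ?thesis
    using p K0_subset_K zeta_m_in_K0 by (simp add: is_aut_poly[OF is_aut_sigma_pow] subsetD)
qed

definition Tr :: "complex \<Rightarrow> complex" where "Tr x = (\<Sum>i<2 ^ e. (\<sigma> ^^ i) x)"

definition Nm :: "complex \<Rightarrow> complex" where "Nm x = (\<Prod>i<2 ^ e. (\<sigma> ^^ i) x)"

lemma Tr_root_of_unity:
  assumes "w ^ n = 1" shows "Tr w = (if w ^ m = 1 then 2 ^ e * w else 0)"
proof -
  obtain j where j: "w = \<zeta> ^ j" using root_of_unity_eq_zeta_power[OF n_pos assms] by blast
  have "Tr w = (\<Sum>i<2 ^ e. w ^ (Suc m ^ i))"
    unfolding Tr_def j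
    by (intro sum.cong refl)
       (simp add: is_aut_power[OF is_aut_sigma_pow zeta_in_K] sigma_pow_zeta mult_ac flip: power_mult)
  then show ?thesis using sum_orbit[OF four_dvd_m] assms by (simp add: n_eq)
qed

lemma Tr_K0_mult: "c \<in> K0 \<Longrightarrow> x \<in> K \<Longrightarrow> Tr (c * x) = c * Tr x"
  unfolding Tr_def sum_distrib_left
  by (intro sum.cong refl) (use K0_subset_K in \<open>auto simp: is_aut_mult[OF is_aut_sigma_pow] sigma_K0\<close>)

lemma Tr_sum: "(\<And>i. i \<in> A \<Longrightarrow> g i \<in> K) \<Longrightarrow> Tr (sum g A) = (\<Sum>i\<in>A. Tr (g i))"
proof -
  assume "\<And>i. i \<in> A \<Longrightarrow> g i \<in> K"
  then have "Tr (sum g A) = (\<Sum>i<2 ^ e. \<Sum>a\<in>A. (\<sigma> ^^ i) (g a))"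
    unfolding Tr_def by (intro sum.cong refl is_aut_sum[OF is_aut_sigma_pow])
  then show ?thesis unfolding Tr_def using sum.swap by fastforce
qed

lemma root_of_unity_in_K0: "w ^ m = 1 \<Longrightarrow> w \<in> K0"
  by (metis root_of_unity_eq_zeta_power[OF m_pos] subring_C_power[OF K0_subring zeta_m_in_K0])

text \<open>Galois descent by averaging: a fixed x satisfies 2^e x = Tr x, and the trace of a power
  of \<zeta> is 0 or 2^e times an m-th root of unity.\<close>

lemma sigma_fixed:
  assumes x: "x \<in> K" "\<sigma> x = x" shows "x \<in> K0"
proof -
  obtain p where p: "x = poly p \<zeta>" "coeffs_in \<rat> p" using x by (auto simp: Kfld_eq_adj adj_def)
  have cK: "coeff p j \<in> K0" for j
    using p(2) Rats_subset_subfield_C[OF K0_subfield] by (auto simp: coeffs_in_def)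
  have "(\<sigma> ^^ i) x = x" for i by (induction i) (simp_all add: x)
  then have "2 ^ e * x = Tr x" by (simp add: Tr_def)
  also have "\<dots> = (\<Sum>j\<le>degree p. coeff p j * Tr (\<zeta> ^ j))"
    unfolding p poly_altdef using cK K0_subset_K
    by (subst Tr_sum) (auto simp: Tr_K0_mult K_closed intro!: K_closed)
  also have "\<dots> \<in> K0"
  proof (intro subring_C_sum[OF K0_subring] subring_C_mult[OF K0_subring] cK)
    fix j
    have "(\<zeta> ^ j) ^ n = 1" by (metis mult.commute power_mult power_one zeta_pow_n)
    then show "Tr (\<zeta> ^ j) \<in> K0"
      using root_of_unity_in_K0[of "\<zeta> ^ j"]
      by (simp add: Tr_root_of_unity subring_C_closed[OF K0_subring])
  qed
  finally have "2 ^ e * x \<in> K0" .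
  moreover have "2 ^ e \<in> K0" by (intro subring_C_closed[OF K0_subring])
  ultimately have "2 ^ e * x / 2 ^ e \<in> K0" by (rule subfield_C_divide[OF K0_subfield])
  then show ?thesis by simp
qed

section \<open>Units of \<^term>\<open>Rring n\<close> of absolute value one\<close>

definition Runit :: "complex \<Rightarrow> bool" where
  "Runit x \<longleftrightarrow> x \<in> R \<and> inverse x \<in> R \<and> x \<noteq> 0"

lemma Runit_mult: "Runit x \<Longrightarrow> Runit y \<Longrightarrow> Runit (x * y)"
  by (simp add: Runit_def R_closed)

lemma Runit_inverse: "Runit x \<Longrightarrow> Runit (inverse x)"
  by (simp add: Runit_def)

lemma Runit_divide: "Runit x \<Longrightarrow> Runit y \<Longrightarrow> Runit (x / y)"
  by (simp add: divide_inverse Runit_mult Runit_inverse)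

lemma Runit_1: "Runit 1"
  by (simp add: Runit_def R_closed)

lemma Runit_power: "Runit x \<Longrightarrow> Runit (x ^ k)"
  by (induction k) (simp_all add: Runit_1 Runit_mult)

lemma Runit_is_aut: "is_aut f \<Longrightarrow> Runit x \<Longrightarrow> Runit (f x)"
  unfolding Runit_def
  using is_aut_R is_aut_nonzero is_aut_inverse R_subset_K by (metis subsetD)

lemma Runit_cnj: "Runit x \<Longrightarrow> Runit (cnj x)"
  unfolding Runit_def using R_cnj by (metis complex_cnj_inverse complex_cnj_zero_iff)

lemma RunitI: "x \<in> R \<Longrightarrow> y \<in> R \<Longrightarrow> x * y = 1 \<Longrightarrow> Runit x"
  unfolding Runit_def by (metis inverse_unique mult_zero_left zero_neq_one)

lemma half_in_R: "1 / 2 \<in> R"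
  using halvesI[OF subring_C_1[OF Oz_subring], of 1] by (simp add: Rring_eq_halves)

lemma zeta_in_R: "\<zeta> \<in> R" and i_in_R: "\<i> \<in> R" and zeta_m_in_R: "zeta m \<in> R"
  using Oz_subset_R zeta_in_Oz i_in_Oz zeta_m_in_Oz by auto

lemma Runit_zeta: "Runit \<zeta>"
  by (metis RunitI Oz_subset_R R_cnj cnj_zeta right_inverse subsetD zeta_in_Oz zeta_nonzero)

lemma Runit_2: "Runit 2"
  by (rule RunitI[OF _ half_in_R]) (simp_all add: R_closed)

lemma sqrt3_Oz: "m = 12 \<Longrightarrow> complex_of_real (sqrt 3) \<in> Oz"
proof -
  assume m: "m = 12"
  have "2 * zeta m - \<i> \<in> Oz" by (intro Oz_closed zeta_m_in_Oz i_in_Oz)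
  then show ?thesis by (simp add: m zeta_12 complex_eq_iff Complex_eq mult_ac)
qed

text \<open>Serves the norm of 1 + \<zeta>, which is 1 - \<open>zeta m\<close> or, for e = 0, 1 +
  \<open>zeta m\<close>; hence the sign s.\<close>

lemma Runit_one_minus_zeta_m:
  assumes s: "s = 1 \<or> s = - 1" shows "Runit (1 - s * zeta m)"
proof -
  have sR: "s \<in> R" using s R_closed(2) R_closed(5) by auto
  from m show ?thesis
  proof
    assume m: "m = 4"
    show ?thesis
    proof (rule RunitI[of _ "(1 + s * \<i>) * (1 / 2)"])
      show "1 - s * zeta m \<in> R" "(1 + s * \<i>) * (1 / 2) \<in> R"
        by (intro R_closed sR zeta_m_in_R i_in_R half_in_R)+
      show "(1 - s * zeta m) * ((1 + s * \<i>) * (1 / 2)) = 1"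
        using s by (auto simp: m zeta_4 complex_eq_iff)
    qed
  next
    assume m: "m = 12"
    define r where "r = complex_of_real (sqrt 3)"
    have r: "r \<in> R" using sqrt3_Oz[OF m] Oz_subset_R by (auto simp: r_def)
    \<comment> \<open>The absolute square of 1 - s \<open>zeta 12\<close> is 2 - s sqrt 3, and (2 -
      s sqrt 3)(2 + s sqrt 3) = 1.\<close>
    show ?thesis
    proof (rule RunitI[of _ "(1 - s * cnj (zeta m)) * (2 + s * r)"])
      show "1 - s * zeta m \<in> R" "(1 - s * cnj (zeta m)) * (2 + s * r) \<in> R"
        by (intro R_closed sR r zeta_m_in_R R_cnj)+
      show "(1 - s * zeta m) * ((1 - s * cnj (zeta m)) * (2 + s * r)) = 1"
        using s by (auto simp: m zeta_12 r_def complex_eq_iff algebra_simps)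
    qed
  qed
qed

lemma zeta_pow_half: "e > 0 \<Longrightarrow> \<zeta> ^ (m * 2 ^ (e - 1)) = - 1"
proof -
  assume "e > 0"
  then obtain e' where e': "e = Suc e'" by (cases e) auto
  have "zeta (2 * (m * 2 ^ e')) ^ (m * 2 ^ e') = zeta 2"
    using m by (intro zeta_mult_power) auto
  moreover have "zeta 2 = -1" by (simp add: zeta_def)
  ultimately show ?thesis by (simp add: e' n_eq mult_ac)
qed

lemma Nm_one_plus_zeta: "Nm (1 + \<zeta>) = 1 - (- 1) ^ (2 ^ e) * zeta m"
proof -
  have "Nm (1 + \<zeta>) = (\<Prod>i<2 ^ e. (- 1) * (- 1 - \<zeta> ^ (Suc m ^ i)))"
    unfolding Nm_def
    by (intro prod.cong refl)
       (simp add: is_aut_add[OF is_aut_sigma_pow] is_aut_1[OF is_aut_sigma_pow] K_closed sigma_pow_zeta)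
  also have "\<dots> = (- 1) ^ (2 ^ e) * (\<Prod>i<2 ^ e. (- 1 - \<zeta> ^ (Suc m ^ i)))"
    by (simp only: prod.distrib prod_constant card_lessThan)
  also have "(\<Prod>i<2 ^ e. (- 1 - \<zeta> ^ (Suc m ^ i))) = (- 1) ^ (2 ^ e) - \<zeta> ^ (2 ^ e)"
    using zeta_pow_half by (intro prod_orbit[OF four_dvd_m]) auto
  also have "(- 1) ^ (2 ^ e) * ((- 1) ^ (2 ^ e) - \<zeta> ^ (2 ^ e)) = 1 - (- 1) ^ (2 ^ e) * zeta m"
    by (simp add: zeta_pow_d right_diff_distrib flip: power_mult_distrib)
  finally show ?thesis .
qed

text \<open>The remaining conjugates form a cofactor in R, so 1 + \<zeta> divides its norm to K0,
  which is a unit.\<close>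

lemma Runit_one_plus_zeta: "Runit (1 + \<zeta>)"
proof -
  define Q where "Q = (\<Prod>i\<in>{..<2 ^ e} - {0}. (\<sigma> ^^ i) (1 + \<zeta>))"
  have z1: "1 + \<zeta> \<in> R" by (intro R_closed zeta_in_R)
  have Q: "Q \<in> R" unfolding Q_def
    by (intro R_closed is_aut_R[OF is_aut_sigma_pow] z1)
  have "Nm (1 + \<zeta>) = (1 + \<zeta>) * Q"
    unfolding Nm_def Q_def by (subst prod.remove[of _ "0::nat"]) auto
  moreover have "Runit (Nm (1 + \<zeta>))"
    unfolding Nm_one_plus_zeta by (rule Runit_one_minus_zeta_m) (metis minus_one_power_iff)
  ultimately have "inverse ((1 + \<zeta>) * Q) \<in> R" "(1 + \<zeta>) * Q \<noteq> 0" by (auto simp: Runit_def)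
  moreover from this have "(1 + \<zeta>) * (Q * inverse ((1 + \<zeta>) * Q)) = 1"
    by (metis mult.assoc right_inverse)
  ultimately show ?thesis
    using z1 Q by (intro RunitI[of _ "Q * inverse ((1 + \<zeta>) * Q)"] subring_C_mult[OF R_subring])
qed

text \<open>Even powers are handled by powers of \<zeta>. For odd ones \<zeta> = (1 + \<zeta>) / cnj
  (1 + \<zeta>) supplies the remaining factor; this is where 1 + \<zeta> has to be a unit.\<close>

lemma zeta_power_eq_cnj_divide: "\<exists>b. Runit b \<and> \<zeta> ^ j = cnj b / b"
proof -
  define l where "l = j div 2"
  have cn: "cnj \<zeta> = inverse \<zeta>" by (rule cnj_zeta)
  show ?thesis
  proof (cases "even j")
    case True
    then have j: "j = l + l" by (auto simp: l_def)
    show ?thesis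
      by (rule exI[of _ "inverse \<zeta> ^ l"])
         (simp add: Runit_power Runit_inverse Runit_zeta cn j power_add divide_inverse power_inverse)
  next
    case False
    then have j: "j = l + l + 1" by (auto simp: l_def elim!: oddE)
    have z: "\<zeta> \<noteq> 0" "1 + \<zeta> \<noteq> 0" using Runit_one_plus_zeta Runit_zeta by (auto simp: Runit_def)
    define w where "w = cnj (1 + \<zeta>)"
    have u: "Runit (inverse \<zeta> ^ l * w)" unfolding w_def
      by (intro Runit_mult Runit_power Runit_inverse Runit_zeta Runit_cnj Runit_one_plus_zeta)
    have w: "w = (1 + \<zeta>) / \<zeta>" using z by (simp add: w_def cn field_simps)
    have "cnj (inverse \<zeta> ^ l * w) = \<zeta> ^ l * (1 + \<zeta>)" by (simp add: w_def cn)
    also have "\<dots> / (inverse \<zeta> ^ l * w) = \<zeta> ^ j"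
      using z by (simp add: w j power_add field_simps)
    finally have "\<zeta> ^ j = cnj (inverse \<zeta> ^ l * w) / (inverse \<zeta> ^ l * w)" by simp
    then show ?thesis using u by blast
  qed
qed

end

section \<open>Binary quadratic forms and roots of unity\<close>

lemma int_square_le_1: "(a::int) ^ 2 \<le> 1 \<Longrightarrow> a = -1 \<or> a = 0 \<or> a = 1"
  by (auto simp: abs_square_le_1)

lemma eisenstein_form:
  fixes a b :: int
  shows "a ^ 2 + a * b + b ^ 2 \<ge> 0" "a ^ 2 + a * b + b ^ 2 = 0 \<Longrightarrow> a = 0 \<and> b = 0"
    "a ^ 2 + a * b + b ^ 2 = 1 \<Longrightarrow> (a, b) \<in> {(1, 0), (-1, 0), (0, 1), (0, -1), (1, -1), (-1, 1)}"
proof -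
  have *: "4 * (a ^ 2 + a * b + b ^ 2) = (2 * a + b) ^ 2 + 3 * b ^ 2"
    by (simp add: algebra_simps power2_eq_square)
  have "4 * (a ^ 2 + a * b + b ^ 2) \<ge> 0" unfolding * by simp
  then show "a ^ 2 + a * b + b ^ 2 \<ge> 0" by simp
  have b: "3 * b ^ 2 \<le> 4 * (a ^ 2 + a * b + b ^ 2)" unfolding * by simp
  {
    assume "a ^ 2 + a * b + b ^ 2 = 0"
    then have "b = 0" using b by simp
    then show "a = 0 \<and> b = 0" using \<open>a ^ 2 + a * b + b ^ 2 = 0\<close> by simp
  next
    assume 1: "a ^ 2 + a * b + b ^ 2 = 1"
    then have "b ^ 2 \<le> 1" using b by simp
    then have "b = -1 \<or> b = 0 \<or> b = 1" by (rule int_square_le_1)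
    then consider "b = -1" "a * (a - 1) = 0" | "b = 0" "a ^ 2 = 1" | "b = 1" "a * (a + 1) = 0"
      using 1 by (auto simp: algebra_simps power2_eq_square)
    then show "(a, b) \<in> {(1, 0), (-1, 0), (0, 1), (0, -1), (1, -1), (-1, 1)}"
      by cases (auto simp: power2_eq_1_iff eq_neg_iff_add_eq_0)
  }
qed

lemma zeta_12_powers:
  "zeta 12 ^ 2 = Complex (1/2) (sqrt 3 / 2)" "zeta 12 ^ 3 = \<i>"
  "zeta 12 ^ 6 = -1" "zeta 12 ^ 8 = - (zeta 12 ^ 2)" "zeta 12 ^ 10 = 1 - zeta 12 ^ 2"
  "zeta 12 ^ 4 = zeta 12 ^ 2 - 1"
proof -
  show 2: "zeta 12 ^ 2 = Complex (1/2) (sqrt 3 / 2)"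
    by (simp add: zeta_12 complex_eq_iff power2_eq_square)
  show 3: "zeta 12 ^ 3 = \<i>"
    by (simp add: zeta_12 complex_eq_iff power3_eq_cube algebra_simps)
  have "zeta 12 ^ 6 = (zeta 12 ^ 3) ^ 2" by (simp flip: power_mult)
  then show 6: "zeta 12 ^ 6 = -1" by (simp add: 3)
  have "zeta 12 ^ 8 = zeta 12 ^ 6 * zeta 12 ^ 2" by (simp flip: power_add)
  then show "zeta 12 ^ 8 = - (zeta 12 ^ 2)" by (simp add: 6)
  have "zeta 12 ^ 4 = (Complex (1/2) (sqrt 3 / 2)) ^ 2"
    unfolding 2[symmetric] by (simp flip: power_mult)
  then show 4: "zeta 12 ^ 4 = zeta 12 ^ 2 - 1"
    unfolding 2 by (simp add: power2_eq_square complex_eq_iff del: power_mult_numeral)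
  have "zeta 12 ^ 10 = zeta 12 ^ 6 * zeta 12 ^ 4" by (simp flip: power_add)
  then show "zeta 12 ^ 10 = 1 - zeta 12 ^ 2" by (simp add: 6 4)
qed

lemma eisenstein_unit:
  fixes a b :: int
  assumes "a ^ 2 + a * b + b ^ 2 = 1"
  shows "\<exists>j. of_int a + of_int b * zeta 12 ^ 2 = zeta 12 ^ j"
proof -
  have "(a, b) \<in> {(1, 0), (-1, 0), (0, 1), (0, -1), (1, -1), (-1, 1)}"
    by (rule eisenstein_form(3)[OF assms])
  then consider "a = 1" "b = 0" | "a = -1" "b = 0" | "a = 0" "b = 1" | "a = 0" "b = -1"
    | "a = 1" "b = -1" | "a = -1" "b = 1" by auto
  then show ?thesis
  proof cases
    case 1 then show ?thesis by (intro exI[of _ 0]) simp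
  next
    case 2 then show ?thesis by (intro exI[of _ 6]) (simp add: zeta_12_powers(3))
  next
    case 3 then show ?thesis by (intro exI[of _ 2]) simp
  next
    case 4 then show ?thesis by (intro exI[of _ 8]) (simp add: zeta_12_powers(4))
  next
    case 5 then show ?thesis by (intro exI[of _ 10]) (simp add: zeta_12_powers(5))
  next
    case 6 then show ?thesis by (intro exI[of _ 4]) (simp add: zeta_12_powers(6))
  qed
qed

text \<open>The number \<open>q\<close> is the rational part of the absolute square of \<open>c\<close>, which is a positive definite
  integral quadratic form in the coordinates of \<open>c\<close>.\<close>

lemma adj_Ints_zeta_norm:
  assumes m: "m = 4 \<or> m = 12" and c: "c \<in> adj \<int> (zeta m)"
  shows "\<exists>q s :: int. c * cnj c = complex_of_real (of_int q + of_int s * sqrt 3) \<and> q \<ge> 0 \<and>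
    (q = 0 \<longrightarrow> c = 0) \<and> (q = 1 \<longrightarrow> (\<exists>j. c = zeta m ^ j))"
proof -
  have pz: "poly (cyc_poly m) (zeta m) = 0" using cyc_poly_zeta_power[OF m, of 1] by simp
  have "coeffs_in \<int> (cyc_poly m)"
    by (auto simp: cyc_poly_def coeffs_in_pCons subring_C_Ints coeffs_in_0)
  moreover have "lead_coeff (cyc_poly m) = 1" "degree (cyc_poly m) > 0" by (simp_all add: cyc_poly_def)
  ultimately obtain c' where c': "\<And>i. c' i \<in> \<int>" "c = (\<Sum>i<degree (cyc_poly m). c' i * zeta m ^ i)"
    using adj_coordinates[OF subring_C_Ints _ _ refl _ pz c] by blast
  have "\<forall>i. \<exists>k :: int. c' i = of_int k" using c'(1) by (auto elim: Ints_cases)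
  then obtain a :: "nat \<Rightarrow> int" where "\<And>i. c' i = of_int (a i)" by metis
  then have ca: "c = (\<Sum>i<degree (cyc_poly m). of_int (a i) * zeta m ^ i)" using c' by simp
  from m show ?thesis
  proof
    assume m: "m = 4"
    have "{..<degree (cyc_poly m)} = {0, 1}" by (auto simp: m cyc_poly_def)
    then have c: "c = of_int (a 0) + of_int (a 1) * \<i>" unfolding ca by (simp add: m zeta_4)
    define q where "q = a 0 ^ 2 + a 1 ^ 2"
    have "c * cnj c = complex_of_real (of_int q + of_int 0 * sqrt 3)"
      by (simp add: c q_def complex_eq_iff power2_eq_square)
    moreover have "q \<ge> 0" "q = 0 \<longrightarrow> c = 0"
      by (auto simp: q_def c sum_power2_eq_zero_iff)
    moreover have "\<exists>j. c = zeta m ^ j" if q1: "q = 1"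
    proof -
      have "a 0 ^ 2 \<le> 1" "a 1 ^ 2 \<le> 1"
        using that zero_le_power2[of "a 0"] zero_le_power2[of "a 1"] unfolding q_def by linarith+
      then have "a 0 = -1 \<or> a 0 = 0 \<or> a 0 = 1" "a 1 = -1 \<or> a 1 = 0 \<or> a 1 = 1"
        by (auto dest: int_square_le_1)
      then consider "a 0 = 1" "a 1 = 0" | "a 0 = -1" "a 1 = 0" | "a 0 = 0" "a 1 = 1" | "a 0 = 0" "a 1 = -1"
        using q1 by (auto simp: q_def)
      then show ?thesis
      proof cases
        case 1 then show ?thesis by (intro exI[of _ 0]) (simp add: c)
      next
        case 2 then show ?thesis by (intro exI[of _ 2]) (simp add: c m zeta_4)
      next
        case 3 then show ?thesis by (intro exI[of _ 1]) (simp add: c m zeta_4)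
      next
        case 4 then show ?thesis by (intro exI[of _ 3]) (simp add: c m zeta_4 power3_eq_cube)
      qed
    qed
    ultimately show ?thesis by blast
  next
    assume m: "m = 12"
    have "{..<degree (cyc_poly m)} = {0, 1, 2, 3}" by (auto simp: m cyc_poly_def)
    then have c: "c = of_int (a 0) + of_int (a 1) * zeta 12 + of_int (a 2) * zeta 12 ^ 2 + of_int (a 3) * zeta 12 ^ 3"
      unfolding ca by (simp add: m)
    then have c': "c = (of_int (a 0) + of_int (a 2) * zeta 12 ^ 2) + zeta 12 * (of_int (a 1) + of_int (a 3) * zeta 12 ^ 2)"
      by (simp add: algebra_simps power2_eq_square power3_eq_cube)
    \<comment> \<open>c = u + \<open>zeta 12\<close> v with Eisenstein integers u and v. The cross
      terms of the absolute square are integral multiples of sqrt 3, so its rational part is A + B,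
      the sum of the norms of u and v.\<close>
    define A where "A = a 0 ^ 2 + a 0 * a 2 + a 2 ^ 2"
    define B where "B = a 1 ^ 2 + a 1 * a 3 + a 3 ^ 2"
    have AB: "A \<ge> 0" "B \<ge> 0" unfolding A_def B_def by (rule eisenstein_form(1))+
    have A0: "of_int (a 0) + of_int (a 2) * zeta 12 ^ 2 = 0" if "A = 0"
      using eisenstein_form(2)[of "a 0" "a 2"] that by (simp add: A_def)
    have B0: "of_int (a 1) + of_int (a 3) * zeta 12 ^ 2 = 0" if "B = 0"
      using eisenstein_form(2)[of "a 1" "a 3"] that by (simp add: B_def)
    have "c * cnj c = complex_of_real (of_int (A + B) + of_int (a 0 * a 1 + a 1 * a 2 + a 2 * a 3) * sqrt 3)"
    proof -
      define r where "r = sqrt 3"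
      define x0 x1 x2 x3 where x: "x0 = real_of_int (a 0)" "x1 = real_of_int (a 1)"
        "x2 = real_of_int (a 2)" "x3 = real_of_int (a 3)"
      have rr: "r * r = 3" by (simp add: r_def)
      have cC: "c = Complex (x0 + x2 / 2 + x1 * r / 2) (x1 / 2 + x3 + x2 * r / 2)"
        unfolding c zeta_12_powers(1,2) unfolding zeta_12 by (simp add: complex_eq_iff x r_def)
      have "(x0 + x2 / 2 + x1 * r / 2) ^ 2 + (x1 / 2 + x3 + x2 * r / 2) ^ 2 =
        (x0 * x0 + x0 * x2 + x2 * x2 / 4 + x1 * x1 / 4 + x1 * x3 + x3 * x3) +
        (x1 * x1 / 4 + x2 * x2 / 4) * (r * r) + (x0 * x1 + x1 * x2 + x2 * x3) * r"
        by (simp add: power2_eq_square field_simps)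
      also have "\<dots> = of_int (A + B) + of_int (a 0 * a 1 + a 1 * a 2 + a 2 * a 3) * r"
        unfolding rr by (simp add: A_def B_def x power2_eq_square field_simps)
      finally show ?thesis unfolding complex_mult_cnj cC complex.sel r_def by simp
    qed
    moreover have "A + B \<ge> 0" using AB by simp
    moreover have "c = 0" if "A + B = 0"
    proof -
      have "A = 0" "B = 0" using AB that by auto
      then show ?thesis unfolding c' using A0 B0 by simp
    qed
    moreover have "\<exists>j. c = zeta m ^ j" if AB1: "A + B = 1"
    proof -
      consider "A = 1" "B = 0" | "A = 0" "B = 1" using AB1 AB by force
      then show ?thesis
      proof cases
        case 1
        then show ?thesis
          using eisenstein_unit[of "a 0" "a 2"] B0 unfolding c' m by (simp add: A_def)
      next
        case 2
        then obtain j where "of_int (a 1) + of_int (a 3) * zeta 12 ^ 2 = zeta 12 ^ j"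
          using eisenstein_unit[of "a 1" "a 3"] by (auto simp: B_def)
        then have "c = zeta 12 ^ Suc j" using A0[OF 2(1)] unfolding c' by simp
        then show ?thesis unfolding m by blast
      qed
    qed
    ultimately show ?thesis by blast
  qed
qed

context cyclo
begin

lemma Oz_coordinates:
  assumes "x \<in> Oz"
  obtains c where "\<And>j. c j \<in> adj \<int> (zeta m)" "x = (\<Sum>j<2 ^ e. c j * \<zeta> ^ j)"
proof -
  let ?Z = "adj \<int> (zeta m)"
  let ?Q = "monom 1 (2 ^ e) + [:- zeta m:]"
  have Z: "subring_C ?Z" by (rule subring_C_adj[OF subring_C_Ints])
  have zm: "zeta m \<in> ?Z" by (rule adj_gen[OF subring_C_Ints])
  have deg: "degree ?Q = 2 ^ e"
    by (subst degree_add_eq_left) (auto simp: degree_monom_eq)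
  have "lead_coeff ?Q = 1" unfolding deg by (simp add: coeff_pCons split: nat.splits)
  moreover have "coeffs_in ?Z ?Q"
    by (intro coeffs_in_add coeffs_in_monom coeffs_in_const Z subring_C_closed[OF Z] zm)
  moreover have "poly ?Q \<zeta> = 0" by (simp add: poly_monom zeta_pow_d)
  moreover have "x \<in> adj ?Z \<zeta>"
    using assms adj_least[OF subring_C_adj[OF Z, of \<zeta>] Ints_subset_subring_C[OF subring_C_adj[OF Z]] adj_gen[OF Z]]
    by blast
  ultimately obtain c where "\<And>i. c i \<in> ?Z" "x = (\<Sum>i<2 ^ e. c i * \<zeta> ^ i)"
    using adj_coordinates[OF Z _ _ deg] by auto
  then show ?thesis using that by blast
qed

text \<open>Since \<open>inverse \<zeta>\<close> is the conjugate of \<zeta>, this is orthogonality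
  of the coordinate basis for the Hermitian form Tr (x * cnj y).\<close>

lemma Tr_zeta_diff:
  assumes "i < 2 ^ e" "j < 2 ^ e"
  shows "Tr (\<zeta> ^ i * inverse \<zeta> ^ j) = (if i = j then 2 ^ e else 0)"
proof -
  let ?w = "\<zeta> ^ i * inverse \<zeta> ^ j"
  have "?w ^ n = (\<zeta> ^ n) ^ i * inverse ((\<zeta> ^ n) ^ j)"
    by (simp add: power_mult_distrib power_inverse mult.commute flip: power_mult)
  then have "?w ^ n = 1" by (simp add: zeta_pow_n)
  moreover have "?w ^ m = 1 \<longleftrightarrow> i = j"
  proof
    assume "?w ^ m = 1"
    then have eq: "\<zeta> ^ (m * i) = \<zeta> ^ (m * j)"
      using zeta_nonzero[of n]
      by (simp add: power_mult_distrib power_inverse mult.commute field_simps flip: power_mult)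
    have aux: "i' = j'" if "j' \<le> i'" "i' < 2 ^ e" "\<zeta> ^ (m * i') = \<zeta> ^ (m * j')" for i' j'
    proof -
      have "\<zeta> ^ (m * i') = \<zeta> ^ (m * j') * \<zeta> ^ (m * (i' - j'))"
        using that(1) by (simp flip: power_add distrib_left)
      then have "\<zeta> ^ (m * (i' - j')) = 1" using that(3) zeta_nonzero[of n] by simp
      then have "m * 2 ^ e dvd m * (i' - j')" using zeta_power_eq_1_iff[OF n_pos] n_eq by simp
      then have "2 ^ e dvd i' - j'" using m_pos by simp
      then have "i' - j' = 0" using that(2) by (metis dvd_imp_le less_imp_diff_less not_gr_zero not_less)
      then show ?thesis using that(1) by simp
    qed
    show "i = j"
    proof (cases "j \<le> i")
      case True
      then show ?thesis using aux eq assms(1) by blast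
    next
      case False
      then have "j = i" by (intro aux eq[symmetric] assms(2)) simp
      then show ?thesis by simp
    qed
  next
    assume "i = j"
    then have "?w = 1" using zeta_nonzero[of n] by (simp add: power_inverse)
    then show "?w ^ m = 1" by simp
  qed
  moreover have "?w = 1" if "i = j" using that zeta_nonzero[of n] by (simp add: power_inverse)
  ultimately show ?thesis by (simp add: Tr_root_of_unity)
qed

lemma adj_Ints_zeta_m_subset_K0: "adj \<int> (zeta m) \<subseteq> K0"
  by (intro adj_least K0_subring Ints_subset_subring_C zeta_m_in_K0)

lemma K0_cnj: "x \<in> K0 \<Longrightarrow> cnj x \<in> K0"
proof -
  interpret c0: cyclo m 0 m using m by unfold_locales auto
  show "x \<in> K0 \<Longrightarrow> cnj x \<in> K0" by (rule c0.K_cnj)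
qed

text \<open>Applying the trace over \<^term>\<open>K0\<close> to \<open>x * cnj x = 1\<close> turns it into \<open>\<Sum> \<bar>c\<^sub>j\<bar>\<^sup>2 = 1\<close>.\<close>

lemma Oz_norm_one:
  assumes x: "x \<in> Oz" "x * cnj x = 1" shows "\<exists>j. x = \<zeta> ^ j"
proof -
  obtain c where c: "\<And>j. c j \<in> adj \<int> (zeta m)" "x = (\<Sum>j<2 ^ e. c j * \<zeta> ^ j)"
    using Oz_coordinates[OF x(1)] by blast
  have cK0: "c j \<in> K0" for j using c(1) adj_Ints_zeta_m_subset_K0 by blast
  have cc: "c i * cnj (c j) \<in> K0" for i j
    by (intro subring_C_mult[OF K0_subring] cK0 K0_cnj)
  have ww: "\<zeta> ^ i * inverse \<zeta> ^ j \<in> K" for i j by (intro K_closed)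
  have inK: "c i * cnj (c j) * (\<zeta> ^ i * inverse \<zeta> ^ j) \<in> K" for i j
    by (rule subring_C_mult[OF K_subring subsetD[OF K0_subset_K cc] ww])
  have "2 ^ e = Tr 1" using Tr_root_of_unity[of 1] by simp
  also have "1 = (\<Sum>i<2 ^ e. \<Sum>j<2 ^ e. (c i * cnj (c j)) * (\<zeta> ^ i * inverse \<zeta> ^ j))"
    unfolding x(2)[symmetric] c(2) by (simp add: sum_product cnj_zeta mult_ac)
  also have "Tr \<dots> = (\<Sum>i<2 ^ e. \<Sum>j<2 ^ e. Tr ((c i * cnj (c j)) * (\<zeta> ^ i * inverse \<zeta> ^ j)))"
    by (subst Tr_sum, intro K_closed(8) inK, intro sum.cong refl Tr_sum inK)
  also have "\<dots> = (\<Sum>i<2 ^ e. \<Sum>j<2 ^ e. if i = j then 2 ^ e * (c i * cnj (c j)) else 0)"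
    by (intro sum.cong refl, subst Tr_K0_mult[OF cc ww]) (simp add: Tr_zeta_diff)
  also have "\<dots> = 2 ^ e * (\<Sum>i<2 ^ e. c i * cnj (c i))"
    by (simp add: sum_distrib_left)
  finally have s1: "(\<Sum>i<2 ^ e. c i * cnj (c i)) = 1" by simp
  obtain q s :: "nat \<Rightarrow> int" where qs: "\<And>i. c i * cnj (c i) = complex_of_real (of_int (q i) + of_int (s i) * sqrt 3)"
    "\<And>i. q i \<ge> 0" "\<And>i. q i = 0 \<Longrightarrow> c i = 0" "\<And>i. q i = 1 \<Longrightarrow> \<exists>j. c i = zeta m ^ j"
    using adj_Ints_zeta_norm[OF m c(1)] by metis
  have "complex_of_real (of_int (\<Sum>i<2 ^ e. q i) + of_int (\<Sum>i<2 ^ e. s i) * sqrt 3) = complex_of_real 1"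
    using s1 by (simp add: qs sum.distrib sum_distrib_right)
  then have "of_int (\<Sum>i<2 ^ e. q i) + of_int (\<Sum>i<2 ^ e. s i) * sqrt 3 = 1"
    unfolding of_real_eq_iff .
  then have "of_int ((\<Sum>i<2 ^ e. q i) - 1) + of_int (\<Sum>i<2 ^ e. s i) * sqrt 3 = 0"
    by simp
  then have q1: "(\<Sum>i<2 ^ e. q i) = 1"
    using Rats_sqrt3_indep[of "of_int ((\<Sum>i<2 ^ e. q i) - 1)" "of_int (\<Sum>i<2 ^ e. s i)"]
    by (metis Rats_of_int eq_iff_diff_eq_0 of_int_eq_0_iff)
  then obtain i where i: "i < 2 ^ e" "q i \<noteq> 0"
    by (metis (no_types, lifting) lessThan_iff sum.neutral zero_neq_one)
  have "(\<Sum>i<2 ^ e. q i) = q i + (\<Sum>l\<in>{..<2 ^ e} - {i}. q l)"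
    using i by (subst sum.remove[of _ i]) auto
  moreover have "(\<Sum>l\<in>{..<2 ^ e} - {i}. q l) \<ge> 0" by (intro sum_nonneg qs)
  ultimately have qi: "q i = 1" and "(\<Sum>l\<in>{..<2 ^ e} - {i}. q l) = 0"
    using q1 i(2) qs(2)[of i] by linarith+
  then have "\<forall>l\<in>{..<2 ^ e} - {i}. q l = 0" using qs(2) by (subst (asm) sum_nonneg_eq_0_iff) auto
  then have "x = c i * \<zeta> ^ i"
    unfolding c(2) using i qs(3) by (subst sum.remove[of _ i]) (auto intro!: sum.neutral)
  moreover obtain j where "c i = (\<zeta> ^ (2 ^ e)) ^ j" using qs(4)[OF qi] zeta_pow_d by auto
  ultimately show ?thesis by (metis power_add power_mult)
qed

end

section \<open>Divisibility in subrings\<close>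

text \<open>The relation \<open>dvd\<close> of the field of complex numbers is trivial, so
  divisibility is taken relative to a subring.\<close>

definition dvd_in :: "complex set \<Rightarrow> complex \<Rightarrow> complex \<Rightarrow> bool" where
  "dvd_in S a b \<longleftrightarrow> (\<exists>y\<in>S. b = a * y)"

context
  fixes S assumes S: "subring_C S"
begin

lemma dvd_in_diff: "dvd_in S a b \<Longrightarrow> dvd_in S a c \<Longrightarrow> dvd_in S a (b - c)"
  unfolding dvd_in_def by (metis right_diff_distrib subring_C_diff[OF S])

lemma dvd_in_add: "dvd_in S a b \<Longrightarrow> dvd_in S a c \<Longrightarrow> dvd_in S a (b + c)"
  unfolding dvd_in_def by (metis distrib_left subring_C_add[OF S])

lemma dvd_in_mult: "dvd_in S a b \<Longrightarrow> c \<in> S \<Longrightarrow> dvd_in S a (b * c)"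
  unfolding dvd_in_def by (metis mult.assoc subring_C_mult[OF S])

lemma dvd_in_mult_left: "dvd_in S a b \<Longrightarrow> c \<in> S \<Longrightarrow> dvd_in S a (c * b)"
  using dvd_in_mult[of a b c] by (simp add: mult.commute)

lemma dvd_in_trans: "dvd_in S a b \<Longrightarrow> dvd_in S b c \<Longrightarrow> dvd_in S a c"
  unfolding dvd_in_def by (metis mult.assoc subring_C_mult[OF S])

lemma dvd_in_triv: "y \<in> S \<Longrightarrow> dvd_in S a (a * y)"
  unfolding dvd_in_def by blast

lemma dvd_in_0: "dvd_in S a 0"
  unfolding dvd_in_def by (rule bexI[OF _ subring_C_0[OF S]]) simp

lemma dvd_in_poly_diff:
  assumes p: "coeffs_in \<int> p" and xy: "x \<in> S" "y \<in> S"
  shows "dvd_in S (x - y) (poly p x - poly p y)"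
  using subring_C_Ints p
proof (induction p rule: coeffs_in_induct)
  case 0
  show ?case by (simp add: dvd_in_0)
next
  case (pCons a p)
  have "poly p y \<in> S"
    by (rule poly_in_subring_C[OF S coeffs_in_mono[OF Ints_subset_subring_C[OF S] pCons(2)] xy(2)])
  then have "dvd_in S (x - y) (x * (poly p x - poly p y) + (x - y) * poly p y)"
    by (intro dvd_in_add dvd_in_mult_left pCons xy dvd_in_triv)
  then show ?case by (simp add: algebra_simps)
qed

lemma dvd_in_one_minus_power: "x \<in> S \<Longrightarrow> dvd_in S (1 - x) (1 - x ^ k)"
  unfolding one_diff_power_eq by (intro dvd_in_triv subring_C_sum[OF S] subring_C_power[OF S])

lemma dvd_in_power: "dvd_in S a (x ^ 2) \<Longrightarrow> x \<in> S \<Longrightarrow> k \<ge> 2 \<Longrightarrow> dvd_in S a (x ^ k)"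
proof -
  assume *: "dvd_in S a (x ^ 2)" "x \<in> S" "k \<ge> 2"
  then obtain j where "k = 2 + j" using le_Suc_ex by blast
  then have "x ^ k = x ^ 2 * x ^ j" by (simp only: power_add)
  then show ?thesis using dvd_in_mult[OF *(1) subring_C_power[OF S *(2)], of j] by simp
qed

end

section \<open>The prime above 2\<close>

context cyclo
begin

text \<open>\<zeta>^(m div 4) is a root of unity of order 2^(e+2), and one minus it generates the
  prime above 2.\<close>

definition lam :: complex where "lam = 1 - \<zeta> ^ (m div 4)"

lemma theta_pow: "(\<zeta> ^ (m div 4)) ^ (2 ^ e) = \<i>"
  by (metis mult.commute power_mult zeta_pow_d zeta_m_pow_m4)

lemma theta_pow_Suc: "(\<zeta> ^ (m div 4)) ^ (2 ^ Suc e) = - 1"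
  unfolding power_Suc2 power_mult theta_pow by simp

lemma theta_in_Oz: "\<zeta> ^ (m div 4) \<in> Oz"
  by (intro Oz_closed)

lemma lam_in_Oz: "lam \<in> Oz"
  unfolding lam_def by (intro Oz_closed)

lemma lam_dvd_2: "dvd_in Oz lam 2"
  using dvd_in_one_minus_power[OF Oz_subring theta_in_Oz, of "2 ^ Suc e"]
  unfolding theta_pow_Suc lam_def by simp

lemma lam_nonzero: "lam \<noteq> 0"
  using lam_dvd_2 by (auto simp: dvd_in_def)

text \<open>Modulo 2 squaring is additive and signs do not matter, so lam^(2^i) is congruent to 1 -
  theta^(2^i) with theta = \<zeta>^(m div 4); for i = e + 1 this is 1 + 1.\<close>

lemma lam_pow_dvd: "dvd_in Oz 2 (lam ^ (2 ^ Suc e))"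
proof -
  have "dvd_in Oz 2 (lam ^ (2 ^ i) - (1 - (\<zeta> ^ (m div 4)) ^ (2 ^ i)))" for i
  proof (induction i)
    case 0
    show ?case by (simp add: lam_def dvd_in_0[OF Oz_subring])
  next
    case (Suc i)
    define t where "t = (\<zeta> ^ (m div 4)) ^ (2 ^ i)"
    have t: "t \<in> Oz" unfolding t_def by (intro Oz_closed)
    obtain y where y: "y \<in> Oz" "lam ^ (2 ^ i) - (1 - t) = 2 * y"
      using Suc by (auto simp: dvd_in_def t_def)
    have "lam ^ (2 ^ Suc i) = (1 - t + 2 * y) ^ 2"
      unfolding power_Suc2[of 2 i] power_mult y(2)[symmetric] by simp
    moreover have "(\<zeta> ^ (m div 4)) ^ (2 ^ Suc i) = t ^ 2"
      unfolding power_Suc2[of 2 i] power_mult t_def ..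
    ultimately have "lam ^ (2 ^ Suc i) - (1 - (\<zeta> ^ (m div 4)) ^ (2 ^ Suc i)) =
        2 * (t ^ 2 - t + 2 * y * (1 - t) + 2 * y ^ 2)"
      by (simp add: power2_eq_square algebra_simps)
    moreover have "t ^ 2 - t + 2 * y * (1 - t) + 2 * y ^ 2 \<in> Oz"
      by (intro Oz_closed t y)
    ultimately show ?case using dvd_in_triv[OF Oz_subring] by metis
  qed
  from dvd_in_add[OF Oz_subring this[of "Suc e"], of 2] show ?thesis
    unfolding theta_pow_Suc using dvd_in_triv[OF Oz_subring subring_C_1[OF Oz_subring], of 2] by simp
qed

lemma half_int_notin_Oz:
  fixes N :: int
  assumes "dvd_in Oz 2 (of_int N)" shows "even N"
proof -
  obtain y where y: "y \<in> Oz" "of_int N = 2 * y" using assms by (auto simp: dvd_in_def)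
  then have "y = of_int N / of_int 2" by simp
  then have "y \<in> \<rat>" by (metis Rats_divide Rats_of_int)
  then obtain k where "y = of_int k" using Oz_Rats y(1) by (auto elim: Ints_cases)
  then have "of_int N = (of_int (2 * k) :: complex)" using y by simp
  then have "N = 2 * k" unfolding of_int_eq_iff .
  then show ?thesis by simp
qed

text \<open>Raising N = lam y to the power 2^(e+1) turns divisibility by \<open>lam\<close> into
  divisibility by 2, which for integers has its usual meaning.\<close>

lemma lam_dvd_int:
  fixes N :: int
  assumes "dvd_in Oz lam (of_int N)" shows "even N"
proof -
  obtain y where y: "y \<in> Oz" "of_int N = lam * y" using assms by (auto simp: dvd_in_def)
  have "of_int (N ^ (2 ^ Suc e)) = lam ^ (2 ^ Suc e) * y ^ (2 ^ Suc e)"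
    unfolding of_int_power y(2) power_mult_distrib ..
  then have "dvd_in Oz 2 (of_int (N ^ (2 ^ Suc e)))"
    using dvd_in_mult[OF Oz_subring lam_pow_dvd subring_C_power[OF Oz_subring y(1)]] by metis
  then have "even (N ^ (2 ^ Suc e))" by (rule half_int_notin_Oz)
  then show ?thesis by simp
qed

lemma inverse_zeta_power_in_Oz: "inverse \<zeta> ^ k \<in> Oz"
  using Oz_cnj[OF zeta_in_Oz] by (simp add: cnj_zeta subring_C_power[OF Oz_subring])

lemma lam_dvd_cnj:
  assumes "dvd_in Oz lam x" shows "dvd_in Oz lam (cnj x)"
proof -
  obtain y where y: "y \<in> Oz" "x = lam * y" using assms by (auto simp: dvd_in_def)
  have "cnj lam = lam * (- (inverse \<zeta> ^ (m div 4)))"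
    using zeta_nonzero[of n] by (simp add: lam_def cnj_zeta field_simps)
  then have "cnj x = lam * (- (inverse \<zeta> ^ (m div 4)) * cnj y)" by (simp add: y)
  moreover have "- (inverse \<zeta> ^ (m div 4)) * cnj y \<in> Oz"
    by (intro Oz_closed(4,5) inverse_zeta_power_in_Oz Oz_cnj y)
  ultimately show ?thesis using dvd_in_triv[OF Oz_subring] by metis
qed

text \<open>These are representatives of the residue field, which has two elements for m = 4 and
  four for m = 12, where w is a cube root of unity. The relations between w and \<open>cnj w\<close>
  turn norms into integral quadratic forms in a and b.\<close>

lemma residue_mod_lam:
  assumes z: "z \<in> Oz"
  obtains w and a b :: int where "w \<in> Oz" "w = 1 \<and> b = 0 \<or> w + cnj w = - 1 \<and> w * cnj w = 1"
    "dvd_in Oz lam (z - (of_int a + of_int b * w))"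
proof -
  obtain p where p: "z = poly p \<zeta>" "coeffs_in \<int> p" using z by (auto simp: adj_def)
  from m show ?thesis
  proof
    assume m: "m = 4"
    have "poly p 1 \<in> \<int>" by (rule poly_in_subring_C[OF subring_C_Ints p(2)]) simp
    then obtain a where a: "poly p 1 = of_int a" by (auto elim: Ints_cases)
    have "dvd_in Oz (1 - \<zeta>) (poly p 1 - poly p \<zeta>)"
      by (intro dvd_in_poly_diff Oz_subring p Oz_closed)
    moreover have "lam = 1 - \<zeta>" unfolding lam_def by (simp add: m)
    ultimately have "dvd_in Oz lam ((poly p 1 - poly p \<zeta>) * (- 1))"
      by (intro dvd_in_mult[OF Oz_subring] Oz_closed) simp_all
    then have "dvd_in Oz lam (z - (of_int a + of_int 0 * 1))" by (simp add: p a)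
    then show ?thesis using that[of 1 0 a] subring_C_1[OF Oz_subring] by simp
  next
    assume m: "m = 12"
    \<comment> \<open>The exponent 4^(e+1) is 1 modulo 3, and three times it is n 2^e: so w is a
      cube root of unity, and w / \<zeta> is a power of \<zeta>^3, which is 1 modulo
      \<open>lam\<close>.\<close>
    define w where "w = \<zeta> ^ (4 ^ Suc e)"
    have w: "w \<in> Oz" unfolding w_def by (intro Oz_closed)
    have "4 ^ Suc e * 3 = n * 2 ^ e" by (simp add: n_eq m flip: power_mult_distrib)
    then have w3: "w ^ 3 = 1"
      unfolding w_def power_mult[symmetric] by (simp add: power_mult zeta_pow_n)
    have "\<not> 3 dvd (4 ^ Suc e :: nat)"
      using prime_dvd_power_nat[of 3 4 "Suc e"] by auto
    moreover have "3 dvd n" by (simp add: n_eq m)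
    ultimately have "\<not> n dvd 4 ^ Suc e" using dvd_trans by blast
    then have w1: "w \<noteq> 1" unfolding w_def using zeta_power_eq_1_iff[OF n_pos] by blast
    have "(w - 1) * (w ^ 2 + w + 1) = 0"
      using w3 by (simp add: algebra_simps power2_eq_square power3_eq_cube)
    then have wq: "w ^ 2 + w + 1 = 0" using w1 by simp
    have "cnj w = inverse w" by (simp add: w_def cnj_zeta power_inverse)
    also have "\<dots> = w ^ 2" using w3 by (intro inverse_unique) (simp add: power3_eq_cube power2_eq_square mult.assoc)
    finally have cw: "cnj w = w ^ 2" .
    have "w + cnj w = (w ^ 2 + w + 1) - 1" unfolding cw by simp
    then have 1: "w + cnj w = - 1" unfolding wq by simp
    have 2: "w * cnj w = 1" unfolding cw using w3 by (simp add: power3_eq_cube power2_eq_square mult.assoc)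
    have "\<exists>t :: nat. 4 ^ k = 1 + 3 * t" for k
    proof (induction k)
      case (Suc k)
      then obtain t :: nat where "4 ^ k = 1 + 3 * t" by blast
      then show ?case by (intro exI[of _ "1 + 4 * t"]) simp
    qed simp
    then obtain t :: nat where "4 ^ Suc e = 1 + 3 * t" by blast
    then have "w = \<zeta> * (\<zeta> ^ (m div 4)) ^ t" unfolding w_def m by (simp add: power_add power_mult)
    then have "\<zeta> - w = \<zeta> * (1 - (\<zeta> ^ (m div 4)) ^ t)" by (simp add: algebra_simps)
    moreover have "dvd_in Oz lam (\<zeta> * (1 - (\<zeta> ^ (m div 4)) ^ t))"
      unfolding lam_def by (intro dvd_in_mult_left dvd_in_one_minus_power Oz_subring Oz_closed)
    ultimately have "dvd_in Oz lam (\<zeta> - w)" by simp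
    moreover have "dvd_in Oz (\<zeta> - w) (poly p \<zeta> - poly p w)"
      by (intro dvd_in_poly_diff Oz_subring p w zeta_in_Oz)
    ultimately have d: "dvd_in Oz lam (poly p \<zeta> - poly p w)" by (rule dvd_in_trans[OF Oz_subring])
    have "poly p w \<in> adj \<int> w" using p(2) by (auto simp: adj_def)
    moreover have "poly [:1, 1, 1:] w = 0" using wq by (simp add: algebra_simps power2_eq_square)
    ultimately obtain c where c: "\<And>i. c i \<in> \<int>" "poly p w = (\<Sum>i<2. c i * w ^ i)"
      using adj_coordinates[OF subring_C_Ints, of "[:1, 1, 1:]" 2]
      by (auto simp: coeffs_in_pCons subring_C_Ints coeffs_in_0)
    obtain a b where ab: "c 0 = of_int a" "c 1 = of_int b" using c(1)[of 0] c(1)[of 1] by (auto elim!: Ints_cases)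
    have "{..<2 :: nat} = {0, 1}" by auto
    then have "poly p w = of_int a + of_int b * w"
      unfolding c(2) using ab by simp
    then show ?thesis using that[OF w, of b a] 1 2 d p(1) by simp
  qed
qed

text \<open>Conjugation preserves divisibility by \<open>lam\<close>, so z may be replaced by its
  representative. The norm of that is a^2 or a^2 - a b + b^2, which is even only if a and b
  are.\<close>

lemma lam_dvd_norm:
  assumes z: "z \<in> Oz" "dvd_in Oz lam (z * cnj z)" shows "dvd_in Oz lam z"
proof -
  obtain w and a b :: int where w: "w \<in> Oz" "w = 1 \<and> b = 0 \<or> w + cnj w = - 1 \<and> w * cnj w = 1"
    "dvd_in Oz lam (z - (of_int a + of_int b * w))"
    using residue_mod_lam[OF z(1)] by metis
  define u where "u = of_int a + of_int b * w"
  have u: "u \<in> Oz" unfolding u_def by (intro Oz_closed w)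
  have 1: "dvd_in Oz lam (z - u)" using w(3) by (simp add: u_def)
  have 2: "dvd_in Oz lam (cnj (z - u))" by (rule lam_dvd_cnj[OF 1])
  have "dvd_in Oz lam (z * cnj z - (z - u) * cnj z - u * cnj (z - u))"
    by (intro dvd_in_diff[OF Oz_subring] z(2) dvd_in_mult[OF Oz_subring 1] dvd_in_mult_left[OF Oz_subring 2] Oz_cnj z(1) u)
  then have uu: "dvd_in Oz lam (u * cnj u)" by (simp add: algebra_simps)
  have "even a \<and> even b"
  proof (cases "w = 1 \<and> b = 0")
    case True
    then have "u * cnj u = of_int (a * a)" by (simp add: u_def)
    then have "even (a * a)" using lam_dvd_int uu by metis
    then show ?thesis using True by simp
  next
    case False
    then have w': "w + cnj w = - 1" "w * cnj w = 1" using w(2) by auto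
    have "u * cnj u = of_int a * of_int a + of_int a * of_int b * (w + cnj w) + of_int b * of_int b * (w * cnj w)"
      by (simp add: u_def algebra_simps)
    then have "u * cnj u = of_int (a * a - a * b + b * b)" unfolding w' by simp
    then have "even (a * a - a * b + b * b)" using lam_dvd_int uu by metis
    then show ?thesis by auto
  qed
  then obtain a' b' where "a = 2 * a'" "b = 2 * b'" by blast
  then have "u = 2 * (of_int a' + of_int b' * w)" by (simp add: u_def algebra_simps)
  moreover have "of_int a' + of_int b' * w \<in> Oz" by (intro Oz_closed w)
  ultimately have "dvd_in Oz lam u" using dvd_in_mult[OF Oz_subring lam_dvd_2] by metis
  then show ?thesis using dvd_in_add[OF Oz_subring 1, of u] by simp
qed

text \<open>If u = z / lam^k with k > 0, then u * cnj u = 1 makes z * cnj z divisible by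
  \<open>lam\<close>, so one factor of the denominator cancels. Denominators 2^k are of this kind,
  since 2 divides a power of \<open>lam\<close>.\<close>

lemma R_norm_one_in_Oz:
  assumes u: "u \<in> R" "u * cnj u = 1" shows "u \<in> Oz"
proof -
  have step: "u \<in> Oz" if "z \<in> Oz" "u = z / lam ^ k" for z k
    using that
  proof (induction k arbitrary: z)
    case (Suc k)
    have "z * cnj z = (lam * cnj lam) ^ Suc k * (u * cnj u)"
      unfolding Suc(3) using lam_nonzero by (simp add: power_mult_distrib)
    also have "\<dots> = lam * (cnj lam * (lam * cnj lam) ^ k)" by (simp add: u mult_ac)
    finally have "dvd_in Oz lam (z * cnj z)"
      using dvd_in_triv[OF Oz_subring, of "cnj lam * (lam * cnj lam) ^ k" lam]
      by (simp add: Oz_closed lam_in_Oz Oz_cnj)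
    then obtain y where "y \<in> Oz" "z = lam * y" using lam_dvd_norm[OF Suc(2)] by (auto simp: dvd_in_def)
    then show ?case using Suc lam_nonzero by (intro Suc.IH[of y]) simp_all
  qed simp
  obtain y k where y: "u = y / 2 ^ k" "y \<in> Oz" using u by (auto simp: Rring_eq_halves halves_def)
  obtain w where w: "w \<in> Oz" "lam ^ (2 ^ Suc e) = 2 * w" using lam_pow_dvd by (auto simp: dvd_in_def)
  have "w \<noteq> 0" using w(2) lam_nonzero by auto
  then have "u = (y * w ^ k) / lam ^ (2 ^ Suc e * k)"
    unfolding power_mult w(2) y(1) by (simp add: power_mult_distrib)
  then show ?thesis by (intro step[of "y * w ^ k"] Oz_closed(4,7) y w)
qed

theorem R_norm_one:
  assumes u: "u \<in> R" "u * cnj u = 1" shows "\<exists>b. Runit b \<and> u = cnj b / b"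
  using Oz_norm_one[OF R_norm_one_in_Oz[OF u] u(2)] zeta_power_eq_cnj_divide by blast

end

section \<open>Frobenius and square roots of elements of \<^term>\<open>Rring n\<close>\<close>

lemma frobenius_add:
  assumes S: "subring_C S" and p: "prime p" and ab: "a \<in> S" "b \<in> S"
  shows "dvd_in S (of_nat p) ((a + b) ^ p - (a ^ p + b ^ p))"
proof -
  have p0: "p > 0" using p prime_gt_0_nat by blast
  have "{..p} = insert 0 (insert p {1..<p})" using p0 by auto
  then have "(a + b) ^ p - (a ^ p + b ^ p) = (\<Sum>k\<in>{1..<p}. of_nat (p choose k) * a ^ k * b ^ (p - k))"
    using p0 by (simp add: binomial_ring)
  also have "\<dots> = of_nat p * (\<Sum>k\<in>{1..<p}. of_nat ((p choose k) div p) * a ^ k * b ^ (p - k))"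
    unfolding sum_distrib_left
  proof (intro sum.cong refl)
    fix k assume "k \<in> {1..<p}"
    then have "p dvd (p choose k)" using p p0 by (intro dvd_choose_prime) auto
    then have "p choose k = p * ((p choose k) div p)" by simp
    then have "of_nat (p choose k) = (of_nat p * of_nat ((p choose k) div p) :: complex)"
      by (metis of_nat_mult)
    then show "of_nat (p choose k) * a ^ k * b ^ (p - k) =
        of_nat p * (of_nat ((p choose k) div p) * a ^ k * b ^ (p - k))" by (simp add: mult.assoc)
  qed
  finally show ?thesis
    unfolding dvd_in_def using ab by (blast intro: subring_C_closed[OF S])
qed

lemma frobenius_int:
  assumes S: "subring_C S" and p: "prime p"
  shows "dvd_in S (of_nat p) (of_int a ^ p - of_int a)"
proof -
  have p0: "p > 0" using p prime_gt_0_nat by blast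
  note S1 = subring_C_1[OF S] and Sa = subring_C_of_int[OF S]
  have step: "dvd_in S (of_nat p) ((of_int a + 1) ^ p - (of_int a ^ p + 1))" for a
    using frobenius_add[OF S p Sa S1, of a] by simp
  show ?thesis
  proof (induction a rule: int_induct[of _ 0])
    case base
    show ?case using p0 dvd_in_0[OF S] by (simp add: zero_power)
  next
    case (step1 i)
    show ?case using dvd_in_add[OF S step[of i] step1(2)] by (simp add: algebra_simps)
  next
    case (step2 i)
    show ?case using dvd_in_diff[OF S step2(2) step[of "i - 1"]] by (simp add: algebra_simps)
  qed
qed

lemma frobenius_poly:
  assumes S: "subring_C S" and p: "prime p" and f: "coeffs_in \<int> f" and z: "z \<in> S"
  shows "dvd_in S (of_nat p) (poly f z ^ p - poly f (z ^ p))"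
  using subring_C_Ints f
proof (induction f rule: coeffs_in_induct)
  case 0
  show ?case using p prime_gt_0_nat[of p] dvd_in_0[OF S] by (simp add: zero_power)
next
  case (pCons a f)
  obtain i where a: "a = of_int i" using pCons(1) by (auto elim: Ints_cases)
  have fS: "poly f z \<in> S"
    by (rule poly_in_subring_C[OF S coeffs_in_mono[OF Ints_subset_subring_C[OF S] pCons(2)] z])
  have "dvd_in S (of_nat p) (((of_int i + z * poly f z) ^ p - (of_int i ^ p + (z * poly f z) ^ p)) +
      (of_int i ^ p - of_int i) + z ^ p * (poly f z ^ p - poly f (z ^ p)))"
    by (intro dvd_in_add[OF S] frobenius_add[OF S p] frobenius_int[OF S p] dvd_in_mult_left[OF S]
        pCons(3) subring_C_of_int[OF S] subring_C_mult[OF S] subring_C_power[OF S] fS z)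
  then show ?case by (simp add: a power_mult_distrib algebra_simps)
qed

lemma frobenius_poly_iterated:
  assumes S: "subring_C S" and p: "prime p" and f: "coeffs_in \<int> f" and z: "z \<in> S"
  shows "dvd_in S (of_nat p) (poly f z ^ (p ^ j) - poly f (z ^ (p ^ j)))"
proof (induction j)
  case (Suc j)
  define u v where "u = poly f z ^ (p ^ j)" and "v = poly f (z ^ (p ^ j))"
  have v: "v \<in> S" unfolding v_def
    by (rule poly_in_subring_C[OF S coeffs_in_mono[OF Ints_subset_subring_C[OF S] f] subring_C_power[OF S z]])
  obtain y where y: "y \<in> S" "u - v = of_nat p * y"
    using Suc by (auto simp: dvd_in_def u_def v_def)
  have uv: "v + of_nat p * y = u" using y(2) by (simp add: algebra_simps)
  have "dvd_in S (of_nat p) ((of_nat p * y) ^ p)"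
    using p prime_gt_0_nat[of p] dvd_in_triv[OF S, of "y * (of_nat p * y) ^ (p - 1)" "of_nat p"]
      power_minus_mult[of p "of_nat p * y"] y(1)
    by (simp add: subring_C_closed[OF S] mult_ac)
  moreover have "dvd_in S (of_nat p) ((v + of_nat p * y) ^ p - (v ^ p + (of_nat p * y) ^ p))"
    by (intro frobenius_add[OF S p] v subring_C_mult[OF S] subring_C_of_nat[OF S] y)
  moreover have "dvd_in S (of_nat p) (v ^ p - poly f ((z ^ (p ^ j)) ^ p))"
    unfolding v_def by (rule frobenius_poly[OF S p f subring_C_power[OF S z]])
  ultimately have "dvd_in S (of_nat p) ((of_nat p * y) ^ p +
     ((v + of_nat p * y) ^ p - (v ^ p + (of_nat p * y) ^ p)) + (v ^ p - poly f ((z ^ (p ^ j)) ^ p)))"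
    by (intro dvd_in_add[OF S])
  then have "dvd_in S (of_nat p) (u ^ p - poly f ((z ^ (p ^ j)) ^ p))" unfolding uv by simp
  then show ?case by (simp only: u_def power_Suc2 power_mult)
qed (simp add: dvd_in_0[OF S])

lemma power_totient_eq:
  fixes p k :: nat
  assumes "coprime p k" "k > 0" "p \<ge> 2"
  obtains j t where "p ^ j = 1 + k * t" "p ^ j \<ge> 2"
proof -
  have "[p ^ totient k = 1] (mod k)" by (rule euler_theorem[OF assms(1)])
  then have "k dvd p ^ totient k - 1" by (rule cong_to_1_nat)
  then obtain t where "p ^ totient k - 1 = k * t" by blast
  moreover have "1 \<le> p ^ totient k" using assms by simp
  ultimately have "p ^ totient k = 1 + k * t" by linarith
  moreover have "p ^ 1 \<le> p ^ totient k" using assms by (intro power_increasing) (auto simp: Suc_le_eq totient_gt_0_iff)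
  ultimately show ?thesis using that[of "totient k" t] assms(3) by (metis order_trans power_one_right)
qed

context cyclo
begin

text \<open>There are no nilpotents modulo an unramified prime: some iterate of the Frobenius fixes
  \<zeta>, hence every x modulo p, while x^(p^j) is a multiple of x^2.\<close>

lemma Oz_reduced_mod_prime:
  assumes p: "prime p" "coprime p n" and x: "x \<in> Oz" "dvd_in Oz (of_nat p) (x ^ 2)"
  shows "dvd_in Oz (of_nat p) x"
proof -
  obtain f where f: "x = poly f \<zeta>" "coeffs_in \<int> f" using x by (auto simp: adj_def)
  obtain j t where j: "p ^ j = 1 + n * t" "p ^ j \<ge> 2"
    using power_totient_eq[OF p(2) n_pos prime_ge_2_nat[OF p(1)]] by blast
  have "\<zeta> ^ (p ^ j) = \<zeta>" unfolding j(1) power_add power_mult zeta_pow_n by simp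
  then have "dvd_in Oz (of_nat p) (x ^ (p ^ j) - x)"
    using frobenius_poly_iterated[OF Oz_subring p(1) f(2) zeta_in_Oz, of j] by (simp add: f)
  from dvd_in_diff[OF Oz_subring dvd_in_power[OF Oz_subring x(2,1) j(2)] this]
  have "dvd_in Oz (of_nat p) (x ^ (p ^ j) - (x ^ (p ^ j) - x))" .
  then show ?thesis by simp
qed

lemma zeta_3_minus_1: "1 - zeta 3 = complex_of_real (sqrt 3) * (complex_of_real (sqrt 3) - zeta 12)"
proof -
  have "zeta 3 = zeta 12 ^ 4" using zeta_mult_power[of 4 3] by simp
  then have "zeta 3 = Complex (1/2) (sqrt 3 / 2) - 1" unfolding zeta_12_powers(6) zeta_12_powers(1) .
  then show ?thesis by (simp add: zeta_12 complex_eq_iff algebra_simps)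
qed

text \<open>3 is ramified, and the argument for unramified primes fails modulo 3. Modulo sqrt 3 the
  cube roots of unity become 1, so it is enough that 3^j is 1 modulo 4 * 2^e: then \<zeta>^(3^j)
  differs from \<zeta> by a cube root of unity.\<close>

lemma Oz_reduced_mod_sqrt3:
  assumes m12: "m = 12" and x: "x \<in> Oz" "dvd_in Oz (complex_of_real (sqrt 3)) (x ^ 2)"
  shows "dvd_in Oz (complex_of_real (sqrt 3)) x"
proof -
  let ?r = "complex_of_real (sqrt 3)"
  note rO = sqrt3_Oz[OF m12]
  have rr: "of_nat 3 = ?r * ?r" by (simp flip: of_real_mult)
  obtain f where f: "x = poly f \<zeta>" "coeffs_in \<int> f" using x by (auto simp: adj_def)
  have "4 * 2 ^ e = (2 ^ (2 + e) :: nat)" by (simp add: power_add)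
  then have "coprime 3 (4 * 2 ^ e :: nat)" by (simp only: coprime_power_right_iff) simp
  then obtain j t :: nat where j: "3 ^ j = 1 + 4 * 2 ^ e * t" "3 ^ j \<ge> (2 :: nat)"
    by (rule power_totient_eq) auto
  define w where "w = \<zeta> ^ (4 * 2 ^ e)"
  have w: "w = zeta 3"
    using zeta_mult_power[of "4 * 2 ^ e" 3] by (simp add: w_def n_eq m12)
  have wO: "w \<in> Oz" unfolding w_def by (intro Oz_closed)
  have "dvd_in Oz ?r (1 - w)"
    unfolding w zeta_3_minus_1
    using rO zeta_m_in_Oz unfolding m12 by (intro dvd_in_triv Oz_subring subring_C_diff[OF Oz_subring])
  then have d1: "dvd_in Oz ?r (1 - w ^ t)"
    using dvd_in_one_minus_power[OF Oz_subring wO] dvd_in_trans[OF Oz_subring] by blast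
  have z: "\<zeta> ^ (3 ^ j) = \<zeta> * w ^ t" unfolding j(1) power_add power_mult w_def by simp
  have "dvd_in Oz ?r (- \<zeta> * (1 - w ^ t))"
    by (intro dvd_in_mult_left[OF Oz_subring] d1 Oz_closed)
  then have "dvd_in Oz ?r (\<zeta> ^ (3 ^ j) - \<zeta>)" unfolding z by (simp add: algebra_simps)
  moreover have "dvd_in Oz (\<zeta> ^ (3 ^ j) - \<zeta>) (poly f (\<zeta> ^ (3 ^ j)) - poly f \<zeta>)"
    by (intro dvd_in_poly_diff Oz_subring f Oz_closed)
  ultimately have A: "dvd_in Oz ?r (poly f (\<zeta> ^ (3 ^ j)) - x)"
    unfolding f by (rule dvd_in_trans[OF Oz_subring])
  have "dvd_in Oz (of_nat 3) (x ^ (3 ^ j) - poly f (\<zeta> ^ (3 ^ j)))"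
    unfolding f by (rule frobenius_poly_iterated[OF Oz_subring _ f(2) zeta_in_Oz]) simp
  moreover have "dvd_in Oz ?r (of_nat 3)" unfolding rr by (rule dvd_in_triv[OF Oz_subring rO])
  ultimately have B: "dvd_in Oz ?r (x ^ (3 ^ j) - poly f (\<zeta> ^ (3 ^ j)))"
    using dvd_in_trans[OF Oz_subring] by blast
  have C: "dvd_in Oz ?r (x ^ (3 ^ j))"
    by (rule dvd_in_power[OF Oz_subring x(2,1) j(2)])
  have "dvd_in Oz ?r (x ^ (3 ^ j) - (x ^ (3 ^ j) - poly f (\<zeta> ^ (3 ^ j))) - (poly f (\<zeta> ^ (3 ^ j)) - x))"
    by (rule dvd_in_diff[OF Oz_subring dvd_in_diff[OF Oz_subring C B] A])
  then show ?thesis by simp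
qed

lemma R_reduced:
  assumes P: "\<And>x. x \<in> Oz \<Longrightarrow> dvd_in Oz P (x ^ 2) \<Longrightarrow> dvd_in Oz P x"
    and x: "x \<in> R" "dvd_in R P (x ^ 2)"
  shows "dvd_in R P x"
proof -
  obtain y k where y: "x = y / 2 ^ k" "y \<in> Oz" using x by (auto simp: Rring_eq_halves halves_def)
  obtain v l where v: "x ^ 2 = P * (v / 2 ^ l)" "v \<in> Oz"
    using x(2) by (auto simp: dvd_in_def Rring_eq_halves halves_def)
  have "(2 ^ l * y) ^ 2 = 2 ^ l * 2 ^ l * (2 ^ k * 2 ^ k) * x ^ 2"
    by (simp add: y power2_eq_square)
  also have "\<dots> = P * (2 ^ l * (2 ^ k * 2 ^ k) * v)" by (simp add: v)
  finally have "dvd_in Oz P ((2 ^ l * y) ^ 2)"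
    using dvd_in_triv[OF Oz_subring, of "2 ^ l * (2 ^ k * 2 ^ k) * v" P] v(2) by (simp add: Oz_closed)
  moreover have "2 ^ l * y \<in> Oz" using y(2) by (simp add: Oz_closed)
  ultimately have "dvd_in Oz P (2 ^ l * y)" by (rule P[rotated])
  then obtain u where u: "u \<in> Oz" "2 ^ l * y = P * u" by (auto simp: dvd_in_def)
  have "x = 2 ^ l * y / 2 ^ (l + k)" by (simp add: y power_add)
  also have "\<dots> = P * (u / 2 ^ (l + k))" by (simp add: u)
  finally show ?thesis
    using dvd_in_triv[OF R_subring, of "u / 2 ^ (l + k)" P] halvesI[OF u(1)] by (simp add: Rring_eq_halves)
qed

lemma R_reduced_mod_prime:
  "prime p \<Longrightarrow> coprime p n \<Longrightarrow> x \<in> R \<Longrightarrow> dvd_in R (of_nat p) (x ^ 2) \<Longrightarrow> dvd_in R (of_nat p) x"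
  by (rule R_reduced[OF Oz_reduced_mod_prime])

lemma R_reduced_mod_sqrt3:
  "m = 12 \<Longrightarrow> x \<in> R \<Longrightarrow> dvd_in R (complex_of_real (sqrt 3)) (x ^ 2) \<Longrightarrow>
    dvd_in R (complex_of_real (sqrt 3)) x"
  by (rule R_reduced[OF Oz_reduced_mod_sqrt3])

lemma sqrt3_in_R: "m = 12 \<Longrightarrow> complex_of_real (sqrt 3) \<in> R"
  using sqrt3_Oz Oz_subset_R by blast

lemma prime_not_coprime_n:
  assumes "prime q" "\<not> coprime q n" shows "q = 2 \<or> (q = 3 \<and> m = 12)"
proof -
  have "q dvd n" using assms prime_imp_coprime by blast
  then have "q dvd m \<or> q dvd 2 ^ e" unfolding n_eq using assms(1) prime_dvd_mult_iff by blast
  then have "q dvd m \<or> q dvd 2" using assms(1) prime_dvd_power by blast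
  moreover have "q dvd 4 \<Longrightarrow> q dvd 2"
    using prime_dvd_power[OF assms(1), of 2 2] by simp
  moreover have "q dvd 12 \<Longrightarrow> q dvd 4 \<or> q dvd 3"
    using prime_dvd_mult_iff[OF assms(1), of 4 3] by simp
  moreover have "q dvd 2 \<Longrightarrow> q = 2" "q dvd 3 \<Longrightarrow> q = 3"
    using assms(1) primes_dvd_imp_eq[of q 2] primes_dvd_imp_eq[of q 3] by simp_all
  ultimately show ?thesis using m by blast
qed

lemma K_denominator:
  assumes "x \<in> K" obtains t where "t > 0" "of_nat t * x \<in> R"
proof -
  obtain p where p: "x = poly p \<zeta>" "coeffs_in \<rat> p" using assms by (auto simp: Kfld_eq_adj adj_def)
  have "\<exists>t>0. of_nat t * poly p \<zeta> \<in> R"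
    using subring_C_Rats p(2)
  proof (induction p rule: coeffs_in_induct)
    case (pCons a p)
    then obtain t where t: "t > 0" "of_nat t * poly p \<zeta> \<in> R" by blast
    obtain i j where ij: "a = of_int i / of_int j" "j > 0" using pCons(1) by (auto elim: Rats_cases')
    define b where "b = nat j"
    have a: "a = of_int i / of_nat b" and b: "b > 0" using ij by (simp_all add: b_def)
    have "of_nat (b * t) * poly (pCons a p) \<zeta> = of_nat t * of_int i + \<zeta> * (of_nat b * (of_nat t * poly p \<zeta>))"
      using b by (simp add: a field_simps)
    moreover have "\<dots> \<in> R"
      by (intro subring_C_add[OF R_subring] subring_C_mult[OF R_subring] R_closed(10,11) zeta_in_R t)
    ultimately show ?case using t(1) b by (intro exI[of _ "b * t"]) simp
  qed (rule exI[of _ 1], simp add: R_closed)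
  then show ?thesis using that p by blast
qed

text \<open>A fragment of integral closedness. A denominator t of \<delta> loses its primes one by
  one: q divides (t \<delta>)^2, hence t \<delta>, by reducedness modulo q. The prime 2 is
  invertible, and for m = 12 the prime 3 is removed as sqrt 3 twice.\<close>

theorem R_sqrt_closed:
  assumes d: "\<delta> \<in> K" "\<delta> ^ 2 \<in> R" shows "\<delta> \<in> R"
proof -
  have "\<delta> \<in> R" if "t > 0" "of_nat t * \<delta> \<in> R" for t
    using that
  proof (induction t rule: less_induct)
    case (less t)
    show ?case
    proof (cases "t = 1")
      case True
      then show ?thesis using less by simp
    next
      case False
      then obtain q where q: "prime q" "q dvd t" using prime_factor_nat by blast
      then obtain s where s: "t = q * s" by blast
      have s0: "s > 0" "s < t" using s less.prems(1) prime_ge_2_nat[OF q(1)] by auto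
      have q0: "of_nat q \<noteq> (0 :: complex)" using q(1) by auto
      define x where "x = of_nat t * \<delta>"
      have xR: "x \<in> R" using less.prems(2) by (simp add: x_def)
      have x2: "x ^ 2 = of_nat q * (of_nat q * (of_nat s ^ 2 * \<delta> ^ 2))"
        by (simp add: x_def s power2_eq_square)
      have sR: "of_nat s ^ 2 * \<delta> ^ 2 \<in> R" "of_nat q * (of_nat s ^ 2 * \<delta> ^ 2) \<in> R"
        by (intro subring_C_mult[OF R_subring] subring_C_power[OF R_subring] R_closed(10) d)+
      have "dvd_in R (of_nat q) x"
      proof (cases "coprime q n")
        case True
        show ?thesis
          by (rule R_reduced_mod_prime[OF q(1) True xR]) (simp only: x2 dvd_in_triv[OF R_subring sR(2)])
      next
        case False
        then consider "q = 2" | "q = 3" "m = 12" using prime_not_coprime_n[OF q(1)] by blast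
        then show ?thesis
        proof cases
          case 1
          have "x = of_nat q * (1 / 2 * x)" by (simp add: 1)
          moreover have "1 / 2 * x \<in> R"
            unfolding x_def by (rule subring_C_mult[OF R_subring half_in_R less.prems(2)])
          ultimately show ?thesis unfolding dvd_in_def by blast
        next
          case 2
          let ?r = "complex_of_real (sqrt 3)"
          have rr: "of_nat q = ?r * ?r" unfolding 2 by (simp flip: of_real_mult)
          have r: "?r \<in> R" "?r \<noteq> 0" using sqrt3_in_R[OF 2(2)] by simp_all
          have e: "x ^ 2 = ?r * (?r * (of_nat q * (of_nat s ^ 2 * \<delta> ^ 2)))"
            unfolding x2 by (simp add: rr mult.assoc)
          have "dvd_in R ?r (x ^ 2)"
            unfolding e by (rule dvd_in_triv[OF R_subring subring_C_mult[OF R_subring r(1) sR(2)]])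
          then have "dvd_in R ?r x" by (rule R_reduced_mod_sqrt3[OF 2(2) xR])
          then obtain y where y: "y \<in> R" "x = ?r * y" by (auto simp: dvd_in_def)
          have "?r * ?r * y ^ 2 = ?r * ?r * (?r * (?r * (of_nat s ^ 2 * \<delta> ^ 2)))"
            using x2 unfolding y(2) rr by (simp add: power2_eq_square mult_ac)
          then have e: "y ^ 2 = ?r * (?r * (of_nat s ^ 2 * \<delta> ^ 2))" using r(2) by simp
          have "dvd_in R ?r (y ^ 2)"
            unfolding e by (rule dvd_in_triv[OF R_subring subring_C_mult[OF R_subring r(1) sR(1)]])
          then have "dvd_in R ?r y" by (rule R_reduced_mod_sqrt3[OF 2(2) y(1)])
          then obtain z where z: "z \<in> R" "y = ?r * z" by (auto simp: dvd_in_def)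
          then have "x = of_nat q * z" unfolding y(2) rr by simp
          then show ?thesis using dvd_in_triv[OF R_subring z(1)] by simp
        qed
      qed
      then obtain y where y: "y \<in> R" "x = of_nat q * y" by (auto simp: dvd_in_def)
      then have "of_nat s * \<delta> = y" using q0 by (simp add: x_def s)
      then show ?thesis using less.IH[OF s0(2,1)] y(1) by simp
    qed
  qed
  then show ?thesis using K_denominator[OF d(1)] by blast
qed

lemma Runit_sqrt: "\<delta> \<in> K \<Longrightarrow> Runit (\<delta> ^ 2) \<Longrightarrow> Runit \<delta>"
  using R_sqrt_closed[of \<delta>] R_sqrt_closed[of "inverse \<delta>"] K_inverse[of \<delta>]
  by (auto simp: Runit_def power_inverse)

end

section \<open>Rational numbers that are a unit times a square\<close>

lemma rational_squarefree_decompose: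
  fixes c :: real
  assumes "c \<in> \<rat>" "c > 0"
  obtains f :: nat and y where "squarefree f" "y \<in> \<rat>" "y > 0" "c = of_nat f * y ^ 2"
proof -
  obtain a b where ab: "c = of_int a / of_int b" "b > 0" using assms(1) by (auto elim: Rats_cases')
  then have a: "a > 0" using assms(2) by (simp add: zero_less_divide_iff)
  define N where "N = nat (a * b)"
  define s where "s = square_part N"
  define f where "f = squarefree_part N"
  have N: "N > 0" "real N = of_int a * of_int b" using a ab(2) by (simp_all add: N_def)
  have Nf: "N = f * s ^ 2" unfolding f_def s_def by (rule squarefree_decompose)
  then have s: "s > 0" using N(1) by (cases s) auto
  have "c = real N / of_int b ^ 2" unfolding N(2) using ab by (simp add: field_simps power2_eq_square)
  also have "\<dots> = of_nat f * (of_nat s / of_int b) ^ 2" by (simp add: Nf power_divide)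
  finally have "c = of_nat f * (of_nat s / of_int b) ^ 2" .
  moreover have "squarefree f" unfolding f_def by (rule squarefree_squarefree_part)
  ultimately show ?thesis using that[of f "of_nat s / of_int b"] s ab(2) by simp
qed

lemma squarefree_dvd_6:
  fixes f :: nat
  assumes f: "squarefree f" and q: "\<And>q. prime q \<Longrightarrow> q dvd f \<Longrightarrow> q = 2 \<or> q = 3"
  shows "f = 1 \<or> f = 2 \<or> f = 3 \<or> f = 6"
proof -
  have f0: "f \<noteq> 0" using f by (metis not_squarefree_0)
  have "f dvd 6"
  proof (rule multiplicity_le_imp_dvd[OF f0])
    fix p :: nat assume p: "prime p"
    show "multiplicity p f \<le> multiplicity p 6"
    proof (cases "p dvd f")
      case False
      then show ?thesis by (simp add: not_dvd_imp_multiplicity_0)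
    next
      case True
      have "multiplicity p f \<le> 1"
        using squarefree_factorial_semiring''[OF f0] f p by auto
      moreover have "p dvd 6" using q[OF p True] by auto
      then have "multiplicity p 6 > 0" using p by (subst prime_multiplicity_gt_zero_iff) auto
      ultimately show ?thesis by linarith
    qed
  qed
  then have "f \<le> 6" by (rule dvd_imp_le) simp
  then have "f = 0 \<or> f = 1 \<or> f = 2 \<or> f = 3 \<or> f = 4 \<or> f = 5 \<or> f = 6" by arith
  then show ?thesis using \<open>f dvd 6\<close> by auto
qed

text \<open>Both values of c are 1 modulo 3, and a^2 + y^2 is divisible by 3 only if a and y are.
  Then 3 divides b too, and infinite descent on y applies. The two values serve to exclude 2 and 3,
  modulo squares, as norms a^2 - 3 b^2.\<close>

lemma ternary_form_mod_3:
  fixes a b y c :: int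
  assumes c: "c = 1 \<or> c = - 2" and eq: "a ^ 2 + c * y ^ 2 = 3 * b ^ 2"
  shows "y = 0"
  using eq
proof (induction "nat \<bar>y\<bar>" arbitrary: a b y rule: less_induct)
  case less
  show ?case
  proof (rule ccontr)
    assume y0: "y \<noteq> 0"
    have sq: "x ^ 2 mod 3 = (if 3 dvd x then 0 else 1)" for x :: int
    proof -
      have "x mod 3 = 0 \<or> x mod 3 = 1 \<or> x mod 3 = 2" by arith
      moreover have e: "x ^ 2 mod 3 = (x mod 3) ^ 2 mod 3" by (simp add: power_mod)
      ultimately show ?thesis unfolding e dvd_eq_mod_eq_0 by (elim disjE) simp_all
    qed
    have "(a ^ 2 + y ^ 2) mod 3 = 0"
    proof -
      have "a ^ 2 + y ^ 2 = 3 * (b ^ 2 + (if c = 1 then 0 else y ^ 2))" using c less.prems by auto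
      then show ?thesis by simp
    qed
    then have "((a ^ 2 mod 3) + (y ^ 2 mod 3)) mod 3 = 0" by (simp add: mod_add_eq)
    then have "3 dvd a" "3 dvd y" unfolding sq by (auto split: if_splits)
    then obtain a' y' where ay: "a = 3 * a'" "y = 3 * y'" by blast
    then have "3 * (a' ^ 2 + c * y' ^ 2) = b ^ 2" using less.prems by (simp add: power2_eq_square algebra_simps)
    then have "b ^ 2 mod 3 = 0" by presburger
    then have "3 dvd b" unfolding sq by (auto split: if_splits)
    then obtain b' where b: "b = 3 * b'" by blast
    have "a' ^ 2 + c * y' ^ 2 = 3 * b' ^ 2"
      using less.prems unfolding ay b by (simp add: power2_eq_square algebra_simps)
    moreover have "nat \<bar>y'\<bar> < nat \<bar>y\<bar>" using y0 ay by simp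
    ultimately have "y' = 0" using less.hyps by blast
    then show False using y0 ay by simp
  qed
qed

lemma ternary_form_rational:
  fixes a b y c :: real
  assumes r: "a \<in> \<rat>" "b \<in> \<rat>" "y \<in> \<rat>" and c: "c = 1 \<or> c = - 2" and eq: "a ^ 2 + c * y ^ 2 = 3 * b ^ 2"
  shows "y = 0"
proof -
  obtain a1 a2 b1 b2 y1 y2 where *: "a = of_int a1 / of_int a2" "a2 > 0" "b = of_int b1 / of_int b2" "b2 > 0"
    "y = of_int y1 / of_int y2" "y2 > 0"
    using r by (metis Rats_cases')
  define D where "D = a2 * b2 * y2"
  define A B Y where "A = a1 * b2 * y2" and "B = b1 * a2 * y2" and "Y = y1 * a2 * b2"
  have D: "of_int D \<noteq> (0::real)" using * by (simp add: D_def)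
  have ABY: "of_int A = of_int D * a" "of_int B = of_int D * b" "of_int Y = of_int D * y"
    using * by (simp_all add: A_def B_def Y_def D_def)
  obtain c' :: int where c': "c = of_int c'" "c' = 1 \<or> c' = - 2" using c by (metis of_int_1 of_int_minus of_int_numeral)
  have "of_int (A ^ 2 + c' * Y ^ 2) = of_int D ^ 2 * (a ^ 2 + c * y ^ 2)"
    by (simp add: ABY c' power_mult_distrib algebra_simps)
  also have "\<dots> = of_int (3 * B ^ 2)" unfolding eq by (simp add: ABY power_mult_distrib)
  finally have "A ^ 2 + c' * Y ^ 2 = 3 * B ^ 2" unfolding of_int_eq_iff .
  then have "Y = 0" by (rule ternary_form_mod_3[OF c'(2)])
  then show ?thesis using ABY(3) D by simp
qed

context cyclo
begin

lemma R_nat_quotient: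
  assumes q: "prime q" "q \<noteq> 2" and R: "of_nat g / of_nat q \<in> R" shows "q dvd g"
proof -
  have "of_nat g / of_nat q \<in> (\<rat> :: complex set)" by simp
  then obtain a k where a: "of_nat g / of_nat q = (of_int a / 2 ^ k :: complex)"
    using R_Rats[OF R] by blast
  have "of_nat q \<noteq> (0 :: complex)" using q by auto
  then have "of_int (int g * 2 ^ k) = (of_int (a * int q) :: complex)" using a by (simp add: field_simps)
  then have "int g * 2 ^ k = a * int q" unfolding of_int_eq_iff .
  then have "int q dvd int g * 2 ^ k" by simp
  then have "int q dvd int (g * 2 ^ k)" by simp
  then have "q dvd g * 2 ^ k" unfolding int_dvd_int_iff .
  then have "q dvd g \<or> q dvd 2 ^ k" using q(1) prime_dvd_mult_iff by blast
  moreover have "\<not> q dvd 2 ^ k"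
    using q primes_dvd_imp_eq[of q 2] prime_dvd_power[of q 2 k] by auto
  ultimately show ?thesis by blast
qed

text \<open>The squarefree part f of c is again a unit times a square \<delta>'^2. A prime q of f
  that is prime to n would divide \<delta>' by reducedness, hence q^2 would divide f. So f has only
  the primes 2 and 3, the latter only for m = 12.\<close>

lemma rational_unit_square:
  fixes c :: real
  assumes c: "c \<in> \<rat>" "c > 0" and nu: "Runit \<nu>" and d: "\<delta> \<in> K" and eq: "complex_of_real c = \<nu> * \<delta> ^ 2"
  obtains f :: nat and y where "y \<in> \<rat>" "y > 0" "c = of_nat f * y ^ 2"
    "f = 1 \<or> f = 2 \<or> m = 12 \<and> (f = 3 \<or> f = 6)"
proof -
  obtain f :: nat and y where f: "squarefree f" "y \<in> \<rat>" "y > 0" "c = of_nat f * y ^ 2"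
    using rational_squarefree_decompose[OF c] by blast
  define \<delta>' where "\<delta>' = \<delta> / complex_of_real y"
  have yK: "complex_of_real y \<in> K" using f(2) Rats_subset_K Rats_complex_iff by blast
  then have d'K: "\<delta>' \<in> K" unfolding \<delta>'_def by (intro K_divide d)
  have nu0: "\<nu> \<noteq> 0" "\<nu> \<in> R" "inverse \<nu> \<in> R" using nu by (auto simp: Runit_def)
  have "of_nat f * complex_of_real y ^ 2 = \<nu> * \<delta> ^ 2" using eq f(4) by simp
  then have feq: "of_nat f = \<nu> * \<delta>' ^ 2" using f(3) by (simp add: \<delta>'_def field_simps)
  then have d2: "\<delta>' ^ 2 = of_nat f * inverse \<nu>" using nu0 by simp
  also have "\<dots> \<in> R" by (intro subring_C_mult[OF R_subring] nu0 R_closed(10))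
  finally have d'R: "\<delta>' \<in> R" by (rule R_sqrt_closed[OF d'K])
  have pr: "q = 2 \<or> (q = 3 \<and> m = 12)" if q: "prime q" "q dvd f" for q
  proof (rule ccontr)
    assume no: "\<not> ?thesis"
    then have cop: "coprime q n" using prime_not_coprime_n[OF q(1)] by blast
    obtain g where g: "f = q * g" using q(2) by blast
    have e: "\<delta>' ^ 2 = of_nat q * (of_nat g * inverse \<nu>)" unfolding d2 g by simp
    have "dvd_in R (of_nat q) (\<delta>' ^ 2)"
      unfolding e by (intro dvd_in_triv R_subring subring_C_mult[OF R_subring] nu0 R_closed(10))
    then have "dvd_in R (of_nat q) \<delta>'" by (rule R_reduced_mod_prime[OF q(1) cop d'R])
    then obtain z where z: "z \<in> R" "\<delta>' = of_nat q * z" by (auto simp: dvd_in_def)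
    have q0: "of_nat q \<noteq> (0::complex)" using q(1) by auto
    have "of_nat q * of_nat g = of_nat q * (\<nu> * of_nat q * z ^ 2)"
      using feq unfolding z(2) g by (simp add: power2_eq_square mult_ac)
    then have "of_nat g / of_nat q = \<nu> * z ^ 2" using q0 by simp
    then have "of_nat g / of_nat q \<in> R"
      using nu0 z(1) subring_C_mult[OF R_subring] subring_C_power[OF R_subring] by simp
    then have "q dvd g" using R_nat_quotient[OF q(1)] no by blast
    then have "q ^ 2 dvd f" unfolding g power2_eq_square by (rule mult_dvd_mono[OF dvd_refl])
    then show False using squarefreeD[OF f(1)] q(1) by (metis not_prime_unit)
  qed
  then have "f = 1 \<or> f = 2 \<or> f = 3 \<or> f = 6" using squarefree_dvd_6[OF f(1)] by blast
  moreover have "m = 12" if "f = 3 \<or> f = 6" using pr[of 3] that by auto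
  ultimately show ?thesis using that[OF f(2-4)] by blast
qed

section \<open>Total positivity\<close>

text \<open>The automorphisms of K realize all embeddings of its real subfield, so this is total
  positivity; quantifying over \<open>is_aut\<close> makes it stable under \<sigma> and \<tau> at
  once.\<close>

definition tpos :: "complex \<Rightarrow> bool" where
  "tpos x \<longleftrightarrow> x \<in> K \<and> (\<forall>f. is_aut f \<longrightarrow> f x \<in> \<real> \<and> Re (f x) > 0)"

text \<open>The multiplicative group of the real subfield. Square classes are formed in it, so that
  y^2 = y * cnj y is a norm.\<close>

definition kr :: "complex \<Rightarrow> bool" where
  "kr x \<longleftrightarrow> x \<in> K \<and> x \<in> \<real> \<and> x \<noteq> 0"

lemma kr_mult: "kr x \<Longrightarrow> kr y \<Longrightarrow> kr (x * y)" and kr_inverse: "kr x \<Longrightarrow> kr (inverse x)"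
  and kr_divide: "kr x \<Longrightarrow> kr y \<Longrightarrow> kr (x / y)"
  by (auto simp: kr_def K_closed)

lemma kr_power: "kr x \<Longrightarrow> kr (x ^ k)"
  by (auto simp: kr_def K_closed)

lemma kr_1: "kr 1"
  by (simp add: kr_def K_closed)

lemma kr_is_aut: "is_aut f \<Longrightarrow> kr x \<Longrightarrow> kr (f x)"
  unfolding kr_def using is_aut_K is_aut_real is_aut_nonzero by blast

lemma Reals_eq_of_real_Re: "x \<in> \<real> \<Longrightarrow> x = complex_of_real (Re x)"
  by (metis Reals_cases Re_complex_of_real)

lemma tpos_aut: "tpos x \<Longrightarrow> is_aut f \<Longrightarrow> f x = complex_of_real (Re (f x)) \<and> Re (f x) > 0"
  unfolding tpos_def using Reals_eq_of_real_Re by blast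

lemma tpos_kr: "tpos x \<Longrightarrow> kr x"
  using tpos_aut[OF _ is_aut_id, of x] unfolding tpos_def kr_def id_def
  by (metis Reals_of_real less_irrefl zero_complex.sel(1))

lemma tpos_mult: assumes "tpos x" "tpos y" shows "tpos (x * y)"
  unfolding tpos_def
proof (intro conjI allI impI)
  have K: "x \<in> K" "y \<in> K" using assms by (auto simp: tpos_def)
  show "x * y \<in> K" by (intro K_closed K)
  fix f assume f: "is_aut f"
  obtain a b where ab: "f x = complex_of_real a" "a > 0" "f y = complex_of_real b" "b > 0"
    using tpos_aut[OF assms(1) f] tpos_aut[OF assms(2) f] by blast
  have "f (x * y) = complex_of_real (a * b)" using ab is_aut_mult[OF f K] by simp
  then show "f (x * y) \<in> \<real>" "Re (f (x * y)) > 0" unfolding Re_complex_of_real using ab by auto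
qed

lemma tpos_inverse: assumes "tpos x" shows "tpos (inverse x)"
  unfolding tpos_def
proof (intro conjI allI impI)
  have K: "x \<in> K" using assms by (auto simp: tpos_def)
  show "inverse x \<in> K" by (intro K_closed K)
  fix f assume f: "is_aut f"
  obtain a where a: "f x = complex_of_real a" "a > 0" using tpos_aut[OF assms(1) f] by blast
  have "f (inverse x) = complex_of_real (inverse a)" using a is_aut_inverse[OF f K] by simp
  then show "f (inverse x) \<in> \<real>" "Re (f (inverse x)) > 0" using a by simp_all
qed

lemma tpos_divide: "tpos x \<Longrightarrow> tpos y \<Longrightarrow> tpos (x / y)"
  by (simp add: divide_inverse tpos_mult tpos_inverse)

lemma tpos_is_aut: assumes "tpos x" "is_aut f" shows "tpos (f x)"
  unfolding tpos_def
proof (intro conjI allI impI)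
  show "f x \<in> K" using assms is_aut_K by (simp add: tpos_def)
  fix g assume "is_aut g"
  then have "is_aut (g \<circ> f)" using assms(2) by (rule is_aut_comp)
  then show "g (f x) \<in> \<real>" "Re (g (f x)) > 0" using assms(1) by (auto simp: tpos_def)
qed

lemma tpos_norm: assumes "x \<in> K" "x \<noteq> 0" shows "tpos (x * cnj x)"
  unfolding tpos_def
proof (intro conjI allI impI)
  show "x * cnj x \<in> K" by (intro K_closed K_cnj assms)
  fix f assume f: "is_aut f"
  have "f (x * cnj x) = complex_of_real ((cmod (f x))\<^sup>2)"
    using is_aut_mult[OF f assms(1) K_cnj[OF assms(1)]] is_aut_cnj[OF f assms(1)]
      complex_norm_square[of "f x"] by simp
  moreover have "f x \<noteq> 0" using is_aut_nonzero[OF f] assms by blast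
  ultimately show "f (x * cnj x) \<in> \<real>" "Re (f (x * cnj x)) > 0" by simp_all
qed

text \<open>Explicit Hilbert 90 for a quadratic extension: if the conjugates q, q' have product y^2,
  then q (q + q' + 2 y) = (q + y)^2. For rational y the factor q + q' + 2 y is rational, so q is a
  rational number times a square.\<close>

lemma quadratic_norm_square:
  fixes q q' y :: real
  assumes "q > 0" "q' > 0" "y > 0" "q * q' = y ^ 2"
  shows "q = (q + q' + 2 * y) * ((q + y) / (q + q' + 2 * y)) ^ 2"
proof -
  define c where "c = q + q' + 2 * y"
  have "q * c = (q + y) ^ 2"
    using assms(4) by (simp add: c_def power2_eq_square algebra_simps)
  moreover have "c > 0" using assms by (simp add: c_def)
  ultimately show ?thesis
    by (fold c_def) (simp add: power_divide field_simps power2_eq_square)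
qed

end

section \<open>Square classes of real elements of K0\<close>

lemma coprime_7_12: "coprime (7::nat) 12"
proof (rule coprimeI)
  fix c :: nat assume "c dvd 7" "c dvd 12"
  then have "c dvd 7 * 7 - 12 * 4" by (intro dvd_diff_nat dvd_mult2)
  then show "is_unit c" by simp
qed

context cyclo
begin

text \<open>Chosen to move sqrt 3 when m = 12: the seventh power of \<open>zeta 12\<close> is its
  negative, and 7 is prime to 12 * 2^e.\<close>

abbreviation "\<tau> \<equiv> aut 7"

lemma coprime_7_n: "m = 12 \<Longrightarrow> coprime 7 n"
proof -
  assume m12: "m = 12"
  have "odd (7 :: nat)" by simp
  then have "coprime (7 :: nat) (2 ^ e)"
    using coprime_right_2_iff_odd[of "7 :: nat"] coprime_power_right_iff[of "7 :: nat" 2 e] by blast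
  then show ?thesis unfolding n_eq m12 coprime_mult_right_iff using coprime_7_12 by blast
qed

lemma is_aut_tau: "m = 12 \<Longrightarrow> is_aut \<tau>"
  by (rule is_aut_aut[OF coprime_7_n])

lemma sqrt3_in_K: "m = 12 \<Longrightarrow> complex_of_real (sqrt 3) \<in> K"
  using sqrt3_Oz Oz_subset_K by blast

lemma tau_sqrt3: assumes m12: "m = 12" shows "\<tau> (complex_of_real (sqrt 3)) = - complex_of_real (sqrt 3)"
proof -
  note t = is_aut_tau[OF m12]
  have c7: "coprime 7 n" by (rule coprime_7_n[OF m12])
  have zK: "zeta 12 \<in> K" using zeta_m_in_K0 K0_subset_K m12 by auto
  have "\<tau> (\<zeta> ^ (2 ^ e)) = (\<zeta> ^ (2 ^ e)) ^ 7"
    unfolding is_aut_power[OF t zeta_in_K] aut_zeta[OF c7] by (simp only: mult.commute flip: power_mult)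
  then have "\<tau> (zeta 12) = zeta 12 ^ 6 * zeta 12" unfolding zeta_pow_d m12 by (simp flip: power_Suc2)
  then have tz: "\<tau> (zeta 12) = - zeta 12" by (simp add: zeta_12_powers(3))
  have s: "complex_of_real (sqrt 3) = zeta 12 + cnj (zeta 12)" by (simp add: zeta_12 complex_eq_iff)
  show ?thesis
    unfolding s is_aut_add[OF t zK K_cnj[OF zK]] is_aut_cnj[OF t zK] tz by simp
qed

lemma K_of_real_Rats: "r \<in> \<rat> \<Longrightarrow> complex_of_real r \<in> K"
  using Rats_subset_K Rats_complex_iff by blast

text \<open>Compare q1 = a + b sqrt 3 with its conjugate q2. Total positivity makes both positive,
  and the rational number q1 q2 is f y^2 with f one of 1, 2, 3, 6. The norm form excludes 2 and 3.
  For f = 1, q1 is a rational number times a square, and 3 is itself a square in K. For f = 6,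
  multiplication by 3 + sqrt 3, of norm 6, makes the norm a square, but leaves an odd power of sqrt
  3, which a unit times a square cannot have.\<close>

lemma square_class_12:
  assumes m12: "m = 12" and mu: "Runit \<mu>" "tpos \<mu>" and B: "kr B"
    and q: "\<mu> * B ^ 2 = complex_of_real (a + b * sqrt 3)" "a \<in> \<rat>" "b \<in> \<rat>"
  shows "\<exists>k y. kr y \<and> \<mu> * B ^ 2 = 2 ^ k * y ^ 2"
proof -
  note t = is_aut_tau[OF m12]
  let ?r = "complex_of_real (sqrt 3)"
  define q1 q2 where "q1 = a + b * sqrt 3" and "q2 = a - b * sqrt 3"
  have K: "\<mu> \<in> K" "B \<in> K" using mu B by (auto simp: tpos_def kr_def)
  have aK: "complex_of_real a \<in> K" "complex_of_real b \<in> K" using q K_of_real_Rats by auto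
  have muR: "\<mu> \<in> R" "inverse \<mu> \<in> R" "\<mu> \<noteq> 0" using mu by (auto simp: Runit_def)
  have pos: "x > 0" if h: "tpos \<nu>" "kr C" "\<nu> * C ^ 2 = complex_of_real x" for \<nu> C x
  proof -
    obtain u where u: "\<nu> = complex_of_real u" "u > 0" using tpos_aut[OF h(1) is_aut_id] by auto
    obtain v where v: "C = complex_of_real v" "v \<noteq> 0"
      using h(2) Reals_eq_of_real_Re by (metis kr_def of_real_0)
    have "complex_of_real x = complex_of_real (u * v ^ 2)" using h(3) u v by simp
    then have "x = u * v ^ 2" unfolding of_real_eq_iff .
    then show ?thesis using u v by simp
  qed
  have q1: "q1 > 0" using pos[OF mu(2) B] q(1) by (simp add: q1_def)
  have tq: "\<tau> \<mu> * \<tau> B ^ 2 = complex_of_real q2"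
  proof -
    have "\<tau> (\<mu> * B ^ 2) = \<tau> \<mu> * \<tau> B ^ 2"
      using K by (simp add: is_aut_mult[OF t] is_aut_power[OF t] K_closed)
    moreover have "\<tau> (complex_of_real a + complex_of_real b * ?r) = complex_of_real a + complex_of_real b * (- ?r)"
    proof -
      have "\<tau> (complex_of_real a) = complex_of_real a" "\<tau> (complex_of_real b) = complex_of_real b"
        using q Rats_complex_iff is_aut_Rats[OF t] by blast+
      then show ?thesis
        using aK sqrt3_in_K[OF m12] tau_sqrt3[OF m12]
        by (simp add: is_aut_add[OF t] is_aut_mult[OF t] K_closed)
    qed
    ultimately show ?thesis using q(1) by (simp add: q2_def)
  qed
  have q2: "q2 > 0" by (rule pos[OF tpos_is_aut[OF mu(2) t] kr_is_aut[OF t B] tq])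
  define r where "r = a ^ 2 - 3 * b ^ 2"
  have rq: "q1 * q2 = r" by (simp add: q1_def q2_def r_def algebra_simps power2_eq_square)
  have "complex_of_real r = (\<mu> * \<tau> \<mu>) * (B * \<tau> B) ^ 2"
    using q(1) tq unfolding rq[symmetric] of_real_mult q1_def[symmetric] by (simp add: power_mult_distrib mult_ac)
  moreover have "r \<in> \<rat>" using q by (simp add: r_def)
  moreover have "r > 0" using rq q1 q2 by (metis mult_pos_pos)
  moreover have "Runit (\<mu> * \<tau> \<mu>)" by (rule Runit_mult[OF mu(1) Runit_is_aut[OF t mu(1)]])
  moreover have "B * \<tau> B \<in> K" by (rule subring_C_mult[OF K_subring K(2) is_aut_K[OF t K(2)]])
  ultimately obtain f :: nat and y where f: "y \<in> \<rat>" "y > 0" "r = of_nat f * y ^ 2"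
    "f = 1 \<or> f = 2 \<or> f = 3 \<or> f = 6"
    using rational_unit_square[of r "\<mu> * \<tau> \<mu>" "B * \<tau> B"] by metis
  have f2: "f \<noteq> 2"
  proof
    assume "f = 2"
    then have "a ^ 2 + (- 2) * y ^ 2 = 3 * b ^ 2" using f(3) by (simp add: r_def)
    then show False using ternary_form_rational[of a b y "- 2"] q f by simp
  qed
  have f3: "f \<noteq> 3"
  proof
    assume "f = 3"
    \<comment> \<open>Dividing a^2 - 3 b^2 = 3 y^2 by 3 brings it into the ternary form with c =
      1.\<close>
    then have "b ^ 2 + 1 * y ^ 2 = 3 * (a / 3) ^ 2" using f(3) by (simp add: r_def power2_eq_square)
    then show False using ternary_form_rational[of b "a / 3" y 1] q f by simp
  qed
  have krr: "kr (complex_of_real x)" if "complex_of_real x \<in> K" "x \<noteq> 0" for x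
    using that by (simp add: kr_def)
  have q1K: "complex_of_real q1 \<in> K"
    using aK sqrt3_in_K[OF m12] by (simp add: q1_def K_closed)
  from f(4) f2 f3 consider "f = 1" | "f = 6" by blast
  then show ?thesis
  proof cases
    case 1
    then have "q1 * q2 = y ^ 2" using rq f(3) by simp
    define c where "c = q1 + q2 + 2 * y"
    define z where "z = (q1 + y) / c"
    have c: "c > 0" "c \<in> \<rat>" using q1 q2 f q by (simp_all add: c_def) (simp add: q1_def q2_def)
    have qz: "q1 = c * z ^ 2"
      unfolding c_def z_def by (rule quadratic_norm_square[OF q1 q2 f(2) \<open>q1 * q2 = y ^ 2\<close>])
    have z: "z > 0" using q1 f c by (simp add: z_def)
    have zK: "complex_of_real z \<in> K"
      unfolding z_def of_real_divide of_real_add by (intro K_closed q1K K_of_real_Rats f c)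
    have "complex_of_real c = \<mu> * (B / complex_of_real z) ^ 2"
      using q(1) z unfolding q1_def[symmetric] qz by (simp add: power_divide field_simps)
    moreover have "B / complex_of_real z \<in> K" by (intro K_divide K zK)
    ultimately obtain g :: nat and w where w: "w \<in> \<rat>" "w > 0" "c = of_nat g * w ^ 2"
      "g = 1 \<or> g = 2 \<or> g = 3 \<or> g = 6"
      using rational_unit_square[OF c(2,1) mu(1)] by metis
    have wz: "kr (complex_of_real (w * z))"
      using w z zK K_of_real_Rats[of w] by (intro krr) (simp_all add: K_closed)
    have wz3: "kr (complex_of_real (sqrt 3 * (w * z)))"
      using w z zK K_of_real_Rats[of w] sqrt3_in_K[OF m12] by (intro krr) (simp_all add: K_closed)
    have eq: "\<mu> * B ^ 2 = complex_of_real (of_nat g * (w * z) ^ 2)"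
      using q(1) unfolding q1_def[symmetric] qz w(3) by (simp add: power_mult_distrib mult_ac)
    show ?thesis
      using w(4)
    proof (elim disjE)
      assume "g = 1"
      then show ?thesis using eq wz by (intro exI[of _ 0] exI[of _ "complex_of_real (w * z)"]) simp
    next
      assume "g = 2"
      then show ?thesis using eq wz by (intro exI[of _ 1] exI[of _ "complex_of_real (w * z)"]) simp
    next
      assume "g = 3"
      then have "of_nat g * (w * z) ^ 2 = (sqrt 3 * (w * z)) ^ 2" by (simp add: power_mult_distrib)
      then show ?thesis using eq wz3
        by (intro exI[of _ 0] exI[of _ "complex_of_real (sqrt 3 * (w * z))"]) (simp only: of_real_power power_0 mult_1 simp_thms)
    next
      assume "g = 6"
      then have "of_nat g * (w * z) ^ 2 = 2 * (sqrt 3 * (w * z)) ^ 2" by (simp add: power_mult_distrib)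
      then show ?thesis using eq wz3
        by (intro exI[of _ 1] exI[of _ "complex_of_real (sqrt 3 * (w * z))"])
           (simp only: of_real_power of_real_mult[of 2] of_real_numeral power_one_right simp_thms)
    qed
  next
    case 2
    \<comment> \<open>3 + sqrt 3 has norm 6, so the product of the conjugates becomes 36 y^2; both
      stay positive because sqrt 3 < 3.\<close>
    define Q1 Q2 where "Q1 = q1 * (3 + sqrt 3)" and "Q2 = q2 * (3 - sqrt 3)"
    have "sqrt 3 < 3" using real_sqrt_less_mono[of 3 9] by simp
    then have Q12: "Q1 > 0" "Q2 > 0" using q1 q2 by (simp_all add: Q1_def Q2_def add_pos_pos)
    have "Q1 * Q2 = (q1 * q2) * ((3 + sqrt 3) * (3 - sqrt 3))" by (simp add: Q1_def Q2_def)
    also have "(3 + sqrt 3) * (3 - sqrt 3) = 6" by (simp add: algebra_simps)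
    finally have QQ: "Q1 * Q2 = (6 * y) ^ 2" unfolding rq using 2 f(3) by (simp add: power2_eq_square)
    define c where "c = Q1 + Q2 + 2 * (6 * y)"
    define z where "z = (Q1 + 6 * y) / c"
    have "Q1 + Q2 = 6 * a + 6 * b" by (simp add: Q1_def Q2_def q1_def q2_def algebra_simps)
    then have c: "c > 0" "c \<in> \<rat>" using Q12 f q by (simp_all add: c_def)
    have y6: "6 * y > 0" using f by simp
    have qz: "Q1 = c * z ^ 2"
      unfolding c_def z_def by (rule quadratic_norm_square[OF Q12 y6 QQ])
    have z: "z > 0" using Q12 f c by (simp add: z_def)
    have s3K: "complex_of_real (3 + sqrt 3) \<in> K" using sqrt3_in_K[OF m12] by (simp add: K_closed)
    have Q1K: "complex_of_real Q1 \<in> K" unfolding Q1_def of_real_mult by (intro K_closed q1K s3K)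
    have y6K: "complex_of_real (6 * y) \<in> K" using f by (intro K_of_real_Rats) simp
    have zK: "complex_of_real z \<in> K"
      unfolding z_def of_real_divide of_real_add[of Q1]
      by (intro K_divide subring_C_add[OF K_subring] Q1K y6K K_of_real_Rats c)
    obtain g :: nat and w where w: "squarefree g" "w \<in> \<rat>" "w > 0" "c = of_nat g * w ^ 2"
      using rational_squarefree_decompose[OF c(2,1)] by blast
    define \<delta> where "\<delta> = B * complex_of_real (3 + sqrt 3) / complex_of_real (w * z)"
    have wK: "complex_of_real w \<in> K" by (rule K_of_real_Rats[OF w(2)])
    have dK: "\<delta> \<in> K" unfolding \<delta>_def of_real_mult by (intro K_closed K s3K wK zK)
    have gd: "of_nat g * complex_of_real (3 + sqrt 3) = \<mu> * \<delta> ^ 2"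
    proof -
      have "\<mu> * \<delta> ^ 2 = (\<mu> * B ^ 2) * (complex_of_real (3 + sqrt 3) / complex_of_real (w * z)) ^ 2"
        by (simp add: \<delta>_def power_divide power_mult_distrib)
      also have "\<dots> = complex_of_real (q1 * ((3 + sqrt 3) / (w * z)) ^ 2)" unfolding q(1) q1_def[symmetric] by simp
      also have "q1 * ((3 + sqrt 3) / (w * z)) ^ 2 = Q1 * (3 + sqrt 3) / (w * z) ^ 2"
        by (simp add: Q1_def power_divide power2_eq_square)
      also have "\<dots> = of_nat g * (3 + sqrt 3)"
        unfolding qz w(4) using w z by (simp add: power_mult_distrib field_simps)
      finally show ?thesis by simp
    qed
    \<comment> \<open>A factor 3 of the squarefree g is the square of sqrt 3 and moves into
      \<delta>.\<close>
    have "\<exists>g \<delta>. \<not> 3 dvd (g::nat) \<and> \<delta> \<in> K \<and> of_nat g * complex_of_real (3 + sqrt 3) = \<mu> * \<delta> ^ 2"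
    proof (cases "3 dvd g")
      case False
      then show ?thesis using gd dK by blast
    next
      case True
      then obtain g' where g': "g = 3 * g'" by blast
      have "\<not> 3 dvd g'"
      proof
        assume "3 dvd g'"
        then have "3 ^ 2 dvd g" unfolding g' power2_eq_square by (rule mult_dvd_mono[OF dvd_refl])
        then have "(3::nat) dvd 1" by (rule squarefreeD[OF w(1)])
        then show False by simp
      qed
      moreover have "of_nat g' * complex_of_real (3 + sqrt 3) = \<mu> * (\<delta> / ?r) ^ 2"
      proof -
        have "?r ^ 2 = 3" by (simp flip: of_real_power)
        then show ?thesis using gd unfolding g' by (simp add: power_divide field_simps)
      qed
      moreover have "\<delta> / ?r \<in> K" by (intro K_divide dK sqrt3_in_K m12)
      ultimately show ?thesis by blast
    qed
    then obtain g :: nat and \<delta> where g: "\<not> 3 dvd g" "\<delta> \<in> K" "of_nat g * complex_of_real (3 + sqrt 3) = \<mu> * \<delta> ^ 2"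
      by blast
    have rR: "?r \<in> R" by (rule sqrt3_in_R[OF m12])
    have rr: "?r * ?r = 3" by (simp flip: of_real_mult)
    have d2: "\<delta> ^ 2 = ?r * (of_nat g * (?r + 1) * inverse \<mu>)"
    proof -
      have "complex_of_real (3 + sqrt 3) = ?r * (?r + 1)" by (simp add: distrib_left rr)
      then show ?thesis using g(3) muR by (simp add: field_simps)
    qed
    have cR: "of_nat g * (?r + 1) * inverse \<mu> \<in> R"
      by (intro subring_C_mult[OF R_subring] subring_C_add[OF R_subring] rR muR R_closed(2,10))
    have "\<delta> ^ 2 \<in> R" unfolding d2 by (intro subring_C_mult[OF R_subring rR] cR)
    then have dR: "\<delta> \<in> R" by (rule R_sqrt_closed[OF g(2)])
    have "dvd_in R ?r (\<delta> ^ 2)" unfolding d2 by (rule dvd_in_triv[OF R_subring cR])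
    then have "dvd_in R ?r \<delta>" by (rule R_reduced_mod_sqrt3[OF m12 dR])
    then obtain v where v: "v \<in> R" "\<delta> = ?r * v" by (auto simp: dvd_in_def)
    \<comment> \<open>Multiplying by sqrt 3 - 1 turns the factor sqrt 3 + 1 into 2: then sqrt 3 x =
      2 g, and squaring gives 3 x^2 = 4 g^2 with x in R, so 3 divides g.\<close>
    define x where "x = \<mu> * v ^ 2 * (?r - 1)"
    have xR: "x \<in> R" unfolding x_def
      by (intro subring_C_mult[OF R_subring] subring_C_diff[OF R_subring] subring_C_power[OF R_subring] v muR rR R_closed(2))
    have "?r * (?r * v ^ 2) = ?r * (of_nat g * (?r + 1) * inverse \<mu>)"
      using d2 unfolding v(2) by (simp add: power2_eq_square mult_ac)
    then have "?r * v ^ 2 = of_nat g * (?r + 1) * inverse \<mu>" by simp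
    then have "?r * x = of_nat g * ((?r + 1) * (?r - 1))" using muR by (simp add: x_def field_simps)
    also have "(?r + 1) * (?r - 1) = 2" by (simp add: algebra_simps rr)
    finally have rx: "?r * x = of_nat (2 * g)" by simp
    have "of_nat (2 * g * (2 * g)) / of_nat 3 = x ^ 2"
      unfolding of_nat_mult[of "2 * g" "2 * g"] rx[symmetric] using rr by (simp add: power2_eq_square mult_ac)
    then have "of_nat (2 * g * (2 * g)) / of_nat 3 \<in> R" using xR by (simp only: subring_C_power[OF R_subring])
    then have "3 dvd 2 * g * (2 * g)" by (intro R_nat_quotient) simp_all
    then have "3 dvd g" using prime_dvd_mult_iff[of 3 "2 * g" "2 * g"] prime_dvd_mult_iff[of 3 2 g] by auto
    then show ?thesis using g(1) by blast
  qed
qed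

text \<open>For m = 4 a real element of K0 is rational and its squarefree part is 1 or 2; for m = 12
  the real subfield is \<rat>(sqrt 3). The square of B is carried along and divided out at the
  end.\<close>

lemma square_class_K0:
  assumes mu: "Runit \<mu>" "tpos \<mu>" and B: "kr B" and q: "\<mu> * B ^ 2 \<in> K0"
  shows "\<exists>k y. kr y \<and> \<mu> = 2 ^ k * y ^ 2"
proof -
  have "\<exists>k y. kr y \<and> \<mu> * B ^ 2 = 2 ^ k * y ^ 2"
  proof -
    have "kr (\<mu> * B ^ 2)" by (intro kr_mult kr_power tpos_kr mu B)
    then obtain x where x: "\<mu> * B ^ 2 = complex_of_real x"
      using Reals_eq_of_real_Re by (metis kr_def)
    from m show ?thesis
    proof
      assume m4: "m = 4"
      then have xQ: "x \<in> \<rat>" and m12: "m \<noteq> 12" using q unfolding x by (simp_all add: Kfld_4_real)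
      obtain u where u: "\<mu> = complex_of_real u" "u > 0" using tpos_aut[OF mu(2) is_aut_id] by auto
      obtain v where v: "B = complex_of_real v" "v \<noteq> 0"
        using B Reals_eq_of_real_Re by (metis kr_def of_real_0)
      have "complex_of_real x = complex_of_real (u * v ^ 2)" using x u v by simp
      then have "x = u * v ^ 2" unfolding of_real_eq_iff .
      then have "x > 0" using u v by simp
      moreover have "B \<in> K" using B by (simp add: kr_def)
      ultimately obtain f :: nat and y where f: "y \<in> \<rat>" "y > 0" "x = of_nat f * y ^ 2" "f = 1 \<or> f = 2"
        using rational_unit_square[OF xQ _ mu(1) _ x[symmetric]] m12 by metis
      have "kr (complex_of_real y)" using f K_of_real_Rats by (simp add: kr_def)
      \<comment> \<open>f is 1 or 2, so f - 1 is the exponent of 2.\<close>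
      moreover have "\<mu> * B ^ 2 = 2 ^ (f - 1) * complex_of_real y ^ 2" using f(3,4) unfolding x by auto
      ultimately show ?thesis by blast
    next
      assume m12: "m = 12"
      then obtain a b where "a \<in> \<rat>" "b \<in> \<rat>" "x = a + b * sqrt 3" using q unfolding x by (auto simp: Kfld_12_real)
      then show ?thesis using square_class_12[OF m12 mu B] x by simp
    qed
  qed
  then obtain k y where y: "kr y" "\<mu> * B ^ 2 = 2 ^ k * y ^ 2" by blast
  have "\<mu> = 2 ^ k * (y / B) ^ 2"
    using y(2) B by (simp add: kr_def power_divide field_simps)
  then show ?thesis using kr_divide[OF y(1) B] by blast
qed

end

section \<open>Hilbert 90 for the cyclic group generated by \<open>\<sigma>\<close>\<close>

lemma two_power_odd_decompose:
  fixes i :: nat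
  assumes "i > 0" obtains a u where "odd u" "i = 2 ^ a * u"
proof -
  have "\<exists>a u. odd u \<and> i = 2 ^ a * u"
    using assms
  proof (induction i rule: less_induct)
    case (less i)
    show ?case
    proof (cases "even i")
      case True
      then obtain j where j: "i = 2 * j" by blast
      then have "j < i" "j > 0" using less.prems by auto
      then obtain a u where "odd u" "j = 2 ^ a * u" using less.IH by blast
      then show ?thesis using j by (intro exI[of _ "Suc a"] exI[of _ u]) simp
    next
      case False
      then show ?thesis by (intro exI[of _ 0] exI[of _ i]) simp
    qed
  qed
  then show ?thesis using that by blast
qed

lemma one_plus_even_power:
  fixes x :: nat
  assumes "even x" shows "\<exists>w. (1 + x) ^ u = 1 + x * w \<and> (odd w \<longleftrightarrow> odd u)"
proof (induction u)
  case (Suc u)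
  then obtain w where w: "(1 + x) ^ u = 1 + x * w" "odd w \<longleftrightarrow> odd u" by blast
  have "(1 + x) ^ Suc u = 1 + x * (w * (1 + x) + 1)"
    unfolding power_Suc w(1) by (simp add: algebra_simps)
  moreover have "odd (w * (1 + x) + 1) \<longleftrightarrow> odd (Suc u)" using assms w(2) by simp
  ultimately show ?case by blast
qed (rule exI[of _ 0], simp)

lemma succ_power_eq:
  assumes "4 dvd m" and i: "i > 0"
  obtains a w where "odd w" "2 ^ a \<le> i" "Suc m ^ i = 1 + m * 2 ^ a * w"
proof -
  obtain a u where u: "odd u" "i = 2 ^ a * u" using two_power_odd_decompose[OF i] by blast
  obtain v where v: "odd v" "Suc m ^ (2 ^ a) = 1 + m * 2 ^ a * v"
    using succ_power_two_power[OF assms(1)] by blast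
  have "even (m * 2 ^ a * v)" using assms(1) by auto
  then obtain w where w: "(1 + m * 2 ^ a * v) ^ u = 1 + m * 2 ^ a * v * w" "odd w \<longleftrightarrow> odd u"
    using one_plus_even_power by blast
  have "Suc m ^ i = 1 + m * 2 ^ a * (v * w)"
    unfolding u(2) power_mult v(2) w(1) by (simp add: mult.assoc)
  moreover have "odd (v * w)" using v w u by simp
  moreover have "2 ^ a \<le> i" using u by (cases u) auto
  ultimately show ?thesis using that by blast
qed

context cyclo
begin

text \<open>Equality would mean that \<sigma>^i sends \<zeta> to itself or to its inverse. The first
  contradicts the exact power of 2 in the exponent. The second would make n, hence 4, divide Suc m ^
  i + 1, which is 2 modulo 4.\<close>

lemma zeta_real_conjugates_distinct:
  assumes i: "0 < i" "i < 2 ^ e"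
  shows "\<zeta> + inverse \<zeta> \<noteq> (\<sigma> ^^ i) (\<zeta> + inverse \<zeta>)"
proof
  assume eq: "\<zeta> + inverse \<zeta> = (\<sigma> ^^ i) (\<zeta> + inverse \<zeta>)"
  note si = is_aut_sigma_pow[of i]
  define b where "b = \<zeta> ^ (Suc m ^ i)"
  have b: "b \<noteq> 0" using zeta_nonzero[of n] by (simp add: b_def)
  have "(\<sigma> ^^ i) (\<zeta> + inverse \<zeta>) = b + inverse b"
    by (simp add: is_aut_add[OF si] is_aut_inverse[OF si] sigma_pow_zeta zeta_in_K K_inverse b_def)
  then have "\<zeta> + inverse \<zeta> - (b + inverse b) = 0" using eq by simp
  moreover have "\<zeta> + inverse \<zeta> - (b + inverse b) = (\<zeta> - b) * (1 - inverse (\<zeta> * b))"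
    using b zeta_nonzero[of n] by (simp add: field_simps)
  ultimately have "(\<zeta> - b) * (1 - inverse (\<zeta> * b)) = 0" by simp
  then have "b = \<zeta> \<or> inverse (\<zeta> * b) = 1" by auto
  then have cases: "b = \<zeta> \<or> \<zeta> * b = 1" by (metis inverse_1 inverse_inverse_eq)
  obtain a w where w: "odd w" "2 ^ a \<le> i" "Suc m ^ i = 1 + m * 2 ^ a * w"
    using succ_power_eq[OF four_dvd_m i(1)] by blast
  from cases show False
  proof
    assume "b = \<zeta>"
    then have "\<zeta> ^ (m * 2 ^ a * w) = 1"
      unfolding b_def w(3) power_add using zeta_nonzero[of n] by simp
    then have "m * 2 ^ e dvd m * (2 ^ a * w)"
      using zeta_power_eq_1_iff[OF n_pos] n_eq by (simp add: mult.assoc)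
    then have d: "2 ^ e dvd 2 ^ a * w" using m_pos by simp
    have "a < e" using w(2) i(2) by (metis le_less_trans nat_power_less_imp_less pos2)
    then have "2 ^ Suc a dvd (2 ^ e :: nat)" by (intro le_imp_power_dvd) simp
    then have "2 ^ a * 2 dvd 2 ^ a * w" using d dvd_trans by (metis power_Suc2)
    then have "2 dvd w" by simp
    then show False using w(1) by simp
  next
    assume "\<zeta> * b = 1"
    then have "\<zeta> ^ Suc (Suc m ^ i) = 1" by (simp add: b_def)
    then have "n dvd Suc (Suc m ^ i)" using zeta_power_eq_1_iff[OF n_pos] by blast
    moreover have "4 dvd n" unfolding n_eq using four_dvd_m by simp
    ultimately have "4 dvd Suc (Suc m ^ i)" using dvd_trans by blast
    then have "4 dvd 2 + m * 2 ^ a * w" unfolding w(3) by simp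
    moreover have "4 dvd m * 2 ^ a * w" using four_dvd_m by simp
    ultimately have "4 dvd (2 :: nat)" using dvd_add_left_iff by blast
    then show False by simp
  qed
qed

text \<open>B has to be real, so the Lagrange resolvent \<open>Bf\<close> is formed from powers of
  the real number \<zeta> + 1/\<zeta>. That it is nonzero for some power is seen by interpolation at
  the conjugates of this number, which are distinct.\<close>

lemma hilbert_90:
  assumes eps: "kr \<epsilon>" "Nm \<epsilon> = 1"
  shows "\<exists>B. kr B \<and> \<epsilon> * \<sigma> B = B"
proof -
  define c where "c i = (\<Prod>j<i. (\<sigma> ^^ j) \<epsilon>)" for i
  define Bf where "Bf t = (\<Sum>i<2 ^ e. c i * (\<sigma> ^^ i) t)" for t
  have eK: "\<epsilon> \<in> K" "\<epsilon> \<in> \<real>" using eps(1) by (auto simp: kr_def)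
  have sK: "(\<sigma> ^^ i) x \<in> K" if "x \<in> K" for i x by (rule is_aut_K[OF is_aut_sigma_pow that])
  have sR: "(\<sigma> ^^ i) x \<in> \<real>" if "x \<in> K" "x \<in> \<real>" for i x by (rule is_aut_real[OF is_aut_sigma_pow that])
  have cK: "c i \<in> K" for i unfolding c_def by (intro subring_C_prod[OF K_subring] sK eK)
  have cR: "c i \<in> \<real>" for i unfolding c_def by (intro prod_in_Reals sR eK)
  have cS: "\<epsilon> * \<sigma> (c i) = c (Suc i)" for i
    unfolding c_def prod.lessThan_Suc_shift by (subst is_aut_prod[OF is_aut_sigma]) (simp_all add: sK eK)
  have BK: "Bf t \<in> K" if "t \<in> K" for t
    unfolding Bf_def by (intro subring_C_sum[OF K_subring] subring_C_mult[OF K_subring] cK sK that)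
  have BR: "Bf t \<in> \<real>" if "t \<in> K" "t \<in> \<real>" for t
    unfolding Bf_def by (intro sum_in_Reals Reals_mult cR sR that)
  have fix_B: "\<epsilon> * \<sigma> (Bf t) = Bf t" if t: "t \<in> K" for t
  proof -
    define g where "g i = c i * (\<sigma> ^^ i) t" for i
    have gK: "g i \<in> K" for i unfolding g_def by (intro subring_C_mult[OF K_subring] cK sK t)
    have "\<epsilon> * \<sigma> (g i) = g (Suc i)" for i
      unfolding g_def is_aut_mult[OF is_aut_sigma cK sK[OF t]] cS[symmetric] by simp
    then have "\<epsilon> * \<sigma> (Bf t) = (\<Sum>i<2 ^ e. g (Suc i))"
      unfolding Bf_def g_def[symmetric] is_aut_sum[OF is_aut_sigma gK] sum_distrib_left by simp
    moreover have "g 0 + (\<Sum>i<2 ^ e. g (Suc i)) = (\<Sum>i<2 ^ e. g i) + g (2 ^ e)"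
      by (simp only: sum.lessThan_Suc[symmetric] sum.lessThan_Suc_shift[symmetric])
    moreover have "g 0 = t" by (simp add: g_def c_def)
    moreover have "g (2 ^ e) = t"
      using eps(2) sigma_pow_d[OF t] by (simp add: g_def c_def Nm_def)
    ultimately show ?thesis unfolding Bf_def g_def[symmetric] by simp
  qed
  define x where "x = \<zeta> + inverse \<zeta>"
  have xK: "x \<in> K" unfolding x_def by (intro K_closed)
  have xR: "x \<in> \<real>" unfolding x_def cnj_zeta[symmetric] by (simp add: complex_is_Real_iff)
  have "\<exists>j. Bf (x ^ j) \<noteq> 0"
  proof (rule ccontr)
    assume "\<not> ?thesis"
    then have B0: "Bf (x ^ j) = 0" for j by blast
    have all: "(\<Sum>i<2 ^ e. c i * poly p ((\<sigma> ^^ i) x)) = 0" for p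
    proof -
      have "(\<Sum>i<2 ^ e. c i * poly p ((\<sigma> ^^ i) x)) = (\<Sum>i<2 ^ e. \<Sum>j\<le>degree p. coeff p j * (c i * (\<sigma> ^^ i) (x ^ j)))"
        by (intro sum.cong refl)
           (simp add: poly_altdef sum_distrib_left is_aut_power[OF is_aut_sigma_pow xK] mult_ac)
      also have "\<dots> = (\<Sum>j\<le>degree p. coeff p j * Bf (x ^ j))"
        by (subst sum.swap) (simp add: Bf_def sum_distrib_left)
      finally show ?thesis by (simp add: B0)
    qed
    \<comment> \<open>p vanishes at every other conjugate of x, so only the term of index 0 is left,
      whose coefficient c 0 is 1.\<close>
    define p where "p = (\<Prod>i\<in>{1..<2 ^ e}. [:- (\<sigma> ^^ i) x, 1:])"
    have p: "poly p y = (\<Prod>i\<in>{1..<2 ^ e}. (y - (\<sigma> ^^ i) x))" for y by (simp add: p_def poly_prod)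
    have "(\<Sum>i<2 ^ e. c i * poly p ((\<sigma> ^^ i) x)) = c 0 * poly p ((\<sigma> ^^ 0) x)"
    proof (subst sum.remove[of _ 0])
      have "c i * poly p ((\<sigma> ^^ i) x) = 0" if "i \<in> {..<2 ^ e} - {0}" for i
      proof -
        have "i \<in> {1..<2 ^ e}" using that by auto
        then have "poly p ((\<sigma> ^^ i) x) = 0" unfolding p by (intro prod_zero) auto
        then show ?thesis by simp
      qed
      then have "(\<Sum>i\<in>{..<2 ^ e} - {0}. c i * poly p ((\<sigma> ^^ i) x)) = 0"
        by (intro sum.neutral) blast
      then show "c 0 * poly p ((\<sigma> ^^ 0) x) + (\<Sum>i\<in>{..<2 ^ e} - {0}. c i * poly p ((\<sigma> ^^ i) x)) =
         c 0 * poly p ((\<sigma> ^^ 0) x)" by simp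
    qed simp_all
    then have "poly p x = 0" using all by (simp add: c_def)
    then obtain i where "i \<in> {1..<2 ^ e}" "x - (\<sigma> ^^ i) x = 0" unfolding p by auto
    then show False using zeta_real_conjugates_distinct[of i] by (auto simp: x_def)
  qed
  then obtain j where j: "Bf (x ^ j) \<noteq> 0" by blast
  have xj: "x ^ j \<in> K" "x ^ j \<in> \<real>" using xK xR by (auto simp: K_closed)
  then have "kr (Bf (x ^ j))" using j BK BR by (simp add: kr_def)
  then show ?thesis using fix_B[OF xj(1)] by blast
qed

lemma Nm_mult: "x \<in> K \<Longrightarrow> y \<in> K \<Longrightarrow> Nm (x * y) = Nm x * Nm y"
  unfolding Nm_def prod.distrib[symmetric]
  by (intro prod.cong refl is_aut_mult[OF is_aut_sigma_pow])

lemma Nm_power: "x \<in> K \<Longrightarrow> Nm (x ^ k) = Nm x ^ k"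
  unfolding Nm_def prod_power_distrib by (intro prod.cong refl is_aut_power[OF is_aut_sigma_pow])

lemma Nm_sigma: assumes x: "x \<in> K" shows "Nm (\<sigma> x) = Nm x"
proof -
  define g where "g i = (\<sigma> ^^ i) x" for i
  have "g 0 * (\<Prod>i<2 ^ e. g (Suc i)) = (\<Prod>i<2 ^ e. g i) * g (2 ^ e)"
    by (simp only: prod.lessThan_Suc[symmetric] prod.lessThan_Suc_shift[symmetric])
  moreover have "g (2 ^ e) = x" unfolding g_def by (rule sigma_pow_d[OF x])
  moreover have "g 0 = x" by (simp add: g_def)
  ultimately have "x = 0 \<or> (\<Prod>i<2 ^ e. g (Suc i)) = (\<Prod>i<2 ^ e. g i)" by auto
  then show ?thesis
  proof
    assume "x = 0"
    then show ?thesis by (simp add: is_aut_0[OF is_aut_sigma])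
  next
    assume "(\<Prod>i<2 ^ e. g (Suc i)) = (\<Prod>i<2 ^ e. g i)"
    then show ?thesis unfolding Nm_def g_def by (simp add: funpow_swap1)
  qed
qed

lemma Nm_K: "x \<in> K \<Longrightarrow> Nm x \<in> K"
  unfolding Nm_def by (intro subring_C_prod[OF K_subring] is_aut_K[OF is_aut_sigma_pow])

lemma Nm_in_K0: assumes x: "x \<in> K" shows "Nm x \<in> K0"
proof (rule sigma_fixed[OF Nm_K[OF x]])
  have "\<sigma> (Nm x) = Nm (\<sigma> x)"
    unfolding Nm_def
    by (subst is_aut_prod[OF is_aut_sigma]) (simp_all add: is_aut_K[OF is_aut_sigma_pow x] funpow_swap1)
  then show "\<sigma> (Nm x) = Nm x" by (simp add: Nm_sigma[OF x])
qed

lemma Nm_nonzero: "x \<in> K \<Longrightarrow> x \<noteq> 0 \<Longrightarrow> Nm x \<noteq> 0"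
  unfolding Nm_def using is_aut_nonzero[OF is_aut_sigma_pow] by simp

lemma Nm_cnj: "x \<in> K \<Longrightarrow> Nm (cnj x) = cnj (Nm x)"
  unfolding Nm_def by (simp add: is_aut_cnj[OF is_aut_sigma_pow])

section \<open>Totally positive units are norms\<close>

definition pie :: complex where "pie = (1 + \<zeta>) * cnj (1 + \<zeta>)"

lemma one_plus_zeta: "1 + \<zeta> \<in> K" "1 + \<zeta> \<noteq> 0"
  using Runit_one_plus_zeta R_subset_K by (auto simp: Runit_def)

lemma Runit_pie: "Runit pie"
  unfolding pie_def by (intro Runit_mult Runit_cnj Runit_one_plus_zeta)

lemma tpos_pie: "tpos pie"
  unfolding pie_def by (rule tpos_norm[OF one_plus_zeta])

lemmas kr_pie = tpos_kr[OF tpos_pie]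

text \<open>A square root of \<sigma> \<pi> / \<pi>. As \<open>pie\<close> = (1 + \<zeta>)^2 /
  \<zeta>, the quotient of \<sigma> (1 + \<zeta>) by 1 + \<zeta> appears; the root of unity in front
  makes the square root real.\<close>

definition rho :: complex where
  "rho = inverse \<zeta> ^ (m div 2) * ((1 + \<zeta> ^ Suc m) / (1 + \<zeta>))"

lemma sigma_one_plus_zeta: "\<sigma> (1 + \<zeta>) = 1 + \<zeta> ^ Suc m"
  using is_aut_add[OF is_aut_sigma subring_C_1[OF K_subring] zeta_in_K] is_aut_1[OF is_aut_sigma]
    aut_zeta[OF coprime_succ_m] by simp

lemma pie_eq: "pie = (1 + \<zeta>) ^ 2 / \<zeta>"
  using zeta_nonzero[of n] by (simp add: pie_def cnj_zeta field_simps power2_eq_square)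

lemma rho_square: "rho ^ 2 = inverse \<zeta> ^ m * ((1 + \<zeta> ^ Suc m) / (1 + \<zeta>)) ^ 2"
proof -
  have "m div 2 * 2 = m" using m by auto
  then have "(inverse \<zeta> ^ (m div 2)) ^ 2 = inverse \<zeta> ^ m" by (simp only: flip: power_mult)
  then show ?thesis by (simp only: rho_def power_mult_distrib)
qed

lemma sigma_pie: "\<sigma> pie = pie * rho ^ 2"
proof -
  have "\<sigma> pie = (1 + \<zeta> ^ Suc m) ^ 2 / \<zeta> ^ Suc m"
    unfolding pie_eq
    by (simp only: is_aut_divide[OF is_aut_sigma] is_aut_power[OF is_aut_sigma] one_plus_zeta
        K_closed(7) zeta_in_K sigma_one_plus_zeta aut_zeta[OF coprime_succ_m])
  then show ?thesis
    unfolding rho_square pie_eq using one_plus_zeta zeta_nonzero[of n] by (simp add: field_simps power_inverse)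
qed

lemma kr_rho: "kr rho"
proof -
  have K: "1 + \<zeta> ^ Suc m \<in> K" by (intro K_closed)
  have z0: "\<zeta> \<noteq> 0" by (rule zeta_nonzero)
  have nz: "1 + \<zeta> ^ Suc m \<noteq> 0"
    using is_aut_nonzero[OF is_aut_sigma one_plus_zeta] unfolding sigma_one_plus_zeta .
  have mm: "m = m div 2 + m div 2" using m by auto
  have c1: "cnj (1 + \<zeta>) = (1 + \<zeta>) / \<zeta>" using z0 by (simp add: cnj_zeta field_simps)
  have c2: "cnj (1 + \<zeta> ^ Suc m) = (1 + \<zeta> ^ Suc m) / \<zeta> ^ Suc m" using z0 by (simp add: cnj_zeta power_inverse field_simps)
  have "cnj rho = \<zeta> ^ (m div 2) * (((1 + \<zeta> ^ Suc m) / \<zeta> ^ Suc m) / ((1 + \<zeta>) / \<zeta>))"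
    unfolding rho_def complex_cnj_mult complex_cnj_divide c1 c2 by (simp add: cnj_zeta)
  also have "\<dots> = (\<zeta> ^ (m div 2) / \<zeta> ^ m) * ((1 + \<zeta> ^ Suc m) / (1 + \<zeta>))"
  proof -
    have "a * ((x / \<zeta> ^ Suc m) / (y / \<zeta>)) = (a / \<zeta> ^ m) * (x / y)" for a x y :: complex
      using z0 by (cases "y = 0") (simp_all add: field_simps)
    then show ?thesis .
  qed
  also have "\<zeta> ^ (m div 2) / \<zeta> ^ m = inverse \<zeta> ^ (m div 2)"
    by (subst (2) mm) (use z0 in \<open>simp add: power_add power_inverse field_simps\<close>)
  finally have "cnj rho = rho" by (simp add: rho_def)
  then have "rho \<in> \<real>" by (simp add: Reals_cnj_iff)
  moreover have "rho \<in> K" unfolding rho_def by (intro K_closed(4,7,13,14) K one_plus_zeta zeta_in_K)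
  moreover have "rho \<noteq> 0" unfolding rho_def using z0 nz one_plus_zeta by simp
  ultimately show ?thesis by (simp add: kr_def)
qed

text \<open>A quotient \<sigma> x / x has norm 1, so only the root of unity counts. Its norm is the
  power of \<open>zeta m\<close> with exponent - u m / 2, where u = ((m + 1)^(2^e) - 1) / (m 2^e) is
  odd, that is, -1.\<close>

lemma Nm_rho: "Nm rho = - 1"
proof -
  have K: "1 + \<zeta> ^ Suc m \<in> K" by (intro K_closed)
  have nz: "Nm (1 + \<zeta>) \<noteq> 0" by (rule Nm_nonzero[OF one_plus_zeta])
  have "Nm (1 + \<zeta> ^ Suc m) = Nm (1 + \<zeta>)"
    using Nm_sigma[OF one_plus_zeta(1)] sigma_one_plus_zeta by simp
  moreover have "1 + \<zeta> ^ Suc m = ((1 + \<zeta> ^ Suc m) / (1 + \<zeta>)) * (1 + \<zeta>)" using one_plus_zeta by simp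
  ultimately have "Nm ((1 + \<zeta> ^ Suc m) / (1 + \<zeta>)) * Nm (1 + \<zeta>) = Nm (1 + \<zeta>)"
    using Nm_mult[OF K_divide[OF K one_plus_zeta(1)] one_plus_zeta(1)] by simp
  then have 1: "Nm ((1 + \<zeta> ^ Suc m) / (1 + \<zeta>)) = 1" using nz by simp
  have iK: "inverse \<zeta> \<in> K" by (intro K_inverse zeta_in_K)
  obtain u where u: "odd u" "Suc m ^ (2 ^ e) = 1 + m * 2 ^ e * u"
    using succ_power_two_power[OF four_dvd_m] by blast
  have geo: "Suc (m * (\<Sum>i<d. Suc m ^ i)) = Suc m ^ d" for d
    by (induction d) (simp_all add: algebra_simps)
  have "Suc (m * (\<Sum>i<2 ^ e. Suc m ^ i)) = Suc (m * (2 ^ e * u))"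
    unfolding geo u(2) by (simp add: mult.assoc)
  then have "m * (\<Sum>i<2 ^ e. Suc m ^ i) = m * (2 ^ e * u)" by (rule Suc_inject)
  then have geo': "(\<Sum>i<2 ^ e. Suc m ^ i) = 2 ^ e * u" using m_pos by simp
  have "Nm (inverse \<zeta>) = (\<Prod>i<2 ^ e. inverse \<zeta> ^ (Suc m ^ i))"
    unfolding Nm_def
    by (intro prod.cong refl) (simp add: is_aut_inverse[OF is_aut_sigma_pow zeta_in_K] sigma_pow_zeta power_inverse)
  also have "\<dots> = inverse \<zeta> ^ (2 ^ e * u)" by (simp only: power_sum[symmetric] geo')
  finally have "Nm (inverse \<zeta> ^ (m div 2)) = inverse ((\<zeta> ^ (2 ^ e)) ^ (m div 2) ^ 1) ^ u"
    unfolding Nm_power[OF iK] by (simp add: power_inverse mult_ac flip: power_mult)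
  also have "(\<zeta> ^ (2 ^ e)) ^ (m div 2) ^ 1 = (zeta m ^ (m div 4)) ^ 2"
    unfolding zeta_pow_d using m by (auto simp flip: power_mult)
  finally have 2: "Nm (inverse \<zeta> ^ (m div 2)) = - 1" using u(1) by (simp add: zeta_m_pow_m4)
  show ?thesis
    unfolding rho_def Nm_mult[OF subring_C_power[OF K_subring iK] K_divide[OF K one_plus_zeta(1)]] 1 2 by simp
qed


lemma square_class_norm_1:
  assumes mu: "Runit \<mu>" "tpos \<mu>" and eps: "kr \<epsilon>" "\<sigma> \<mu> = \<mu> * \<epsilon> ^ 2" "Nm \<epsilon> = 1"
  shows "\<exists>k y. kr y \<and> \<mu> = 2 ^ k * y ^ 2"
proof -
  obtain B where B: "kr B" "\<epsilon> * \<sigma> B = B" using hilbert_90[OF eps(1,3)] by blast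
  have K: "\<mu> \<in> K" "B \<in> K" using mu B by (auto simp: tpos_def kr_def)
  have K2: "B ^ 2 \<in> K" "\<mu> * B ^ 2 \<in> K"
    by (intro subring_C_mult[OF K_subring] subring_C_power[OF K_subring] K)+
  have "\<sigma> (\<mu> * B ^ 2) = \<mu> * (\<epsilon> * \<sigma> B) ^ 2"
    unfolding is_aut_mult[OF is_aut_sigma K(1) K2(1)] is_aut_power[OF is_aut_sigma K(2)] eps(2)
    by (simp add: power_mult_distrib)
  then have "\<mu> * B ^ 2 \<in> K0" unfolding B(2) by (rule sigma_fixed[OF K2(2)])
  then show ?thesis by (rule square_class_K0[OF mu B(1)])
qed

text \<open>If the norm of \<open>\<epsilon>\<close> is \<open>- 1\<close>, multiplying by \<^term>\<open>pie\<close> and \<^term>\<open>rho\<close> makes it \<open>1\<close>.\<close>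

lemma square_class_sigma_invariant:
  assumes mu: "Runit \<mu>" "tpos \<mu>" and eps: "kr \<epsilon>" "\<sigma> \<mu> = \<mu> * \<epsilon> ^ 2"
  shows "\<exists>k a y. kr y \<and> \<mu> = 2 ^ k * pie ^ a * y ^ 2"
proof -
  have K: "\<mu> \<in> K" "\<epsilon> \<in> K" "pie \<in> K" "rho \<in> K" and nz: "\<mu> \<noteq> 0" "pie \<noteq> 0"
    using tpos_kr[OF mu(2)] eps kr_pie kr_rho by (auto simp: kr_def)
  have "Nm \<mu> = Nm \<mu> * (Nm \<epsilon>) ^ 2"
    using Nm_sigma[OF K(1)] unfolding eps(2) Nm_mult[OF K(1) subring_C_power[OF K_subring K(2)]] Nm_power[OF K(2)]
    by simp
  then have "(Nm \<epsilon>) ^ 2 = 1" using Nm_nonzero[OF K(1) nz(1)] by simp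
  then consider "Nm \<epsilon> = 1" | "Nm \<epsilon> = - 1" by (auto simp: power2_eq_1_iff)
  then show ?thesis
  proof cases
    case 1
    then obtain k y where "kr y" "\<mu> = 2 ^ k * y ^ 2" using square_class_norm_1[OF mu eps] by blast
    then show ?thesis by (intro exI[of _ k] exI[of _ 0] exI[of _ y]) simp
  next
    case 2
    have "\<sigma> (\<mu> * pie) = \<mu> * pie * (\<epsilon> * rho) ^ 2"
      unfolding is_aut_mult[OF is_aut_sigma K(1,3)] eps(2) sigma_pie by (simp add: power_mult_distrib)
    moreover have "Nm (\<epsilon> * rho) = 1" unfolding Nm_mult[OF K(2,4)] Nm_rho 2 by simp
    ultimately obtain k y where y: "kr y" "\<mu> * pie = 2 ^ k * y ^ 2"
      using square_class_norm_1[OF Runit_mult[OF mu(1) Runit_pie] tpos_mult[OF mu(2) tpos_pie] kr_mult[OF eps(1) kr_rho]]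
      by blast
    have "\<mu> = 2 ^ k * pie ^ 1 * (y / pie) ^ 2"
      using y(2) nz by (simp add: power_divide field_simps power2_eq_square)
    then show ?thesis using kr_divide[OF y(1) kr_pie] by blast
  qed
qed

text \<open>The norm is the absolute square of 1 - \<open>zeta m\<close>: 2 for m = 4, and 2 - sqrt
  3 for m = 12, where (2 - sqrt 3)(1 + sqrt 3)^2 = 2. In both cases a square root would give one of
  2.\<close>

lemma Nm_pie_nonsquare:
  assumes e: "e > 0" and y: "y \<in> K0" shows "y ^ 2 \<noteq> Nm pie"
proof
  assume eq: "y ^ 2 = Nm pie"
  have "even (2 ^ e :: nat)" using e by simp
  then have "Nm (1 + \<zeta>) = 1 - zeta m" unfolding Nm_one_plus_zeta by simp
  then have N: "Nm pie = (1 - zeta m) * cnj (1 - zeta m)"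
    unfolding pie_def Nm_mult[OF one_plus_zeta(1) K_cnj[OF one_plus_zeta(1)]] Nm_cnj[OF one_plus_zeta(1)] by simp
  have y2: "y ^ 2 = (1 - zeta m) * cnj (1 - zeta m)" using eq N by simp
  from m show False
  proof
    assume m4: "m = 4"
    have "y ^ 2 = 2" unfolding y2 unfolding m4 zeta_4 by (simp add: complex_eq_iff)
    then show False using sqrt2_notin_Kfld[OF m y] by blast
  next
    assume m12: "m = 12"
    define r where "r = complex_of_real (sqrt 3)"
    have rr: "r * r = 3" by (simp add: r_def flip: of_real_mult)
    have "y ^ 2 = 2 - r" unfolding y2 unfolding m12 zeta_12 by (simp add: complex_eq_iff r_def algebra_simps)
    then have "(y * (1 + r)) ^ 2 = (2 - r) * ((1 + r) * (1 + r))"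
      by (simp add: power_mult_distrib power2_eq_square)
    also have "\<dots> = 2 + 3 * r - r * (r * r)" by (simp add: algebra_simps rr)
    finally have "(y * (1 + r)) ^ 2 = 2" by (simp add: rr)
    moreover have "y * (1 + r) \<in> K0"
    proof -
      have "r \<in> K0" unfolding m12 r_def Kfld_12_real by (rule bexI[of _ 0], rule bexI[of _ 1]) simp_all
      then show ?thesis by (intro subring_C_mult[OF K0_subring] subring_C_add[OF K0_subring] subring_C_1[OF K0_subring] y)
    qed
    ultimately show False using sqrt2_notin_Kfld[OF m] by blast
  qed
qed

text \<open>For e > 0 some power w of \<zeta> is a square root of \<i>, and w + cnj w is sqrt 2 up
  to sign.\<close>

lemma sqrt2_in_K: assumes e: "e > 0" obtains r where "kr r" "r ^ 2 = 2"
proof -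
  obtain e' where e': "e = Suc e'" using e by (cases e) auto
  define w where "w = \<zeta> ^ (2 ^ e' * (m div 4))"
  have "w ^ 2 = (\<zeta> ^ (2 ^ e)) ^ (m div 4)" by (simp add: w_def e' mult_ac flip: power_mult)
  then have w2: "w ^ 2 = \<i>" unfolding zeta_pow_d zeta_m_pow_m4 .
  have w0: "w \<noteq> 0" using zeta_nonzero[of n] by (simp add: w_def)
  have c: "cnj w = inverse w" by (simp add: w_def cnj_zeta power_inverse)
  have "(w + cnj w) ^ 2 = w ^ 2 + inverse (w ^ 2) + 2"
    unfolding c using w0 by (simp add: field_simps power2_eq_square)
  then have s: "(w + cnj w) ^ 2 = 2" unfolding w2 by simp
  have wK: "w \<in> K" unfolding w_def by (intro subring_C_power[OF K_subring] zeta_in_K)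
  have "w + cnj w \<in> K" by (intro subring_C_add[OF K_subring] K_cnj wK)
  moreover have "w + cnj w \<in> \<real>" by (simp add: complex_is_Real_iff)
  moreover have "w + cnj w \<noteq> 0"
  proof
    assume "w + cnj w = 0"
    then show False using s by simp
  qed
  ultimately show ?thesis using that[OF _ s] by (simp add: kr_def)
qed

text \<open>One step back along x -> \<sigma> x / x. The norm of \<sigma> \<mu> / \<mu> is 1, so an
  odd a would make the norm of \<open>pie\<close> a square in K0. With a even the class of \<mu> is
  fixed by \<sigma>, and the power of 2 is absorbed because 2 is a square.\<close>

lemma square_class_descent:
  assumes e: "e > 0" and mu: "Runit \<mu>" "tpos \<mu>" and d: "kr \<delta>" "\<sigma> \<mu> / \<mu> = pie ^ a * \<delta> ^ 2"
  shows "\<exists>a y. kr y \<and> \<mu> = pie ^ a * y ^ 2"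
proof -
  have K: "\<mu> \<in> K" "\<delta> \<in> K" "pie \<in> K" and nz: "\<mu> \<noteq> 0" "pie \<noteq> 0" "\<delta> \<noteq> 0"
    using tpos_kr[OF mu(2)] d kr_pie by (auto simp: kr_def)
  have s: "\<sigma> \<mu> = \<mu> * (pie ^ a * \<delta> ^ 2)" using d(2) nz by (simp add: field_simps)
  have Kp: "pie ^ a \<in> K" "\<delta> ^ 2 \<in> K" "pie ^ a * \<delta> ^ 2 \<in> K"
    by (intro subring_C_mult[OF K_subring] subring_C_power[OF K_subring] K)+
  have "Nm \<mu> = Nm \<mu> * (Nm pie ^ a * Nm \<delta> ^ 2)"
    using Nm_sigma[OF K(1)] unfolding s Nm_mult[OF K(1) Kp(3)] Nm_mult[OF Kp(1,2)] Nm_power[OF K(3)] Nm_power[OF K(2)]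
    by simp
  then have N1: "Nm pie ^ a * Nm \<delta> ^ 2 = 1" using Nm_nonzero[OF K(1) nz(1)] by simp
  have "even a"
  proof (rule ccontr)
    assume "odd a"
    then obtain c where c: "a = Suc (2 * c)" by (auto elim: oddE)
    define t where "t = Nm pie ^ c * Nm \<delta>"
    have "Nm pie * t ^ 2 = 1" using N1 by (simp add: c t_def power_mult_distrib power_mult[symmetric] mult_ac)
    then have "inverse (t ^ 2) = Nm pie"
      by (metis inverse_unique mult.commute)
    then have "inverse t ^ 2 = Nm pie" by (simp add: power_inverse)
    moreover have "inverse t \<in> K0"
      unfolding t_def by (intro subfield_C_inverse[OF K0_subfield] subring_C_mult[OF K0_subring] subring_C_power[OF K0_subring] Nm_in_K0 K)
    ultimately show False using Nm_pie_nonsquare[OF e] by blast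
  qed
  then obtain c where c: "a = 2 * c" by blast
  have "pie ^ a * \<delta> ^ 2 = (pie ^ c * \<delta>) ^ 2"
    unfolding c by (simp add: power_mult_distrib power_mult[symmetric] mult.commute)
  then have "\<sigma> \<mu> = \<mu> * (pie ^ c * \<delta>) ^ 2" using s by simp
  then obtain k b y where y: "kr y" "\<mu> = 2 ^ k * pie ^ b * y ^ 2"
    using square_class_sigma_invariant[OF mu kr_mult[OF kr_power[OF kr_pie] d(1)]] by blast
  obtain r where r: "kr r" "r ^ 2 = 2" using sqrt2_in_K[OF e] by blast
  have "\<mu> = pie ^ b * (r ^ k * y) ^ 2"
    unfolding y(2) r(2)[symmetric] by (simp add: power_mult_distrib mult_ac flip: power_mult)
  then show ?thesis using kr_mult[OF kr_power[OF r(1)] y(1)] by blast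
qed

section \<open>The operator x -> \<sigma> x / x modulo squares\<close>

definition Dn :: "complex \<Rightarrow> complex" where "Dn x = \<sigma> x / x"

text \<open>In the group ring modulo 2, \<open>(\<sigma> - 1)\<^sup>h = \<sigma>\<^sup>h - 1\<close> whenever \<open>h\<close> is a power of 2.\<close>

lemma Dn_pow_two_power:
  "kr x \<Longrightarrow> \<exists>s. kr s \<and> (Dn ^^ (2 ^ i)) x = (\<sigma> ^^ (2 ^ i)) x / x * s ^ 2"
proof (induction i arbitrary: x)
  case 0
  show ?case by (intro exI[of _ 1]) (simp add: Dn_def kr_1)
next
  case (Suc i)
  let ?h = "2 ^ i :: nat"
  note a = is_aut_sigma_pow[of ?h]
  obtain s where s: "kr s" "(Dn ^^ ?h) x = (\<sigma> ^^ ?h) x / x * s ^ 2" using Suc by blast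
  define X where "X = (\<sigma> ^^ ?h) x"
  define y where "y = X / x * s ^ 2"
  have X: "kr X" unfolding X_def by (rule kr_is_aut[OF a Suc(2)])
  have y: "kr y" unfolding y_def by (intro kr_mult kr_divide kr_power X Suc(2) s(1))
  obtain t where t: "kr t" "(Dn ^^ ?h) y = (\<sigma> ^^ ?h) y / y * t ^ 2" using Suc(1)[OF y] by blast
  have K: "x \<in> K" "X \<in> K" "s \<in> K" and nz: "x \<noteq> 0" "X \<noteq> 0" "s \<noteq> 0"
    using Suc(2) X s by (auto simp: kr_def)
  have yy: "(\<sigma> ^^ ?h) y = (\<sigma> ^^ ?h) X / X * ((\<sigma> ^^ ?h) s) ^ 2"
    unfolding y_def is_aut_mult[OF a K_divide[OF K(2,1)] subring_C_power[OF K_subring K(3)]]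
      is_aut_divide[OF a K(2,1)] is_aut_power[OF a K(3)] by (simp add: X_def)
  have e2: "2 ^ Suc i = ?h + ?h" by simp
  have "(Dn ^^ (2 ^ Suc i)) x = (Dn ^^ ?h) y"
    unfolding e2 funpow_add o_apply s(2) y_def X_def ..
  \<comment> \<open>Apart from the squares of s and t, this is \<sigma>^h X * x / X^2, that is,
    \<sigma>^h X / x times (x / X)^2.\<close>
  also have "\<dots> = (\<sigma> ^^ ?h) X / x * (x / X * (\<sigma> ^^ ?h) s / s * t) ^ 2"
    unfolding t(2) yy unfolding y_def using nz by (simp add: power_mult_distrib power_divide field_simps power2_eq_square)
  also have "(\<sigma> ^^ ?h) X = (\<sigma> ^^ (2 ^ Suc i)) x" unfolding e2 funpow_add o_apply X_def ..
  finally have "(Dn ^^ (2 ^ Suc i)) x = (\<sigma> ^^ (2 ^ Suc i)) x / x * (x / X * (\<sigma> ^^ ?h) s / s * t) ^ 2" .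
  moreover have "kr (x / X * (\<sigma> ^^ ?h) s / s * t)"
    by (rule kr_mult[OF kr_divide[OF kr_mult[OF kr_divide[OF Suc(2) X] kr_is_aut[OF a s(1)]] s(1)] t(1)])
  ultimately show ?case by blast
qed

text \<open>For e = 0 the map \<sigma> is the identity on K. Otherwise all iterates of
  \<open>Dn\<close> on \<mu> are totally positive units, the iterate of order 2^e is a square since
  \<sigma>^(2^e) is trivial, and the descent step leads back to \<mu>.\<close>

lemma tpos_unit_square_class:
  assumes mu: "Runit \<mu>" "tpos \<mu>"
  shows "\<exists>k a y. kr y \<and> \<mu> = 2 ^ k * pie ^ a * y ^ 2"
proof (cases "e = 0")
  case True
  have "\<sigma> \<mu> = \<mu> * 1 ^ 2" using sigma_pow_d[of \<mu>] mu(2) True by (simp add: tpos_def)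
  then show ?thesis by (rule square_class_sigma_invariant[OF mu kr_1])
next
  case False
  then have e: "e > 0" by simp
  have U: "Runit ((Dn ^^ i) \<mu>) \<and> tpos ((Dn ^^ i) \<mu>)" for i
  proof (induction i)
    case (Suc i)
    then show ?case
      using Runit_divide[OF Runit_is_aut[OF is_aut_sigma, of "(Dn ^^ i) \<mu>"], of "(Dn ^^ i) \<mu>"]
        tpos_divide[OF tpos_is_aut[OF _ is_aut_sigma, of "(Dn ^^ i) \<mu>"], of "(Dn ^^ i) \<mu>"]
      by (simp add: Dn_def[of "(Dn ^^ i) \<mu>"])
  qed (simp add: mu)
  \<comment> \<open>Truncated subtraction lets i run over all natural numbers; i = 2^e gives \<mu>
    itself, and beyond it nothing changes.\<close>
  have "\<exists>a y. kr y \<and> (Dn ^^ (2 ^ e - i)) \<mu> = pie ^ a * y ^ 2" for i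
  proof (induction i)
    case 0
    have krm: "kr \<mu>" by (rule tpos_kr[OF mu(2)])
    then have "\<mu> \<noteq> 0" "(\<sigma> ^^ (2 ^ e)) \<mu> = \<mu>" using sigma_pow_d by (auto simp: kr_def)
    then obtain t where "kr t" "(Dn ^^ (2 ^ e)) \<mu> = t ^ 2" using Dn_pow_two_power[OF krm, of e] by auto
    then show ?case by (intro exI[of _ 0] exI[of _ t]) simp
  next
    case (Suc i)
    show ?case
    proof (cases "i < 2 ^ e")
      case False
      then show ?thesis using Suc by simp
    next
      case True
      define j where "j = 2 ^ e - Suc i"
      have j: "2 ^ e - i = Suc j" using True by (simp add: j_def)
      obtain a y where "kr y" "(Dn ^^ Suc j) \<mu> = pie ^ a * y ^ 2" using Suc unfolding j by blast
      then have "kr y" "\<sigma> ((Dn ^^ j) \<mu>) / (Dn ^^ j) \<mu> = pie ^ a * y ^ 2"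
        by (simp_all add: Dn_def[of "(Dn ^^ j) \<mu>"])
      then show ?thesis unfolding j_def[symmetric] using square_class_descent[OF e] U by blast
    qed
  qed
  from this[of "2 ^ e"] obtain a y where "kr y" "\<mu> = pie ^ a * y ^ 2" by auto
  then show ?thesis by (intro exI[of _ 0] exI[of _ a] exI[of _ y]) simp
qed

text \<open>Each factor is a norm: 2 from 1 + \<i>, \<open>pie\<close> from 1 + \<zeta>, and y^2
  from the real y, which is a unit because its square is one.\<close>

theorem tpos_unit_is_norm:
  assumes mu: "Runit \<mu>" "tpos \<mu>"
  shows "\<exists>\<beta>. Runit \<beta> \<and> \<beta> * cnj \<beta> = \<mu>"
proof -
  obtain k a y where y: "kr y" "\<mu> = 2 ^ k * pie ^ a * y ^ 2" using tpos_unit_square_class[OF mu] by blast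
  have i: "Runit (1 + \<i>)"
    by (rule RunitI[of _ "(1 - \<i>) * (1 / 2)"])
       (simp_all only: subring_C_add[OF R_subring] subring_C_diff[OF R_subring] subring_C_mult[OF R_subring]
          subring_C_1[OF R_subring] half_in_R i_in_R, simp add: complex_eq_iff)
  have u: "Runit (2 ^ k * pie ^ a)" by (intro Runit_mult Runit_power Runit_2 Runit_pie)
  then have "y ^ 2 = \<mu> / (2 ^ k * pie ^ a)" using y(2) by (simp add: Runit_def)
  then have "Runit (y ^ 2)" using Runit_divide[OF mu(1) u] by simp
  moreover have "y \<in> K" using y(1) by (simp add: kr_def)
  ultimately have yu: "Runit y" by (rule Runit_sqrt[rotated])
  define \<beta> where "\<beta> = (1 + \<i>) ^ k * (1 + \<zeta>) ^ a * y"
  have "Runit \<beta>" unfolding \<beta>_def by (intro Runit_mult Runit_power i Runit_one_plus_zeta yu)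
  moreover have "\<beta> * cnj \<beta> = \<mu>"
  proof -
    have cy: "cnj y = y" using y(1) by (simp add: kr_def Reals_cnj_iff)
    have ii: "(1 + \<i>) * cnj (1 + \<i>) = 2" by (simp add: complex_eq_iff)
    have "\<beta> * cnj \<beta> = ((1 + \<i>) * cnj (1 + \<i>)) ^ k * ((1 + \<zeta>) * cnj (1 + \<zeta>)) ^ a * (y * cnj y)"
      unfolding \<beta>_def complex_cnj_mult complex_cnj_power power_mult_distrib by (simp only: mult_ac)
    then show ?thesis unfolding ii pie_def[symmetric] cy y(2) by (simp add: power2_eq_square)
  qed
  ultimately show ?thesis by blast
qed

end

section \<open>Unitary matrices and quaternions\<close>

text \<open>The quaternion r - u i - t j - s k attached to a matrix with first row x = r + s \<i>, y
  = t + u \<i>. With these signs matrix multiplication becomes \<open>qmul\<close>.\<close>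

definition row_quat :: "complex \<Rightarrow> complex \<Rightarrow> quat" where
  "row_quat x y = Quat (Re x) (- Im y) (- Re y) (- Im x)"

lemma qmul_row_quat:
  "qmul (row_quat x y) (row_quat x' y') = row_quat (x * x' - y * cnj y') (x * y' + y * cnj x')"
  by (simp add: qmul_def row_quat_def)

lemma row_quat_inj: "row_quat x y = row_quat x' y' \<longleftrightarrow> x = x' \<and> y = y'"
  by (auto simp: row_quat_def complex_eq_iff)

lemma qscale_row_quat: "qscale c (row_quat x y) = row_quat (complex_of_real c * x) (complex_of_real c * y)"
  by (simp add: qscale_def row_quat_def)

lemma qmul_qscale: "qmul (qscale c x) (qscale d y) = qscale (c * d) (qmul x y)"
  by (simp add: qmul_def qscale_def algebra_simps)

lemma qscale_qscale: "qscale c (qscale d x) = qscale (c * d) x"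
  by (simp add: qscale_def)

lemma qscale_1: "qscale 1 x = x"
  by (simp add: qscale_def)

definition qnorm :: "quat \<Rightarrow> real" where
  "qnorm x = q1 x ^ 2 + qi x ^ 2 + qj x ^ 2 + qk x ^ 2"

lemma qnorm_qmul: "qnorm (qmul x y) = qnorm x * qnorm y"
  by (simp add: qnorm_def qmul_def power2_eq_square algebra_simps)

lemma matrix_mult_2:
  fixes A B :: "complex^2^2"
  shows "(A ** B) $ i $ j = A $ i $ 1 * B $ 1 $ j + A $ i $ 2 * B $ 2 $ j"
  by (simp add: matrix_matrix_mult_def sum_2)

lemma matrix_eq_2:
  fixes A B :: "complex^2^2"
  shows "A = B \<longleftrightarrow> A $ 1 $ 1 = B $ 1 $ 1 \<and> A $ 1 $ 2 = B $ 1 $ 2 \<and> A $ 2 $ 1 = B $ 2 $ 1 \<and> A $ 2 $ 2 = B $ 2 $ 2"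
  by (auto simp: vec_eq_iff forall_2)

lemma unitary_2_iff:
  "A ** cadj A = mat 1 \<longleftrightarrow>
     A $ 1 $ 1 * cnj (A $ 1 $ 1) + A $ 1 $ 2 * cnj (A $ 1 $ 2) = 1 \<and>
     A $ 1 $ 1 * cnj (A $ 2 $ 1) + A $ 1 $ 2 * cnj (A $ 2 $ 2) = 0 \<and>
     A $ 2 $ 1 * cnj (A $ 1 $ 1) + A $ 2 $ 2 * cnj (A $ 1 $ 2) = 0 \<and>
     A $ 2 $ 1 * cnj (A $ 2 $ 1) + A $ 2 $ 2 * cnj (A $ 2 $ 2) = 1"
  by (simp add: matrix_eq_2 matrix_mult_2 cadj_def mat_def)

text \<open>The second row of a unitary matrix is determined by the first row and the determinant.
  After scaling by b with det A = cnj b / b, the rows are (x, y) and (- cnj y, cnj x), the shape on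
  which quaternion multiplication is modelled.\<close>

lemma unitary_2_second_row:
  assumes "A ** cadj A = mat 1"
  shows "A $ 2 $ 2 = det A * cnj (A $ 1 $ 1)" "A $ 2 $ 1 = - det A * cnj (A $ 1 $ 2)"
    "det A * cnj (det A) = 1"
proof -
  define a b c d where abcd: "a = A $ 1 $ 1" "b = A $ 1 $ 2" "c = A $ 2 $ 1" "d = A $ 2 $ 2"
  have u: "a * cnj a + b * cnj b = 1" "c * cnj a + d * cnj b = 0" "c * cnj c + d * cnj d = 1"
    using assms unfolding unitary_2_iff abcd by auto
  have D: "det A = a * d - b * c" by (simp add: det_2 abcd)
  have "det A * cnj a = (a * cnj a + b * cnj b) * d - b * (c * cnj a + d * cnj b)"
    unfolding D by (simp add: algebra_simps)
  then have 1: "det A * cnj a = d" using u by simp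
  have "- det A * cnj b = (a * cnj a + b * cnj b) * c - a * (c * cnj a + d * cnj b)"
    unfolding D by (simp add: algebra_simps)
  then have 2: "- det A * cnj b = c" using u by simp
  show "A $ 2 $ 2 = det A * cnj (A $ 1 $ 1)" "A $ 2 $ 1 = - det A * cnj (A $ 1 $ 2)"
    using 1 2 by (simp_all add: abcd)
  have "det A * cnj (det A) = (det A * cnj a) * cnj d + (- det A * cnj b) * cnj c"
    by (subst (2) D) (simp add: algebra_simps)
  also have "\<dots> = 1" unfolding 1 2 using u(3) by (simp add: add.commute)
  finally show "det A * cnj (det A) = 1" .
qed

context cyclo
begin

lemma Freal_iff': "x \<in> Freal n \<longleftrightarrow> complex_of_real x \<in> K"
  by (rule Freal_iff[OF n_pos])

lemma Rbreal_iff': "x \<in> Rbreal n \<longleftrightarrow> complex_of_real x \<in> R"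
  by (rule Rbreal_iff[OF n_pos])

lemma Freal_mult: "x \<in> Freal n \<Longrightarrow> y \<in> Freal n \<Longrightarrow> x * y \<in> Freal n"
  unfolding Freal_iff' of_real_mult by (rule subring_C_mult[OF K_subring])

lemma Freal_inverse: "x \<in> Freal n \<Longrightarrow> inverse x \<in> Freal n"
  unfolding Freal_iff' of_real_inverse by (rule K_inverse)

lemma Freal_1: "1 \<in> Freal n"
  unfolding Freal_iff' by (simp add: K_closed)

lemma Fcls_self: "x \<in> Fcls n x"
  unfolding Fcls_def using Freal_1 qscale_1[of x] by force

lemma Fcls_qscale:
  assumes c: "c \<in> Freal n" "c \<noteq> 0" shows "Fcls n (qscale c x) = Fcls n x"
proof (intro equalityI subsetI)
  fix y assume "y \<in> Fcls n (qscale c x)"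
  then obtain d where "d \<in> Freal n" "d \<noteq> 0" "y = qscale (d * c) x"
    by (auto simp: Fcls_def qscale_qscale)
  moreover have "d * c \<in> Freal n" using calculation(1) c(1) by (rule Freal_mult)
  ultimately show "y \<in> Fcls n x" using c(2) unfolding Fcls_def by force
next
  fix y assume "y \<in> Fcls n x"
  then obtain d where d: "d \<in> Freal n" "d \<noteq> 0" "y = qscale d x" by (auto simp: Fcls_def)
  have "d * inverse c \<in> Freal n" by (intro Freal_mult Freal_inverse d c)
  moreover have "y = qscale (d * inverse c) (qscale c x)" using c(2) by (simp add: qscale_qscale d mult.assoc)
  ultimately show "y \<in> Fcls n (qscale c x)" using c(2) d(2) unfolding Fcls_def by force
qed

lemma Fcls_qmul: "{qmul x y | x y. x \<in> Fcls n p \<and> y \<in> Fcls n q} = Fcls n (qmul p q)"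
proof (intro equalityI subsetI)
  fix z assume "z \<in> {qmul x y | x y. x \<in> Fcls n p \<and> y \<in> Fcls n q}"
  then obtain c d where cd: "c \<in> Freal n" "c \<noteq> 0" "d \<in> Freal n" "d \<noteq> 0" "z = qscale (c * d) (qmul p q)"
    by (auto simp: Fcls_def qmul_qscale)
  have "c * d \<in> Freal n" using cd(1,3) by (rule Freal_mult)
  then show "z \<in> Fcls n (qmul p q)" using cd unfolding Fcls_def by force
next
  fix z assume "z \<in> Fcls n (qmul p q)"
  then obtain c where c: "c \<in> Freal n" "c \<noteq> 0" "z = qscale c (qmul p q)" by (auto simp: Fcls_def)
  have "z = qmul (qscale c p) q" using qmul_qscale[of c p 1 q] by (simp add: c qscale_1)
  moreover have "qscale c p \<in> Fcls n p" using c unfolding Fcls_def by blast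
  ultimately show "z \<in> {qmul x y | x y. x \<in> Fcls n p \<and> y \<in> Fcls n q}" using Fcls_self by blast
qed

text \<open>The choice in \<open>phi\<close> is immaterial: two numbers b with the same cnj b / b
  have a real quotient, which disappears in the class. So a unit may take the place of the chosen
  number.\<close>

lemma phi_eq:
  assumes b: "\<beta> \<in> K" "\<beta> \<noteq> 0" "det A = cnj \<beta> / \<beta>"
  shows "phi n A = Fcls n (row_quat (\<beta> * A $ 1 $ 1) (\<beta> * A $ 1 $ 2))"
proof -
  define b where "b = (SOME b. b \<in> K \<and> b \<noteq> 0 \<and> det A = cnj b / b)"
  have b': "b \<in> K \<and> b \<noteq> 0 \<and> det A = cnj b / b"
    unfolding b_def by (rule someI[of _ \<beta>]) (use b in blast)
  define c where "c = b / \<beta>"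
  have "cnj b * \<beta> = cnj \<beta> * b" using b b' by (simp add: field_simps)
  then have "cnj c = c" using b by (simp add: c_def field_simps)
  then have c: "c = complex_of_real (Re c)" using Reals_eq_of_real_Re Reals_cnj_iff by blast
  have cK: "c \<in> K" unfolding c_def using b b' by (intro K_divide) blast+
  have c0: "c \<noteq> 0" using b b' by (simp add: c_def)
  have bc: "b = complex_of_real (Re c) * \<beta>" unfolding c[symmetric] using b(2) by (simp add: c_def)
  have "phi n A = Fcls n (row_quat (b * A $ 1 $ 1) (b * A $ 1 $ 2))"
    unfolding phi_def Let_def b_def[symmetric] row_quat_def by simp
  also have "row_quat (b * A $ 1 $ 1) (b * A $ 1 $ 2) = qscale (Re c) (row_quat (\<beta> * A $ 1 $ 1) (\<beta> * A $ 1 $ 2))"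
    unfolding qscale_row_quat bc by (simp add: mult.assoc)
  also have "Fcls n \<dots> = Fcls n (row_quat (\<beta> * A $ 1 $ 1) (\<beta> * A $ 1 $ 2))"
  proof (rule Fcls_qscale)
    show "Re c \<in> Freal n" unfolding Freal_iff' c[symmetric] by (rule cK)
    show "Re c \<noteq> 0" using c c0 by (metis of_real_0)
  qed
  finally show ?thesis .
qed

lemma U2_entries: "A \<in> U2 n \<Longrightarrow> A $ i $ j \<in> R" and U2_unitary: "A \<in> U2 n \<Longrightarrow> A ** cadj A = mat 1"
  by (auto simp: U2_def)

lemma U2_det:
  assumes A: "A \<in> U2 n" shows "\<exists>\<beta>. Runit \<beta> \<and> det A = cnj \<beta> / \<beta>"
proof (rule R_norm_one)
  show "det A \<in> R"
    unfolding det_2 by (intro subring_C_diff[OF R_subring] subring_C_mult[OF R_subring] U2_entries A)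
  show "det A * cnj (det A) = 1" by (rule unitary_2_second_row(3)[OF U2_unitary[OF A]])
qed

lemma Runit_K: "Runit x \<Longrightarrow> x \<in> K" and Runit_nonzero: "Runit x \<Longrightarrow> x \<noteq> 0"
  using R_subset_K by (auto simp: Runit_def)

lemma phi_mult:
  assumes A: "A \<in> U2 n" and B: "B \<in> U2 n"
  shows "phi n (A ** B) = {qmul x y | x y. x \<in> phi n A \<and> y \<in> phi n B}"
proof -
  obtain \<alpha> where a: "Runit \<alpha>" "det A = cnj \<alpha> / \<alpha>" using U2_det[OF A] by blast
  obtain \<beta> where b: "Runit \<beta>" "det B = cnj \<beta> / \<beta>" using U2_det[OF B] by blast
  note a' = Runit_K[OF a(1)] Runit_nonzero[OF a(1)] and b' = Runit_K[OF b(1)] Runit_nonzero[OF b(1)]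
  have "\<alpha> * \<beta> \<in> K" by (rule subring_C_mult[OF K_subring a'(1) b'(1)])
  moreover have "\<alpha> * \<beta> \<noteq> 0" using a' b' by simp
  moreover have "det (A ** B) = cnj (\<alpha> * \<beta>) / (\<alpha> * \<beta>)" by (simp add: det_mul a b)
  ultimately have AB: "phi n (A ** B) = Fcls n (row_quat (\<alpha> * \<beta> * (A ** B) $ 1 $ 1) (\<alpha> * \<beta> * (A ** B) $ 1 $ 2))"
    by (rule phi_eq)
  have B2: "\<beta> * B $ 2 $ 2 = cnj (\<beta> * B $ 1 $ 1)" "\<beta> * B $ 2 $ 1 = - cnj (\<beta> * B $ 1 $ 2)"
    using unitary_2_second_row(1,2)[OF U2_unitary[OF B]] b'(2) by (simp_all add: b)
  have "\<alpha> * \<beta> * (A ** B) $ 1 $ 1 = (\<alpha> * A $ 1 $ 1) * (\<beta> * B $ 1 $ 1) + (\<alpha> * A $ 1 $ 2) * (\<beta> * B $ 2 $ 1)"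
    "\<alpha> * \<beta> * (A ** B) $ 1 $ 2 = (\<alpha> * A $ 1 $ 1) * (\<beta> * B $ 1 $ 2) + (\<alpha> * A $ 1 $ 2) * (\<beta> * B $ 2 $ 2)"
    by (simp_all add: matrix_mult_2 algebra_simps)
  then have "row_quat (\<alpha> * \<beta> * (A ** B) $ 1 $ 1) (\<alpha> * \<beta> * (A ** B) $ 1 $ 2) =
      qmul (row_quat (\<alpha> * A $ 1 $ 1) (\<alpha> * A $ 1 $ 2)) (row_quat (\<beta> * B $ 1 $ 1) (\<beta> * B $ 1 $ 2))"
    unfolding qmul_row_quat B2 by simp
  then show ?thesis
    unfolding AB phi_eq[OF a' a(2)] phi_eq[OF b' b(2)] Fcls_qmul by simp
qed

text \<open>A complex scalar between two unitary matrices over R is a quotient of entries, hence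
  lies in K, and c * cnj c = 1. Conversely equal classes make the first rows proportional, and the
  second rows follow from unitarity.\<close>

lemma phi_eq_iff:
  assumes A: "A \<in> U2 n" and B: "B \<in> U2 n"
  shows "phi n A = phi n B \<longleftrightarrow> (\<exists>c::complex. B = (\<chi> i j. c * A $ i $ j))"
proof
  obtain \<alpha> where a: "Runit \<alpha>" "det A = cnj \<alpha> / \<alpha>" using U2_det[OF A] by blast
  note a' = Runit_K[OF a(1)] Runit_nonzero[OF a(1)]
  have rowA: "A $ 1 $ 1 * cnj (A $ 1 $ 1) + A $ 1 $ 2 * cnj (A $ 1 $ 2) = 1"
    using U2_unitary[OF A] unfolding unitary_2_iff by blast
  have rowB: "B $ 1 $ 1 * cnj (B $ 1 $ 1) + B $ 1 $ 2 * cnj (B $ 1 $ 2) = 1"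
    using U2_unitary[OF B] unfolding unitary_2_iff by blast
  {
    assume "\<exists>c::complex. B = (\<chi> i j. c * A $ i $ j)"
    then obtain c where "B = (\<chi> i j. c * A $ i $ j)" by blast
    then have c: "B $ i $ j = c * A $ i $ j" for i j by simp
    have "(c * cnj c) * (A $ 1 $ 1 * cnj (A $ 1 $ 1) + A $ 1 $ 2 * cnj (A $ 1 $ 2)) = 1"
      using rowB unfolding c by (simp add: algebra_simps)
    then have cc: "c * cnj c = 1" unfolding rowA by simp
    then have c0: "c \<noteq> 0" by auto
    have "A $ 1 $ 1 \<noteq> 0 \<or> A $ 1 $ 2 \<noteq> 0" using rowA by auto
    then obtain j where "A $ 1 $ j \<noteq> 0" by blast
    then have "c = B $ 1 $ j / A $ 1 $ j" by (simp add: c)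
    moreover have "A $ 1 $ j \<in> K" "B $ 1 $ j \<in> K"
      using U2_entries[OF A] U2_entries[OF B] R_subset_K by blast+
    ultimately have cK: "c \<in> K" by (simp add: K_divide)
    have "det B = c * c * det A" by (simp add: det_2 c algebra_simps)
    \<comment> \<open>With c * cnj c = 1 the factor c * c equals c / cnj c, so \<alpha> / c plays
      the part of \<alpha> for B.\<close>
    also have "\<dots> = cnj (\<alpha> / c) / (\<alpha> / c)"
      using cc c0 a'(2) by (simp add: a field_simps)
    finally have "phi n B = Fcls n (row_quat (\<alpha> / c * B $ 1 $ 1) (\<alpha> / c * B $ 1 $ 2))"
      using a' c0 by (intro phi_eq K_divide cK) simp_all
    then show "phi n A = phi n B" unfolding phi_eq[OF a' a(2)] c using c0 by simp
  next
    obtain \<beta> where b: "Runit \<beta>" "det B = cnj \<beta> / \<beta>" using U2_det[OF B] by blast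
    note b' = Runit_K[OF b(1)] Runit_nonzero[OF b(1)]
    assume "phi n A = phi n B"
    then have "row_quat (\<alpha> * A $ 1 $ 1) (\<alpha> * A $ 1 $ 2) \<in> Fcls n (row_quat (\<beta> * B $ 1 $ 1) (\<beta> * B $ 1 $ 2))"
      using Fcls_self unfolding phi_eq[OF a' a(2)] phi_eq[OF b' b(2)] by blast
    then obtain t where t: "t \<noteq> 0" "row_quat (\<alpha> * A $ 1 $ 1) (\<alpha> * A $ 1 $ 2) = qscale t (row_quat (\<beta> * B $ 1 $ 1) (\<beta> * B $ 1 $ 2))"
      unfolding Fcls_def by blast
    define T where "T = complex_of_real t"
    have T: "T \<noteq> 0" "cnj T = T" using t(1) by (simp_all add: T_def)
    have eq: "\<alpha> * A $ 1 $ 1 = T * (\<beta> * B $ 1 $ 1)" "\<alpha> * A $ 1 $ 2 = T * (\<beta> * B $ 1 $ 2)"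
      using t(2) unfolding qscale_row_quat row_quat_inj T_def by blast+
    define c where "c = \<alpha> / (T * \<beta>)"
    have B1: "B $ 1 $ 1 = c * A $ 1 $ 1" "B $ 1 $ 2 = c * A $ 1 $ 2"
      using eq T(1) b'(2) by (simp_all add: c_def field_simps)
    have dc: "det B * cnj c = c * det A"
      unfolding b(2) a(2) c_def using T a'(2) b'(2) by (simp add: field_simps)
    have B2: "B $ 2 $ 1 = c * A $ 2 $ 1" "B $ 2 $ 2 = c * A $ 2 $ 2"
    proof -
      have "B $ 2 $ 1 = - (det B * cnj c) * cnj (A $ 1 $ 2)" "B $ 2 $ 2 = (det B * cnj c) * cnj (A $ 1 $ 1)"
        unfolding unitary_2_second_row(1,2)[OF U2_unitary[OF B]] B1 by (simp_all add: mult_ac)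
      then show "B $ 2 $ 1 = c * A $ 2 $ 1" "B $ 2 $ 2 = c * A $ 2 $ 2"
        unfolding dc unitary_2_second_row(1,2)[OF U2_unitary[OF A]] by simp_all
    qed
    have "B = (\<chi> i j. c * A $ i $ j)" unfolding matrix_eq_2 using B1 B2 by simp
    then show "\<exists>c::complex. B = (\<chi> i j. c * A $ i $ j)" by blast
  }
qed

section \<open>The order, its units and the image\<close>

lemma Rb_add: "x \<in> Rbreal n \<Longrightarrow> y \<in> Rbreal n \<Longrightarrow> x + y \<in> Rbreal n"
  and Rb_diff: "x \<in> Rbreal n \<Longrightarrow> y \<in> Rbreal n \<Longrightarrow> x - y \<in> Rbreal n"
  and Rb_mult: "x \<in> Rbreal n \<Longrightarrow> y \<in> Rbreal n \<Longrightarrow> x * y \<in> Rbreal n"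
  unfolding Rbreal_iff' of_real_add of_real_diff of_real_mult
  by (rule subring_C_add[OF R_subring], assumption+, rule subring_C_diff[OF R_subring], assumption+,
      rule subring_C_mult[OF R_subring], assumption+)

lemma Rb_uminus: "x \<in> Rbreal n \<Longrightarrow> - x \<in> Rbreal n"
  unfolding Rbreal_iff' of_real_minus by (rule subring_C_uminus[OF R_subring])

lemma Rb_half: "1 / 2 \<in> Rbreal n"
  unfolding Rbreal_iff' using half_in_R by simp

lemma Rb_Re: assumes "x \<in> R" shows "Re x \<in> Rbreal n"
proof -
  have "1 / 2 * (x + cnj x) \<in> R"
    by (intro subring_C_mult[OF R_subring] subring_C_add[OF R_subring] half_in_R R_cnj assms)
  also have "1 / 2 * (x + cnj x) = complex_of_real (Re x)" by (simp add: complex_eq_iff)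
  finally show ?thesis unfolding Rbreal_iff' .
qed

lemma Rb_Im: assumes "x \<in> R" shows "Im x \<in> Rbreal n"
proof -
  have "- \<i> * x \<in> R" by (intro subring_C_mult[OF R_subring] subring_C_uminus[OF R_subring] i_in_R assms)
  from Rb_Re[OF this] show ?thesis by simp
qed

lemma R_Complex: assumes "a \<in> Rbreal n" "b \<in> Rbreal n" shows "Complex a b \<in> R"
  unfolding Complex_eq using assms unfolding Rbreal_iff'
  by (intro subring_C_add[OF R_subring] subring_C_mult[OF R_subring] i_in_R)

text \<open>Because 1/2 lies in the ring, adjoining (1 + i + j + k)/2 gives nothing beyond the
  quaternions with coordinates in that ring.\<close>

lemma Mtilde_iff:
  "x \<in> Mtilde n \<longleftrightarrow> q1 x \<in> Rbreal n \<and> qi x \<in> Rbreal n \<and> qj x \<in> Rbreal n \<and> qk x \<in> Rbreal n"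
proof
  assume "x \<in> Mtilde n"
  then obtain a b c d where *: "a \<in> Rbreal n" "b \<in> Rbreal n" "c \<in> Rbreal n" "d \<in> Rbreal n"
    "x = Quat (a + d/2) (b + d/2) (c + d/2) (d/2)" unfolding Mtilde_def by blast
  have "d / 2 \<in> Rbreal n" using Rb_mult[OF *(4) Rb_half] by simp
  then show "q1 x \<in> Rbreal n \<and> qi x \<in> Rbreal n \<and> qj x \<in> Rbreal n \<and> qk x \<in> Rbreal n"
    unfolding *(5) quat.sel by (intro conjI Rb_add *)
next
  assume *: "q1 x \<in> Rbreal n \<and> qi x \<in> Rbreal n \<and> qj x \<in> Rbreal n \<and> qk x \<in> Rbreal n"
  define d where "d = 2 * qk x"
  have "d \<in> Rbreal n" using Rb_add[of "qk x" "qk x"] * by (simp add: d_def)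
  moreover have "x = Quat ((q1 x - qk x) + d/2) ((qi x - qk x) + d/2) ((qj x - qk x) + d/2) (d/2)"
    by (cases x) (simp add: d_def)
  moreover have "q1 x - qk x \<in> Rbreal n" "qi x - qk x \<in> Rbreal n" "qj x - qk x \<in> Rbreal n"
    using * by (simp_all add: Rb_diff)
  ultimately show "x \<in> Mtilde n" unfolding Mtilde_def by blast
qed

lemma phi_image_subset:
  assumes A: "A \<in> U2 n" shows "phi n A \<in> Fcls n ` Mtilde_units n"
proof -
  obtain \<beta> where b: "Runit \<beta>" "det A = cnj \<beta> / \<beta>" using U2_det[OF A] by blast
  note b' = Runit_K[OF b(1)] Runit_nonzero[OF b(1)]
  define x y where "x = \<beta> * A $ 1 $ 1" and "y = \<beta> * A $ 1 $ 2"
  have xy: "x \<in> R" "y \<in> R"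
    unfolding x_def y_def using b(1) U2_entries[OF A] by (auto simp: Runit_def intro!: subring_C_mult[OF R_subring])
  have rowA: "A $ 1 $ 1 * cnj (A $ 1 $ 1) + A $ 1 $ 2 * cnj (A $ 1 $ 2) = 1"
    using U2_unitary[OF A] unfolding unitary_2_iff by blast
  have "x * cnj x + y * cnj y = (\<beta> * cnj \<beta>) * (A $ 1 $ 1 * cnj (A $ 1 $ 1) + A $ 1 $ 2 * cnj (A $ 1 $ 2))"
    by (simp add: x_def y_def algebra_simps)
  then have nu: "x * cnj x + y * cnj y = \<beta> * cnj \<beta>" unfolding rowA by simp
  define \<mu> where "\<mu> = inverse (\<beta> * cnj \<beta>)"
  have "Runit (\<beta> * cnj \<beta>)" by (intro Runit_mult Runit_cnj b)
  then have muR: "\<mu> \<in> R" and "\<beta> * cnj \<beta> \<noteq> 0" unfolding \<mu>_def Runit_def by blast+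
  then have mu1: "\<mu> * (x * cnj x + y * cnj y) = 1" unfolding nu \<mu>_def by (intro left_inverse)
  have muc: "cnj \<mu> = \<mu>" unfolding \<mu>_def by (simp add: mult.commute)
  define M where "M = row_quat x y"
  \<comment> \<open>The conjugate quaternion divided by the norm of M.\<close>
  define M' where "M' = row_quat (\<mu> * cnj x) (- \<mu> * y)"
  have "M \<in> Mtilde n"
    unfolding Mtilde_iff M_def row_quat_def quat.sel by (intro conjI Rb_uminus Rb_Re Rb_Im xy)
  moreover have "M' \<in> Mtilde n"
    unfolding Mtilde_iff M'_def row_quat_def quat.sel
    by (intro conjI Rb_uminus Rb_Re Rb_Im subring_C_mult[OF R_subring] subring_C_uminus[OF R_subring] R_cnj xy muR)
  moreover have "qmul M M' = qone" "qmul M' M = qone"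
  proof -
    have q1: "qone = row_quat 1 0" by (simp add: qone_def row_quat_def)
    have a1: "x * (\<mu> * cnj x) - y * cnj (- \<mu> * y) = \<mu> * (x * cnj x + y * cnj y)"
      by (simp add: muc algebra_simps)
    have a2: "x * (- \<mu> * y) + y * cnj (\<mu> * cnj x) = 0" by (simp add: muc algebra_simps)
    show "qmul M M' = qone" unfolding M_def M'_def qmul_row_quat q1 a1 a2 mu1 ..
    have a1: "\<mu> * cnj x * x - - \<mu> * y * cnj y = \<mu> * (x * cnj x + y * cnj y)" by (simp add: algebra_simps)
    have a2: "\<mu> * cnj x * y + - \<mu> * y * cnj x = 0" by (simp add: algebra_simps)
    show "qmul M' M = qone" unfolding M_def M'_def qmul_row_quat q1 a1 a2 mu1 ..
  qed
  ultimately have "M \<in> Mtilde_units n" unfolding Mtilde_units_def by blast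
  moreover have "phi n A = Fcls n M" unfolding M_def x_def y_def by (rule phi_eq[OF b' b(2)])
  ultimately show ?thesis by blast
qed

text \<open>The reduced norm of a unit is a unit, and it is totally positive as a sum of absolute
  squares x * cnj x + y * cnj y. Dividing by a \<beta> of that norm turns the quaternion into a
  unitary matrix.\<close>

lemma phi_image_superset:
  assumes M: "M \<in> Mtilde_units n" shows "Fcls n M \<in> phi n ` U2 n"
proof -
  obtain M' where MM: "M \<in> Mtilde n" "M' \<in> Mtilde n" "qmul M M' = qone"
    using M unfolding Mtilde_units_def by blast
  have MR: "q1 M \<in> Rbreal n" "qi M \<in> Rbreal n" "qj M \<in> Rbreal n" "qk M \<in> Rbreal n"
    and MR': "q1 M' \<in> Rbreal n" "qi M' \<in> Rbreal n" "qj M' \<in> Rbreal n" "qk M' \<in> Rbreal n"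
    using MM(1,2) unfolding Mtilde_iff by blast+
  define x y where "x = Complex (q1 M) (- qk M)" and "y = Complex (- qj M) (- qi M)"
  have xy: "x \<in> R" "y \<in> R" unfolding x_def y_def by (intro R_Complex Rb_uminus MR)+
  have Mq: "M = row_quat x y" by (cases M) (simp add: row_quat_def x_def y_def)
  have n1: "qnorm M * qnorm M' = 1"
    using qnorm_qmul[of M M'] unfolding MM(3) by (simp add: qnorm_def qone_def)
  have nR: "qnorm M \<in> Rbreal n" "qnorm M' \<in> Rbreal n"
    unfolding qnorm_def power2_eq_square by (intro Rb_add Rb_mult MR MR')+
  define \<nu> where "\<nu> = complex_of_real (qnorm M)"
  have nuxy: "\<nu> = x * cnj x + y * cnj y"
    by (simp add: \<nu>_def qnorm_def x_def y_def complex_eq_iff power2_eq_square)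
  have "\<nu> * complex_of_real (qnorm M') = 1" using n1 by (simp add: \<nu>_def flip: of_real_mult)
  then have nu: "Runit \<nu>" using nR unfolding Rbreal_iff' \<nu>_def by (intro RunitI)
  have xyK: "x \<in> K" "y \<in> K" using xy R_subset_K by blast+
  have "tpos \<nu>"
  proof -
    have "x \<noteq> 0 \<or> y \<noteq> 0" using nu unfolding nuxy by (auto simp: Runit_def)
    show ?thesis unfolding tpos_def
    proof (intro conjI allI impI)
      show "\<nu> \<in> K" by (rule Runit_K[OF nu])
      fix f assume f: "is_aut f"
      have fx: "f (z * cnj z) = complex_of_real ((cmod (f z))\<^sup>2)" if "z \<in> K" for z
        using is_aut_mult[OF f that K_cnj[OF that]] is_aut_cnj[OF f that] complex_norm_square[of "f z"] by simp
      have "f \<nu> = complex_of_real ((cmod (f x))\<^sup>2 + (cmod (f y))\<^sup>2)"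
        unfolding nuxy is_aut_add[OF f subring_C_mult[OF K_subring xyK(1) K_cnj[OF xyK(1)]]
            subring_C_mult[OF K_subring xyK(2) K_cnj[OF xyK(2)]]] fx[OF xyK(1)] fx[OF xyK(2)] by simp
      moreover have "f x \<noteq> 0 \<or> f y \<noteq> 0"
        using \<open>x \<noteq> 0 \<or> y \<noteq> 0\<close> is_aut_nonzero[OF f xyK(1)] is_aut_nonzero[OF f xyK(2)] by blast
      then have "(cmod (f x))\<^sup>2 + (cmod (f y))\<^sup>2 > 0" by (simp add: sum_power2_gt_zero_iff)
      ultimately show "f \<nu> \<in> \<real>" "Re (f \<nu>) > 0" by simp_all
    qed
  qed
  then obtain \<beta> where b: "Runit \<beta>" "\<beta> * cnj \<beta> = \<nu>" using tpos_unit_is_norm[OF nu] by blast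
  note b' = Runit_K[OF b(1)] Runit_nonzero[OF b(1)]
  define A :: "complex^2^2" where
    "A = (\<chi> i j. if i = 1 then (if j = 1 then x / \<beta> else y / \<beta>) else (if j = 1 then - cnj y / \<beta> else cnj x / \<beta>))"
  have A: "A $ 1 $ 1 = x / \<beta>" "A $ 1 $ 2 = y / \<beta>" "A $ 2 $ 1 = - cnj y / \<beta>" "A $ 2 $ 2 = cnj x / \<beta>"
    by (simp_all add: A_def)
  have "\<forall>i j. A $ i $ j \<in> R"
    unfolding forall_2 A divide_inverse using b(1) xy
    by (auto simp: Runit_def intro!: subring_C_mult[OF R_subring] subring_C_uminus[OF R_subring] R_cnj)
  moreover have "A ** cadj A = mat 1"
  proof -
    have *: "x * cnj x + y * cnj y = \<beta> * cnj \<beta>" using b(2) nuxy by simp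
    have "cnj \<beta> \<noteq> 0" using b' by simp
    then have "x / \<beta> * cnj (x / \<beta>) + y / \<beta> * cnj (y / \<beta>) = (x * cnj x + y * cnj y) / (\<beta> * cnj \<beta>)"
      "- cnj y / \<beta> * cnj (- cnj y / \<beta>) + cnj x / \<beta> * cnj (cnj x / \<beta>) = (x * cnj x + y * cnj y) / (\<beta> * cnj \<beta>)"
      using b' by (simp_all add: add_divide_distrib add.commute mult_ac)
    then show ?thesis
      unfolding unitary_2_iff A * using b' by (simp add: mult_ac)
  qed
  ultimately have "A \<in> U2 n" unfolding U2_def by blast
  moreover have "phi n A = Fcls n (row_quat (\<beta> * A $ 1 $ 1) (\<beta> * A $ 1 $ 2))"
  proof (rule phi_eq[OF b'])
    have "det A = (x * cnj x + y * cnj y) / (\<beta> * \<beta>)"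
      unfolding det_2 A by (simp add: add_divide_distrib)
    also have "\<dots> = cnj \<beta> / \<beta>" unfolding nuxy[symmetric] b(2)[symmetric] using b' by simp
    finally show "det A = cnj \<beta> / \<beta>" .
  qed
  moreover have "row_quat (\<beta> * A $ 1 $ 1) (\<beta> * A $ 1 $ 2) = M" unfolding A Mq using b' by simp
  ultimately show ?thesis by (metis imageI)
qed

end

theorem theorem3p25:
  fixes n :: nat
  assumes "\<exists>s::nat. n = 2 ^ s \<or> n = 3 * 2 ^ s"
    and "n \<ge> 8"
  shows "(\<forall>A \<in> U2 n. \<forall>B \<in> U2 n.
            phi n (A ** B) = {qmul x y | x y. x \<in> phi n A \<and> y \<in> phi n B})
       \<and> (\<forall>A \<in> U2 n. \<forall>B \<in> U2 n. phi n A = phi n B \<longleftrightarrow> (\<exists>c::complex. B = (\<chi> i j. c * A $ i $ j)))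
       \<and> phi n ` U2 n = Fcls n ` Mtilde_units n"
proof -
  obtain s :: nat where s: "n = 2 ^ s \<or> n = 3 * 2 ^ s" using assms(1) by blast
  have s2: "s \<ge> 2"
  proof (rule ccontr)
    assume "\<not> s \<ge> 2"
    then have "s = 0 \<or> s = 1" by auto
    then show False using s assms(2) by auto
  qed
  \<comment> \<open>Powers of 2 belong to the base field of order 4, the other values of n to that
    of order 12; two factors 2 go into m, which s \<ge> 2 allows.\<close>
  define m :: nat where "m = (if n = 2 ^ s then 4 else 12)"
  obtain t where "s = 2 + t" using s2 le_Suc_ex by blast
  then have "(2::nat) ^ s = 4 * 2 ^ (s - 2)" by (simp add: power_add)
  then have "n = m * 2 ^ (s - 2)" using s by (auto simp: m_def)
  then interpret cyclo m "s - 2" n by unfold_locales (auto simp: m_def)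
  show ?thesis
  proof (intro conjI ballI)
    show "phi n (A ** B) = {qmul x y | x y. x \<in> phi n A \<and> y \<in> phi n B}"
      if "A \<in> U2 n" "B \<in> U2 n" for A B by (rule phi_mult[OF that])
    show "phi n A = phi n B \<longleftrightarrow> (\<exists>c::complex. B = (\<chi> i j. c * A $ i $ j))"
      if "A \<in> U2 n" "B \<in> U2 n" for A B by (rule phi_eq_iff[OF that])
    show "phi n ` U2 n = Fcls n ` Mtilde_units n"
      using phi_image_subset phi_image_superset by blast
  qed
qed

end
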